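(* Let $K$ be a field, let $n\geq 3$ be an integer, let $S=K[x,y_1,\ldots,y_n,z]$, and let $$I=I_{D_{n+2}}=(y_iy_j-xz : 1\leq i<j\leq n)\subset S$$ be the join-meet ideal of the diamond lattice $D_{n+2}$. Then $I$ is a Gorenstein ideal, i.e. $S/I$ is a Gorenstein ring.
   Context: The diamond lattice $D_{n+2}$ is the lattice with $n+2$ elements $x,y_1,\ldots,y_n,z$, where $x$ is the maximum, $z$ is the minimum, and $y_1,\ldots,y_n$ are pairwise incomparable with $x>y_i>z$ for all $i$. Its join-meet ideal is the ideal $I$ displayed in the claim (lattice elements and variables are denoted by the same symbols). *)

theory Defs
  imports "HOL-Library.Poly_Mapping" "HOL-Algebra.QuotRing" "HOL-Algebra.Ring_Divisibility"
begin

section \<open>Modules and injective dimension\<close>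

definition mod_hom ::
  "('r, 'p) ring_scheme \<Rightarrow> ('r, 'm, 'q) module_scheme \<Rightarrow> ('r, 'n, 's) module_scheme \<Rightarrow> ('m \<Rightarrow> 'n) set"
  where "mod_hom R M N = {f \<in> carrier M \<rightarrow> carrier N.
    (\<forall>x \<in> carrier M. \<forall>y \<in> carrier M. f (x \<oplus>\<^bsub>M\<^esub> y) = f x \<oplus>\<^bsub>N\<^esub> f y) \<and>
    (\<forall>r \<in> carrier R. \<forall>x \<in> carrier M. f (r \<odot>\<^bsub>M\<^esub> x) = r \<odot>\<^bsub>N\<^esub> f x)}"

definition regular_module :: "('r, 'p) ring_scheme \<Rightarrow> ('r, 'r) module"
  where "regular_module R = \<lparr>carrier = carrier R, mult = mult R, one = one R,
    zero = zero R, add = add R, smult = mult R\<rparr>"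

text \<open>
  HOL cannot quantify over types inside a definition, so the modules over a ring with elements
  in \<open>'r\<close> that occur in the definitions of injectivity and of injective resolutions are those
  carried by subsets of \<open>(nat \<times> 'r) set\<close>. This is no restriction. The ring and all its ideals
  embed into this type, so by Baer's criterion injectivity within this universe agrees with
  injectivity with respect to all modules. Moreover the type has \<open>2 ^ \<kappa>\<close> elements with
  \<open>\<kappa> = max \<aleph>\<^sub>0 |'r|\<close>, and every module with at most that many elements embeds into an injective
  module with at most that many elements; hence a module of at most this cardinality which has
  a finite injective resolution at all has one of the same length in this universe. The
  ring components \<open>mult\<close> and \<open>one\<close> of a module record play no role.
\<close>

type_synonym 'r umodule = "('r, (nat \<times> 'r) set) module"

definition injective_module :: "('r, 'p) ring_scheme \<Rightarrow> 'r umodule \<Rightarrow> bool"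
  where "injective_module R E \<longleftrightarrow> module R E \<and>
    (\<forall>(M :: 'r umodule) (N :: 'r umodule) f g.
       module R M \<and> module R N \<and> f \<in> mod_hom R M N \<and> inj_on f (carrier M) \<and> g \<in> mod_hom R M E \<longrightarrow>
       (\<exists>h \<in> mod_hom R N E. \<forall>x \<in> carrier M. h (f x) = g x))"

text \<open>
  Exactness of \<open>0 \<rightarrow> M \<rightarrow> E 0 \<rightarrow> E 1 \<rightarrow> \<dots>\<close> with augmentation \<open>\<epsilon>\<close> and differentials \<open>\<delta> i\<close>,
  all \<open>E i\<close> being injective.
\<close>

definition injective_resolution ::
  "('r, 'p) ring_scheme \<Rightarrow> ('r, 'm, 'q) module_scheme \<Rightarrow> (nat \<Rightarrow> 'r umodule) \<Rightarrow>
    ('m \<Rightarrow> (nat \<times> 'r) set) \<Rightarrow> (nat \<Rightarrow> (nat \<times> 'r) set \<Rightarrow> (nat \<times> 'r) set) \<Rightarrow> bool"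
  where "injective_resolution R M E \<epsilon> \<delta> \<longleftrightarrow>
    (\<forall>i. injective_module R (E i)) \<and>
    \<epsilon> \<in> mod_hom R M (E 0) \<and> (\<forall>i. \<delta> i \<in> mod_hom R (E i) (E (Suc i))) \<and>
    inj_on \<epsilon> (carrier M) \<and>
    \<epsilon> ` carrier M = {e \<in> carrier (E 0). \<delta> 0 e = \<zero>\<^bsub>E 1\<^esub>} \<and>
    (\<forall>i. \<delta> i ` carrier (E i) = {e \<in> carrier (E (Suc i)). \<delta> (Suc i) e = \<zero>\<^bsub>E (Suc (Suc i))\<^esub>})"

definition finite_injective_dimension ::
  "('r, 'p) ring_scheme \<Rightarrow> ('r, 'm, 'q) module_scheme \<Rightarrow> bool"
  where "finite_injective_dimension R M \<longleftrightarrow> module R M \<and>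
    (\<exists>E \<epsilon> \<delta> d. injective_resolution R M E \<epsilon> \<delta> \<and> (\<forall>i > d. carrier (E i) = {\<zero>\<^bsub>E i\<^esub>}))"


section \<open>Localization at a prime ideal\<close>

text \<open>The fraction \<open>a / s\<close>, as the class of all pairs equivalent to \<open>(a, s)\<close>.\<close>

definition fraction :: "('a, 'p) ring_scheme \<Rightarrow> 'a set \<Rightarrow> 'a \<Rightarrow> 'a \<Rightarrow> ('a \<times> 'a) set"
  where "fraction R P a s = {(b, t). b \<in> carrier R \<and> t \<in> carrier R - P \<and>
    (\<exists>u \<in> carrier R - P. u \<otimes>\<^bsub>R\<^esub> (a \<otimes>\<^bsub>R\<^esub> t) = u \<otimes>\<^bsub>R\<^esub> (b \<otimes>\<^bsub>R\<^esub> s))}"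

text \<open>
  In \<open>mult\<close> and \<open>add\<close> all members of the union coincide, whichever representatives are used.
\<close>

definition localization :: "('a, 'p) ring_scheme \<Rightarrow> 'a set \<Rightarrow> ('a \<times> 'a) set ring"
  where "localization R P =
    \<lparr>carrier = {fraction R P a s | a s. a \<in> carrier R \<and> s \<in> carrier R - P},
     mult = (\<lambda>X Y. \<Union>(a, s) \<in> X. \<Union>(b, t) \<in> Y. fraction R P (a \<otimes>\<^bsub>R\<^esub> b) (s \<otimes>\<^bsub>R\<^esub> t)),
     one = fraction R P \<one>\<^bsub>R\<^esub> \<one>\<^bsub>R\<^esub>,
     zero = fraction R P \<zero>\<^bsub>R\<^esub> \<one>\<^bsub>R\<^esub>,
     add = (\<lambda>X Y. \<Union>(a, s) \<in> X. \<Union>(b, t) \<in> Y.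
       fraction R P (a \<otimes>\<^bsub>R\<^esub> t \<oplus>\<^bsub>R\<^esub> b \<otimes>\<^bsub>R\<^esub> s) (s \<otimes>\<^bsub>R\<^esub> t))\<rparr>"


section \<open>Gorenstein rings\<close>

text \<open>
  A Noetherian local ring is Gorenstein if it has finite injective dimension as a module over
  itself, and a Noetherian commutative ring is Gorenstein if all its localizations at prime
  ideals are (these are automatically Noetherian local rings).
\<close>

definition gorenstein_ring :: "('a, 'p) ring_scheme \<Rightarrow> bool"
  where "gorenstein_ring R \<longleftrightarrow> cring R \<and> noetherian_ring R \<and>
    (\<forall>P. primeideal P R \<longrightarrow>
       finite_injective_dimension (localization R P) (regular_module (localization R P)))"

definition gorenstein_ideal :: "('a, 'p) ring_scheme \<Rightarrow> 'a set \<Rightarrow> bool"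
  where "gorenstein_ideal S I \<longleftrightarrow> ideal I S \<and> gorenstein_ring (S Quot I)"


section \<open>Polynomial rings and the join-meet ideal of the diamond lattice\<close>

text \<open>
  Polynomials are finitely supported maps from exponent vectors to coefficients, with the
  convolution product; \<open>poly_ring V\<close> is the polynomial ring in the variables from \<open>V\<close>.
\<close>

definition poly_ring :: "'v set \<Rightarrow> (('v \<Rightarrow>\<^sub>0 nat) \<Rightarrow>\<^sub>0 'k::field) ring"
  where "poly_ring V = \<lparr>carrier = {p. \<forall>m \<in> Poly_Mapping.keys p. Poly_Mapping.keys m \<subseteq> V},
    mult = (*), one = 1, zero = 0, add = (+)\<rparr>"

definition pvar :: "'v \<Rightarrow> ('v \<Rightarrow>\<^sub>0 nat) \<Rightarrow>\<^sub>0 'k::field"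
  where "pvar v = Poly_Mapping.single (Poly_Mapping.single v 1) 1"

datatype diamond = elt_x | elt_y nat | elt_z

definition diamond_lattice :: "nat \<Rightarrow> diamond set"
  where "diamond_lattice n = {elt_x, elt_z} \<union> elt_y ` {1..n}"

definition diamond_ring :: "nat \<Rightarrow> ((diamond \<Rightarrow>\<^sub>0 nat) \<Rightarrow>\<^sub>0 'k::field) ring"
  where "diamond_ring n = poly_ring (diamond_lattice n)"

definition diamond_ideal :: "nat \<Rightarrow> ((diamond \<Rightarrow>\<^sub>0 nat) \<Rightarrow>\<^sub>0 'k::field) set"
  where "diamond_ideal n = genideal (diamond_ring n)
    {pvar (elt_y i) * pvar (elt_y j) - pvar elt_x * pvar elt_z | i j. 1 \<le> i \<and> i < j \<and> j \<le> n}"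

end

theory Submission
  imports Defs "HOL-Computational_Algebra.Polynomial"
begin

text \<open>
  Let \<open>A = S / I\<close> and write \<open>t = x z\<close>, \<open>c = x + z\<close> and \<open>u = y\<^sub>1\<^sup>2 + \<dots> + y\<^sub>n\<^sup>2 - (n - 1) t\<close>. The ring \<open>A\<close> is
  Gorenstein because it is a Frobenius algebra over the polynomial ring \<open>T = K[u, c]\<close>: it is a finitely
  generated projective (even free) \<open>T\<close>-module, and there is a \<open>T\<close>-linear form \<open>\<lambda> : A \<rightarrow> T\<close> for which
  \<open>a \<mapsto> \<lambda>(a _)\<close> is an isomorphism from \<open>A\<close> to \<open>Hom\<^sub>T(A, T)\<close>. Such a form comes with finitely many
  elements \<open>e\<^sub>j\<close> and dual elements \<open>e'\<^sub>j\<close> such that \<open>y = \<Sum>\<^sub>j \<lambda>(y e'\<^sub>j) e\<^sub>j\<close> for all \<open>y\<close>, and this single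
  identity carries the whole argument.

  \<^emph>\<open>The resolution.\<close> Let \<open>H = Hom\<^sub>K(A, T)\<close>, on which \<open>A\<close> acts through the argument. It is an injective
  \<open>A\<close>-module, being coinduced from the field \<open>K\<close>. For \<open>p\<close> equal to \<open>c\<close> or \<open>u\<close> let \<open>[p, h]\<close> be the map
  \<open>y \<mapsto> h(p y) - p h(y)\<close>. The sequence
  \<open>0 \<rightarrow> A \<rightarrow> H \<rightarrow> H \<times> H \<rightarrow> H \<rightarrow> 0\<close> with the maps \<open>a \<mapsto> \<lambda>(a _)\<close>, \<open>h \<mapsto> ([c, h], [u, h])\<close> and
  \<open>(f, g) \<mapsto> [u, f] - [c, g]\<close> is exact: the kernel of the second map is \<open>Hom\<^sub>T(A, T)\<close>, and the rest is the
  exactness of a Koszul complex, which the dual elements reduce from \<open>A\<close> to \<open>T\<close>, where the equations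
  \<open>[c, h] = k\<close> and \<open>[u, h] = k\<close> are solved by explicit recursion on the degree. So \<open>A\<close> has an injective
  resolution of length two (locale \<open>frobenius_presentation\<close>).

  \<^emph>\<open>Localization.\<close> Let \<open>S\<close> be the complement of a prime ideal \<open>P\<close> of a Noetherian ring \<open>A\<close> and \<open>E\<close> an
  injective \<open>A\<close>-module. The submodule of elements killed by some member of \<open>S\<close> is injective again, hence
  a direct summand. On a complement \<open>E'\<close> every element of \<open>S\<close> acts bijectively, so \<open>E'\<close> is a module over
  \<open>A\<^sub>P\<close>. It is the localization of \<open>E\<close> and injective over \<open>A\<^sub>P\<close> (\<open>localize_injective\<close>,
  \<open>loc_module_baer_injective\<close>). In this way the resolution of \<open>A\<close> becomes one of \<open>A\<^sub>P\<close>
  (\<open>finite_injective_dimension_localization\<close>). Injectivity is handled throughout by Baer's criterion,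
  and \<open>A\<close> is Noetherian by Hilbert's basis theorem.

  \<^emph>\<open>The form.\<close> The relations \<open>y\<^sub>i y\<^sub>j = x z\<close> equate monomials, so \<open>\<lambda>\<close> can be defined on monomials.
  Let \<open>B\<close> be the quotient of \<open>K[y\<^sub>1, \<dots>, y\<^sub>n]\<close> in which all products \<open>y\<^sub>i y\<^sub>j\<close> with \<open>i \<noteq> j\<close> become equal, with
  common value \<open>t\<close>; so \<open>A\<close> is \<open>B[x, z] / (x z - t)\<close>. The ring \<open>B\<close> is the coordinate ring of the union of the
  coordinate axes and the diagonal in affine \<open>n\<close>-space. A \<open>K\<close>-basis of it is formed by the powers
  of the \<open>y\<^sub>i\<close> and one further monomial \<open>t\<^sub>d\<close> in each degree \<open>d \<ge> 2\<close>, to which all products of degree \<open>d\<close> that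
  involve two different \<open>y\<^sub>i\<close> are equal. On \<open>B\<close> the form sends \<open>t\<^sub>d\<close> to
  \<open>u ^ ((d - 3) div 2)\<close> for odd \<open>d\<close> and all other basis elements to \<open>0\<close>. Since \<open>A\<close> is free over
  \<open>B[c]\<close> with basis \<open>1, x\<close>, where \<open>x\<^sup>2 = c x - t\<close>, the form is extended to \<open>A\<close> by taking it on the
  coefficient of \<open>x\<close>. With respect to it, \<open>1, y\<^sub>i, t - y\<^sub>i\<^sup>2, t y\<^sub>1\<close> is dual to \<open>t y\<^sub>1, t - y\<^sub>i\<^sup>2, y\<^sub>i, 1\<close> over \<open>K[u]\<close>, and \<open>1, x\<close> is dual to
  \<open>- z, 1\<close>; the products of these are the \<open>e\<^sub>j\<close> and \<open>e'\<^sub>j\<close> (\<open>basis_dual_pairing\<close>, \<open>expansion\<close>).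
\<close>

hide_const (open) Polynomial.smult

section \<open>Baer's criterion\<close>

lemma regular_module_simps [simp]:
  "carrier (regular_module R) = carrier R"
  "x \<oplus>\<^bsub>regular_module R\<^esub> y = x \<oplus>\<^bsub>R\<^esub> y"
  "\<zero>\<^bsub>regular_module R\<^esub> = \<zero>\<^bsub>R\<^esub>"
  "r \<odot>\<^bsub>regular_module R\<^esub> y = r \<otimes>\<^bsub>R\<^esub> y"
  by (simp_all add: regular_module_def)

lemma module_regular_module:
  assumes "cring R"
  shows "module R (regular_module R)"
proof -
  interpret cring R by fact
  show ?thesis
  proof (intro moduleI abelian_groupI)
    show "\<exists>y\<in>carrier (regular_module R). y \<oplus>\<^bsub>regular_module R\<^esub> x = \<zero>\<^bsub>regular_module R\<^esub>"
      if "x \<in> carrier (regular_module R)" for x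
      using that l_neg[of x] a_inv_closed[of x] by auto
  qed (auto simp: a_assoc l_distr r_distr m_assoc is_cring intro: a_comm)
qed

lemma mod_homI:
  assumes "\<And>x. x \<in> carrier M \<Longrightarrow> f x \<in> carrier N"
    and "\<And>x y. x \<in> carrier M \<Longrightarrow> y \<in> carrier M \<Longrightarrow> f (x \<oplus>\<^bsub>M\<^esub> y) = f x \<oplus>\<^bsub>N\<^esub> f y"
    and "\<And>r x. r \<in> carrier R \<Longrightarrow> x \<in> carrier M \<Longrightarrow> f (r \<odot>\<^bsub>M\<^esub> x) = r \<odot>\<^bsub>N\<^esub> f x"
  shows "f \<in> mod_hom R M N"
  using assms by (auto simp: mod_hom_def)

lemma mod_homD:
  assumes "f \<in> mod_hom R M N"
  shows "x \<in> carrier M \<Longrightarrow> f x \<in> carrier N"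
    and "x \<in> carrier M \<Longrightarrow> y \<in> carrier M \<Longrightarrow> f (x \<oplus>\<^bsub>M\<^esub> y) = f x \<oplus>\<^bsub>N\<^esub> f y"
    and "r \<in> carrier R \<Longrightarrow> x \<in> carrier M \<Longrightarrow> f (r \<odot>\<^bsub>M\<^esub> x) = r \<odot>\<^bsub>N\<^esub> f x"
  using assms by (auto simp: mod_hom_def)

lemma mod_hom_zero:
  assumes "module R M" "module R N" "f \<in> mod_hom R M N"
  shows "f \<zero>\<^bsub>M\<^esub> = \<zero>\<^bsub>N\<^esub>"
proof -
  interpret M: module R M by fact
  interpret N: module R N by fact
  have "f (\<zero>\<^bsub>R\<^esub> \<odot>\<^bsub>M\<^esub> \<zero>\<^bsub>M\<^esub>) = \<zero>\<^bsub>R\<^esub> \<odot>\<^bsub>N\<^esub> f \<zero>\<^bsub>M\<^esub>"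
    using mod_homD(3)[OF assms(3), of "\<zero>\<^bsub>R\<^esub>" "\<zero>\<^bsub>M\<^esub>"] by simp
  then show ?thesis
    using mod_homD(1)[OF assms(3)] by simp
qed

lemma mod_hom_compose:
  assumes "f \<in> mod_hom R M N" "g \<in> mod_hom R N L"
  shows "(\<lambda>x. g (f x)) \<in> mod_hom R M L"
  by (rule mod_homI) (use mod_homD[OF assms(1)] mod_homD[OF assms(2)] in auto)

text \<open>
  A homomorphism from a submodule of \<open>M\<close> to \<open>N\<close>, represented by its graph. In this form extensions are
  inclusions, unions of chains are again partial homomorphisms, and pulling back is taking a preimage.
\<close>

definition partial_hom ::
  "('r, 'p) ring_scheme \<Rightarrow> ('r, 'm, 'q) module_scheme \<Rightarrow> ('r, 'n, 's) module_scheme \<Rightarrow> ('m \<times> 'n) set \<Rightarrow> bool"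
  where "partial_hom R M N G \<longleftrightarrow> G \<subseteq> carrier M \<times> carrier N \<and> (\<zero>\<^bsub>M\<^esub>, \<zero>\<^bsub>N\<^esub>) \<in> G \<and>
    (\<forall>x a y b. (x, a) \<in> G \<and> (y, b) \<in> G \<longrightarrow> (x \<oplus>\<^bsub>M\<^esub> y, a \<oplus>\<^bsub>N\<^esub> b) \<in> G) \<and>
    (\<forall>r\<in>carrier R. \<forall>x a. (x, a) \<in> G \<longrightarrow> (r \<odot>\<^bsub>M\<^esub> x, r \<odot>\<^bsub>N\<^esub> a) \<in> G) \<and>
    (\<forall>a. (\<zero>\<^bsub>M\<^esub>, a) \<in> G \<longrightarrow> a = \<zero>\<^bsub>N\<^esub>)"

lemma partial_homI:
  assumes "G \<subseteq> carrier M \<times> carrier N" "(\<zero>\<^bsub>M\<^esub>, \<zero>\<^bsub>N\<^esub>) \<in> G"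
    and "\<And>x a y b. (x, a) \<in> G \<Longrightarrow> (y, b) \<in> G \<Longrightarrow> (x \<oplus>\<^bsub>M\<^esub> y, a \<oplus>\<^bsub>N\<^esub> b) \<in> G"
    and "\<And>r x a. r \<in> carrier R \<Longrightarrow> (x, a) \<in> G \<Longrightarrow> (r \<odot>\<^bsub>M\<^esub> x, r \<odot>\<^bsub>N\<^esub> a) \<in> G"
    and "\<And>a. (\<zero>\<^bsub>M\<^esub>, a) \<in> G \<Longrightarrow> a = \<zero>\<^bsub>N\<^esub>"
  shows "partial_hom R M N G"
  using assms unfolding partial_hom_def by blast

lemma partial_homD:
  assumes "partial_hom R M N G"
  shows "(x, a) \<in> G \<Longrightarrow> x \<in> carrier M" "(x, a) \<in> G \<Longrightarrow> a \<in> carrier N"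
    and "(\<zero>\<^bsub>M\<^esub>, \<zero>\<^bsub>N\<^esub>) \<in> G"
    and "(x, a) \<in> G \<Longrightarrow> (y, b) \<in> G \<Longrightarrow> (x \<oplus>\<^bsub>M\<^esub> y, a \<oplus>\<^bsub>N\<^esub> b) \<in> G"
    and "r \<in> carrier R \<Longrightarrow> (x, a) \<in> G \<Longrightarrow> (r \<odot>\<^bsub>M\<^esub> x, r \<odot>\<^bsub>N\<^esub> a) \<in> G"
    and "(\<zero>\<^bsub>M\<^esub>, a) \<in> G \<Longrightarrow> a = \<zero>\<^bsub>N\<^esub>"
  using assms unfolding partial_hom_def by blast+

lemma partial_hom_minus:
  assumes "module R M" "module R N" and G: "partial_hom R M N G" and "(x, a) \<in> G"
  shows "(\<ominus>\<^bsub>M\<^esub> x, \<ominus>\<^bsub>N\<^esub> a) \<in> G"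
proof -
  interpret M: module R M by fact
  interpret N: module R N by fact
  have "((\<ominus>\<^bsub>R\<^esub> \<one>\<^bsub>R\<^esub>) \<odot>\<^bsub>M\<^esub> x, (\<ominus>\<^bsub>R\<^esub> \<one>\<^bsub>R\<^esub>) \<odot>\<^bsub>N\<^esub> a) \<in> G"
    using partial_homD(5)[OF G _ assms(4)] by simp
  then show ?thesis
    using partial_homD(1,2)[OF G assms(4)] by (simp add: M.smult_l_minus N.smult_l_minus)
qed

lemma partial_hom_unique:
  assumes "module R M" "module R N" and G: "partial_hom R M N G" and "(x, a) \<in> G" "(x, b) \<in> G"
  shows "a = b"
proof -
  interpret M: module R M by fact
  interpret N: module R N by fact
  note c = partial_homD(1,2)[OF G assms(4)] partial_homD(1,2)[OF G assms(5)]
  have "(x \<oplus>\<^bsub>M\<^esub> \<ominus>\<^bsub>M\<^esub> x, a \<oplus>\<^bsub>N\<^esub> \<ominus>\<^bsub>N\<^esub> b) \<in> G"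
    using partial_homD(4)[OF G assms(4) partial_hom_minus[OF assms(1,2) G assms(5)]] .
  then have "a \<oplus>\<^bsub>N\<^esub> \<ominus>\<^bsub>N\<^esub> b = \<zero>\<^bsub>N\<^esub>"
    using partial_homD(6)[OF G] c by (simp add: M.M.r_neg)
  then show ?thesis
    using c by (metis N.M.add.inv_closed N.M.minus_minus N.M.minus_equality)
qed

lemma partial_hom_preimage:
  assumes L: "module R L" and M: "module R M" and f: "f \<in> mod_hom R L M" and G: "partial_hom R M N G"
  shows "partial_hom R L N {(x, a). x \<in> carrier L \<and> (f x, a) \<in> G}" (is "partial_hom R L N ?G")
proof (rule partial_homI)
  interpret L: module R L by fact
  note f0 = mod_hom_zero[OF L M f]
  show "?G \<subseteq> carrier L \<times> carrier N" using partial_homD(2)[OF G] by auto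
  show "(\<zero>\<^bsub>L\<^esub>, \<zero>\<^bsub>N\<^esub>) \<in> ?G" using partial_homD(3)[OF G] f0 by simp
  show "(x \<oplus>\<^bsub>L\<^esub> y, a \<oplus>\<^bsub>N\<^esub> b) \<in> ?G" if "(x, a) \<in> ?G" "(y, b) \<in> ?G" for x a y b
    using that partial_homD(4)[OF G, of "f x" a "f y" b] mod_homD(2)[OF f, of x y] by simp
  show "(r \<odot>\<^bsub>L\<^esub> x, r \<odot>\<^bsub>N\<^esub> a) \<in> ?G" if "r \<in> carrier R" "(x, a) \<in> ?G" for r x a
    using that partial_homD(5)[OF G, of r "f x" a] mod_homD(3)[OF f, of r x] by simp
  show "a = \<zero>\<^bsub>N\<^esub>" if "(\<zero>\<^bsub>L\<^esub>, a) \<in> ?G" for a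
    using that partial_homD(6)[OF G] f0 by simp
qed

lemma partial_hom_image:
  assumes L: "module R L" and M: "module R M" and N: "module R N"
    and f: "f \<in> mod_hom R L M" and g: "g \<in> mod_hom R L N"
    and ker: "\<And>x. x \<in> carrier L \<Longrightarrow> f x = \<zero>\<^bsub>M\<^esub> \<Longrightarrow> g x = \<zero>\<^bsub>N\<^esub>"
  shows "partial_hom R M N {(f x, g x) | x. x \<in> carrier L}" (is "partial_hom R M N ?G")
proof (rule partial_homI)
  interpret L: module R L by fact
  show "?G \<subseteq> carrier M \<times> carrier N" using mod_homD(1)[OF f] mod_homD(1)[OF g] by auto
  show "(\<zero>\<^bsub>M\<^esub>, \<zero>\<^bsub>N\<^esub>) \<in> ?G" using mod_hom_zero[OF L M f] mod_hom_zero[OF L N g] by force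
  show "(x \<oplus>\<^bsub>M\<^esub> y, a \<oplus>\<^bsub>N\<^esub> b) \<in> ?G" if "(x, a) \<in> ?G" "(y, b) \<in> ?G" for x a y b
    using that mod_homD(2)[OF f, symmetric] mod_homD(2)[OF g, symmetric] L.M.a_closed by fastforce
  show "(r \<odot>\<^bsub>M\<^esub> x, r \<odot>\<^bsub>N\<^esub> a) \<in> ?G" if r: "r \<in> carrier R" and "(x, a) \<in> ?G" for r x a
    using that mod_homD(3)[OF f r, symmetric] mod_homD(3)[OF g r, symmetric] L.smult_closed[OF r] by fastforce
  show "a = \<zero>\<^bsub>N\<^esub>" if "(\<zero>\<^bsub>M\<^esub>, a) \<in> ?G" for a
    using that ker by auto
qed

definition baer_injective :: "('r, 'p) ring_scheme \<Rightarrow> ('r, 'e, 's) module_scheme \<Rightarrow> bool"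
  where "baer_injective R E \<longleftrightarrow> (\<forall>G. partial_hom R (regular_module R) E G \<longrightarrow>
    (\<exists>e\<in>carrier E. \<forall>r x. (r, x) \<in> G \<longrightarrow> x = r \<odot>\<^bsub>E\<^esub> e))"

lemma baer_injectiveD:
  assumes "baer_injective R E" "partial_hom R (regular_module R) E G"
  obtains e where "e \<in> carrier E" "\<And>r x. (r, x) \<in> G \<Longrightarrow> x = r \<odot>\<^bsub>E\<^esub> e"
  using assms unfolding baer_injective_def by meson

lemma partial_hom_union_chain:
  assumes "C \<noteq> {}" and C: "subset.chain {G. partial_hom R M N G} C"
  shows "partial_hom R M N (\<Union>C)"
proof -
  have p: "partial_hom R M N G" if "G \<in> C" for G
    using C that by (auto simp: subset_chain_def)
  have tot: "G \<subseteq> H \<or> H \<subseteq> G" if "G \<in> C" "H \<in> C" for G H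
    using C that by (auto simp: subset_chain_def)
  show ?thesis
  proof (rule partial_homI)
    show "\<Union>C \<subseteq> carrier M \<times> carrier N"
      using partial_homD(1,2)[OF p] by fast
    show "(\<zero>\<^bsub>M\<^esub>, \<zero>\<^bsub>N\<^esub>) \<in> \<Union>C"
      using assms(1) partial_homD(3)[OF p] by blast
    show "(x \<oplus>\<^bsub>M\<^esub> y, a \<oplus>\<^bsub>N\<^esub> b) \<in> \<Union>C" if xa: "(x, a) \<in> \<Union>C" and yb: "(y, b) \<in> \<Union>C" for x a y b
    proof -
      obtain G H where GH: "G \<in> C" "H \<in> C" "(x, a) \<in> G" "(y, b) \<in> H" using xa yb by blast
      then obtain L where "L \<in> C" "(x, a) \<in> L" "(y, b) \<in> L" using tot[OF GH(1,2)] by blast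
      then show ?thesis using partial_homD(4)[OF p] by blast
    qed
    show "(r \<odot>\<^bsub>M\<^esub> x, r \<odot>\<^bsub>N\<^esub> a) \<in> \<Union>C" if "r \<in> carrier R" "(x, a) \<in> \<Union>C" for r x a
      using that partial_homD(5)[OF p] by blast
    show "a = \<zero>\<^bsub>N\<^esub>" if "(\<zero>\<^bsub>M\<^esub>, a) \<in> \<Union>C" for a
      using that partial_homD(6)[OF p] by blast
  qed
qed

text \<open>
  The ring elements that carry \<open>n\<close> into the domain of \<open>G\<close> form an ideal, and \<open>G\<close> induces a partial
  homomorphism on it. An element \<open>e\<close> of \<open>E\<close> by which the latter is given can be taken as the value at \<open>n\<close>.
\<close>

lemma baer_extend_one:
  assumes N: "module R N" and E: "module R E" and baer: "baer_injective R E"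
    and G: "partial_hom R N E G" and n: "n \<in> carrier N"
  obtains H e where "partial_hom R N E H" "G \<subseteq> H" "(n, e) \<in> H"
proof -
  interpret N: module R N by fact
  interpret E: module R E by fact
  have RM: "module R (regular_module R)" by (rule module_regular_module) unfold_locales
  let ?J = "{(r, x). r \<in> carrier (regular_module R) \<and> (r \<odot>\<^bsub>N\<^esub> n, x) \<in> G}"
  have "(\<lambda>r. r \<odot>\<^bsub>N\<^esub> n) \<in> mod_hom R (regular_module R) N"
    by (rule mod_homI) (use n in \<open>simp_all add: N.smult_l_distr N.smult_assoc1\<close>)
  then have "partial_hom R (regular_module R) E ?J" by (rule partial_hom_preimage[OF RM N _ G])
  then obtain e where e: "e \<in> carrier E" and eJ: "\<And>r x. (r, x) \<in> ?J \<Longrightarrow> x = r \<odot>\<^bsub>E\<^esub> e"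
    by (rule baer_injectiveD[OF baer]) blast
  have eG: "x = r \<odot>\<^bsub>E\<^esub> e" if "r \<in> carrier R" "(r \<odot>\<^bsub>N\<^esub> n, x) \<in> G" for r x
    using that eJ by simp
  let ?H = "{(m \<oplus>\<^bsub>N\<^esub> r \<odot>\<^bsub>N\<^esub> n, a \<oplus>\<^bsub>E\<^esub> r \<odot>\<^bsub>E\<^esub> e) | m a r. (m, a) \<in> G \<and> r \<in> carrier R}"
  have H: "partial_hom R N E ?H"
  proof (rule partial_homI)
    show "?H \<subseteq> carrier N \<times> carrier E"
      using partial_homD(1,2)[OF G] n e by fastforce
    have "(\<zero>\<^bsub>N\<^esub>, \<zero>\<^bsub>E\<^esub>) = (\<zero>\<^bsub>N\<^esub> \<oplus>\<^bsub>N\<^esub> \<zero>\<^bsub>R\<^esub> \<odot>\<^bsub>N\<^esub> n, \<zero>\<^bsub>E\<^esub> \<oplus>\<^bsub>E\<^esub> \<zero>\<^bsub>R\<^esub> \<odot>\<^bsub>E\<^esub> e)"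
      using n e by simp
    then show "(\<zero>\<^bsub>N\<^esub>, \<zero>\<^bsub>E\<^esub>) \<in> ?H"
      using partial_homD(3)[OF G] by blast
    show "(x \<oplus>\<^bsub>N\<^esub> y, a \<oplus>\<^bsub>E\<^esub> b) \<in> ?H" if xa: "(x, a) \<in> ?H" and yb: "(y, b) \<in> ?H" for x a y b
    proof -
      obtain m c r m' c' r' where *: "x = m \<oplus>\<^bsub>N\<^esub> r \<odot>\<^bsub>N\<^esub> n" "a = c \<oplus>\<^bsub>E\<^esub> r \<odot>\<^bsub>E\<^esub> e" "(m, c) \<in> G" "r \<in> carrier R"
        "y = m' \<oplus>\<^bsub>N\<^esub> r' \<odot>\<^bsub>N\<^esub> n" "b = c' \<oplus>\<^bsub>E\<^esub> r' \<odot>\<^bsub>E\<^esub> e" "(m', c') \<in> G" "r' \<in> carrier R"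
        using xa yb by blast
      note cc = partial_homD(1,2)[OF G *(3)] partial_homD(1,2)[OF G *(7)]
      have "x \<oplus>\<^bsub>N\<^esub> y = (m \<oplus>\<^bsub>N\<^esub> m') \<oplus>\<^bsub>N\<^esub> (r \<oplus>\<^bsub>R\<^esub> r') \<odot>\<^bsub>N\<^esub> n"
        "a \<oplus>\<^bsub>E\<^esub> b = (c \<oplus>\<^bsub>E\<^esub> c') \<oplus>\<^bsub>E\<^esub> (r \<oplus>\<^bsub>R\<^esub> r') \<odot>\<^bsub>E\<^esub> e"
        using * cc n e by (auto simp: N.smult_l_distr E.smult_l_distr N.M.a_ac E.M.a_ac)
      moreover have "(m \<oplus>\<^bsub>N\<^esub> m', c \<oplus>\<^bsub>E\<^esub> c') \<in> G" using partial_homD(4)[OF G] * by blast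
      ultimately show ?thesis using * by blast
    qed
    show "(s \<odot>\<^bsub>N\<^esub> x, s \<odot>\<^bsub>E\<^esub> a) \<in> ?H" if s: "s \<in> carrier R" and xa: "(x, a) \<in> ?H" for s x a
    proof -
      obtain m c r where *: "x = m \<oplus>\<^bsub>N\<^esub> r \<odot>\<^bsub>N\<^esub> n" "a = c \<oplus>\<^bsub>E\<^esub> r \<odot>\<^bsub>E\<^esub> e" "(m, c) \<in> G" "r \<in> carrier R"
        using xa by blast
      note cc = partial_homD(1,2)[OF G *(3)]
      have "s \<odot>\<^bsub>N\<^esub> x = s \<odot>\<^bsub>N\<^esub> m \<oplus>\<^bsub>N\<^esub> (s \<otimes>\<^bsub>R\<^esub> r) \<odot>\<^bsub>N\<^esub> n"
        "s \<odot>\<^bsub>E\<^esub> a = s \<odot>\<^bsub>E\<^esub> c \<oplus>\<^bsub>E\<^esub> (s \<otimes>\<^bsub>R\<^esub> r) \<odot>\<^bsub>E\<^esub> e"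
        using * cc n e s by (auto simp: N.smult_r_distr E.smult_r_distr N.smult_assoc1 E.smult_assoc1)
      moreover have "(s \<odot>\<^bsub>N\<^esub> m, s \<odot>\<^bsub>E\<^esub> c) \<in> G" using partial_homD(5)[OF G] * s by blast
      ultimately show ?thesis using * s by blast
    qed
    show "a = \<zero>\<^bsub>E\<^esub>" if 0: "(\<zero>\<^bsub>N\<^esub>, a) \<in> ?H" for a
    proof -
      obtain m c r where *: "\<zero>\<^bsub>N\<^esub> = m \<oplus>\<^bsub>N\<^esub> r \<odot>\<^bsub>N\<^esub> n" "a = c \<oplus>\<^bsub>E\<^esub> r \<odot>\<^bsub>E\<^esub> e" "(m, c) \<in> G" "r \<in> carrier R"
        using 0 by blast
      note cc = partial_homD(1,2)[OF G *(3)]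
      have "r \<odot>\<^bsub>N\<^esub> n = \<ominus>\<^bsub>N\<^esub> m"
        using *(1) cc n *(4) by (metis N.M.a_comm N.M.minus_equality N.smult_closed)
      then have "(r \<odot>\<^bsub>N\<^esub> n, \<ominus>\<^bsub>E\<^esub> c) \<in> G"
        using partial_hom_minus[OF N E G *(3)] by simp
      then have "\<ominus>\<^bsub>E\<^esub> c = r \<odot>\<^bsub>E\<^esub> e" using eG *(4) by blast
      then show ?thesis using *(2) cc by (metis E.M.r_neg)
    qed
  qed
  have "G \<subseteq> ?H"
  proof (clarsimp)
    fix m a assume ma: "(m, a) \<in> G"
    have "m = m \<oplus>\<^bsub>N\<^esub> \<zero>\<^bsub>R\<^esub> \<odot>\<^bsub>N\<^esub> n" "a = a \<oplus>\<^bsub>E\<^esub> \<zero>\<^bsub>R\<^esub> \<odot>\<^bsub>E\<^esub> e"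
      using partial_homD(1,2)[OF G ma] n e by auto
    then show "\<exists>m' a' r. m = m' \<oplus>\<^bsub>N\<^esub> r \<odot>\<^bsub>N\<^esub> n \<and> a = a' \<oplus>\<^bsub>E\<^esub> r \<odot>\<^bsub>E\<^esub> e \<and> (m', a') \<in> G \<and> r \<in> carrier R"
      using ma by blast
  qed
  moreover have "(n, e) \<in> ?H"
  proof -
    have "n = \<zero>\<^bsub>N\<^esub> \<oplus>\<^bsub>N\<^esub> \<one>\<^bsub>R\<^esub> \<odot>\<^bsub>N\<^esub> n" "e = \<zero>\<^bsub>E\<^esub> \<oplus>\<^bsub>E\<^esub> \<one>\<^bsub>R\<^esub> \<odot>\<^bsub>E\<^esub> e" using n e by auto
    then show ?thesis using partial_homD(3)[OF G] by blast
  qed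
  ultimately show ?thesis using H that by blast
qed

text \<open>
  By Zorn's lemma there is a maximal extension of \<open>G\<close>, and by the preceding lemma its domain is all of \<open>N\<close>.
  The modules are in arbitrary types; the definition of injective modules ties them to one type.
\<close>

lemma baer_criterion:
  assumes N: "module R N" and E: "module R E" and baer: "baer_injective R E"
    and G: "partial_hom R N E G"
  obtains h where "h \<in> mod_hom R N E" "\<And>x y. (x, y) \<in> G \<Longrightarrow> h x = y"
proof -
  let ?A = "{H. partial_hom R N E H \<and> G \<subseteq> H}"
  have "\<exists>M\<in>?A. \<forall>X\<in>?A. M \<subseteq> X \<longrightarrow> X = M"
  proof (rule subset_Zorn_nonempty)
    show "?A \<noteq> {}" using G by blast
    fix C assume C: "C \<noteq> {}" "subset.chain ?A C"
    then have "subset.chain {H. partial_hom R N E H} C" by (auto simp: subset_chain_def)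
    then have "partial_hom R N E (\<Union>C)" using partial_hom_union_chain C(1) by blast
    moreover have "G \<subseteq> \<Union>C" using C unfolding subset_chain_def by fast
    ultimately show "\<Union>C \<in> ?A" by blast
  qed
  then obtain M where "M \<in> ?A" and max': "\<forall>X\<in>?A. M \<subseteq> X \<longrightarrow> X = M" ..
  then have M: "partial_hom R N E M" "G \<subseteq> M" by simp_all
  have max: "X = M" if "partial_hom R N E X" "M \<subseteq> X" for X
    using bspec[OF max', of X] that M(2) by simp
  have dom: "\<exists>e. (n, e) \<in> M" if n: "n \<in> carrier N" for n
  proof -
    obtain H e where H: "partial_hom R N E H" "M \<subseteq> H" "(n, e) \<in> H"
      using baer_extend_one[OF N E baer M(1) n] .
    then show ?thesis using max[OF H(1,2)] by blast
  qed
  define h where "h n = (THE e. (n, e) \<in> M)" for n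
  have h: "h n = e" if "(n, e) \<in> M" for n e
    unfolding h_def using that partial_hom_unique[OF N E M(1) _ that] by (rule the_equality)
  have hM: "(n, h n) \<in> M" if "n \<in> carrier N" for n
    using dom[OF that] h by auto
  have "h \<in> mod_hom R N E"
  proof (rule mod_homI)
    show "h x \<in> carrier E" if "x \<in> carrier N" for x
      using hM[OF that] partial_homD(2)[OF M(1)] by blast
    show "h (x \<oplus>\<^bsub>N\<^esub> y) = h x \<oplus>\<^bsub>E\<^esub> h y" if "x \<in> carrier N" "y \<in> carrier N" for x y
      using partial_homD(4)[OF M(1) hM[OF that(1)] hM[OF that(2)]] by (rule h)
    show "h (r \<odot>\<^bsub>N\<^esub> x) = r \<odot>\<^bsub>E\<^esub> h x" if "r \<in> carrier R" "x \<in> carrier N" for r x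
      using partial_homD(5)[OF M(1) that(1) hM[OF that(2)]] by (rule h)
  qed
  then show ?thesis by (rule that) (rule h, use M(2) in blast)
qed

section \<open>Injective modules and torsion\<close>

lemma (in cring) idealI_commutative:
  assumes "J \<subseteq> carrier R" "\<zero> \<in> J"
    and "\<And>a b. a \<in> J \<Longrightarrow> b \<in> J \<Longrightarrow> a \<oplus> b \<in> J"
    and "\<And>a r. a \<in> J \<Longrightarrow> r \<in> carrier R \<Longrightarrow> r \<otimes> a \<in> J"
  shows "ideal J R"
proof (rule idealI)
  show "ring R" ..
  have minus: "\<ominus> a \<in> J" if "a \<in> J" for a
    using assms(4)[OF that, of "\<ominus> \<one>"] assms(1) that by (auto simp: l_minus)
  show "subgroup J (add_monoid R)"
    by (rule subgroup.intro) (use assms minus in \<open>auto simp flip: a_inv_def\<close>)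
  show "a \<otimes> x \<in> J" if "a \<in> J" "x \<in> carrier R" for a x
    using assms(1,4) that by (metis m_comm subsetD)
qed (use assms in auto)

lemma submodule_moduleI:
  assumes M: "module R M" and "H \<subseteq> carrier M" "\<zero>\<^bsub>M\<^esub> \<in> H"
    and add: "\<And>a b. a \<in> H \<Longrightarrow> b \<in> H \<Longrightarrow> a \<oplus>\<^bsub>M\<^esub> b \<in> H"
    and smult: "\<And>r a. r \<in> carrier R \<Longrightarrow> a \<in> H \<Longrightarrow> r \<odot>\<^bsub>M\<^esub> a \<in> H"
  shows "module R (M\<lparr>carrier := H\<rparr>)"
proof -
  interpret M: module R M by fact
  have "\<ominus>\<^bsub>M\<^esub> a \<in> H" if "a \<in> H" for a
    using smult[of "\<ominus>\<^bsub>R\<^esub> \<one>\<^bsub>R\<^esub>" a] assms(2) that by (auto simp: M.smult_l_minus)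
  then have "submodule H R M"
    using assms by (intro M.submoduleI) auto
  then show ?thesis
    by (rule submodule.submodule_is_module) fact
qed

lemma (in cring) partial_hom_domain_ideal:
  assumes M: "module R M" and G: "partial_hom R (regular_module R) M G"
  shows "ideal (Domain G) R"
proof (rule idealI_commutative)
  show "Domain G \<subseteq> carrier R" using partial_homD(1)[OF G] by auto
  show "\<zero> \<in> Domain G" using partial_homD(3)[OF G] by auto
  show "a \<oplus> b \<in> Domain G" if "a \<in> Domain G" "b \<in> Domain G" for a b
    using that partial_homD(4)[OF G] by fastforce
  show "r \<otimes> a \<in> Domain G" if "a \<in> Domain G" "r \<in> carrier R" for a r
    using that partial_homD(5)[OF G] by fastforce
qed

lemma partial_hom_codomain_mono:
  assumes "partial_hom R M (E\<lparr>carrier := H\<rparr>) G" "H \<subseteq> carrier E"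
  shows "partial_hom R M E G"
proof (rule partial_homI)
  show "G \<subseteq> carrier M \<times> carrier E"
    using partial_homD(1,2)[OF assms(1)] assms(2) by auto
  show "(\<zero>\<^bsub>M\<^esub>, \<zero>\<^bsub>E\<^esub>) \<in> G"
    using partial_homD(3)[OF assms(1)] by simp
  show "(x \<oplus>\<^bsub>M\<^esub> y, a \<oplus>\<^bsub>E\<^esub> b) \<in> G" if "(x, a) \<in> G" "(y, b) \<in> G" for x a y b
    using partial_homD(4)[OF assms(1) that] by simp
  show "(r \<odot>\<^bsub>M\<^esub> x, r \<odot>\<^bsub>E\<^esub> a) \<in> G" if "r \<in> carrier R" "(x, a) \<in> G" for r x a
    using partial_homD(5)[OF assms(1) that] by simp
  show "a = \<zero>\<^bsub>E\<^esub>" if "(\<zero>\<^bsub>M\<^esub>, a) \<in> G" for a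
    using partial_homD(6)[OF assms(1) that] by simp
qed

text \<open>
  The set \<open>S\<close> is going to be the complement of a prime ideal.
\<close>

locale denominators = cring R for R (structure) +
  fixes S
  assumes S_subset: "S \<subseteq> carrier R" and S_one [simp]: "\<one> \<in> S"
    and S_mult [simp]: "\<And>s t. s \<in> S \<Longrightarrow> t \<in> S \<Longrightarrow> s \<otimes> t \<in> S"
begin

lemma S_carrier [simp]: "s \<in> S \<Longrightarrow> s \<in> carrier R"
  using S_subset by blast

lemma S_pow [simp]: "s \<in> S \<Longrightarrow> s [^] (n::nat) \<in> S"
  by (induction n) auto

definition torsion :: "('a, 'e, 'z) module_scheme \<Rightarrow> 'e set"
  where "torsion E = {e \<in> carrier E. \<exists>s\<in>S. s \<odot>\<^bsub>E\<^esub> e = \<zero>\<^bsub>E\<^esub>}"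

lemma torsion_module:
  assumes E: "module R E"
  shows "module R (E\<lparr>carrier := torsion E\<rparr>)"
proof (rule submodule_moduleI[OF E])
  interpret E: module R E by fact
  show "torsion E \<subseteq> carrier E" by (auto simp: torsion_def)
  show "\<zero>\<^bsub>E\<^esub> \<in> torsion E" unfolding torsion_def using S_one E.smult_r_null[OF one_closed] by blast
  show "a \<oplus>\<^bsub>E\<^esub> b \<in> torsion E" if ab: "a \<in> torsion E" "b \<in> torsion E" for a b
  proof -
    obtain s t where st: "s \<in> S" "t \<in> S" "s \<odot>\<^bsub>E\<^esub> a = \<zero>\<^bsub>E\<^esub>" "t \<odot>\<^bsub>E\<^esub> b = \<zero>\<^bsub>E\<^esub>"
      and c: "a \<in> carrier E" "b \<in> carrier E"
      using ab by (auto simp: torsion_def)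
    have "(s \<otimes> t) \<odot>\<^bsub>E\<^esub> a = t \<odot>\<^bsub>E\<^esub> (s \<odot>\<^bsub>E\<^esub> a)" "(s \<otimes> t) \<odot>\<^bsub>E\<^esub> b = s \<odot>\<^bsub>E\<^esub> (t \<odot>\<^bsub>E\<^esub> b)"
      using st(1,2) c by (simp_all add: E.smult_assoc1[symmetric] m_comm)
    then have "(s \<otimes> t) \<odot>\<^bsub>E\<^esub> (a \<oplus>\<^bsub>E\<^esub> b) = \<zero>\<^bsub>E\<^esub>"
      using st c by (simp add: E.smult_r_distr)
    then show ?thesis using st c by (auto simp: torsion_def intro!: bexI[of _ "s \<otimes> t"])
  qed
  show "r \<odot>\<^bsub>E\<^esub> a \<in> torsion E" if r: "r \<in> carrier R" and a: "a \<in> torsion E" for r a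
  proof -
    obtain s where s: "s \<in> S" "s \<odot>\<^bsub>E\<^esub> a = \<zero>\<^bsub>E\<^esub>" and c: "a \<in> carrier E"
      using a by (auto simp: torsion_def)
    have "s \<odot>\<^bsub>E\<^esub> (r \<odot>\<^bsub>E\<^esub> a) = r \<odot>\<^bsub>E\<^esub> (s \<odot>\<^bsub>E\<^esub> a)"
      using s(1) r c by (simp add: E.smult_assoc1[symmetric] m_comm)
    then show ?thesis using s r c by (auto simp: torsion_def intro!: bexI[of _ s])
  qed
qed

text \<open>
  The domain is generated by finitely many elements, and the product of annihilators of their values
  annihilates all values.
\<close>

lemma torsion_partial_hom_annihilated:
  assumes noeth: "noetherian_ring R" and E: "module R E"
    and G: "partial_hom R (regular_module R) (E\<lparr>carrier := torsion E\<rparr>) G"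
  shows "\<exists>s\<in>S. \<forall>r x. (r, x) \<in> G \<longrightarrow> s \<odot>\<^bsub>E\<^esub> x = \<zero>\<^bsub>E\<^esub>"
proof -
  interpret E: module R E by fact
  interpret noetherian_ring R by fact
  note T = torsion_module[OF E]
  have RM: "module R (regular_module R)" by (rule module_regular_module) unfold_locales
  have Gc: "r \<in> carrier R" "x \<in> carrier E" "x \<in> torsion E" if "(r, x) \<in> G" for r x
    using partial_homD(1,2)[OF G that] by (auto simp: torsion_def)
  define K where "K s = {r. \<exists>x. (r, x) \<in> G \<and> s \<odot>\<^bsub>E\<^esub> x = \<zero>\<^bsub>E\<^esub>}" for s
  have K_ideal: "ideal (K s) R" if s: "s \<in> S" for s
  proof (rule idealI_commutative)
    show "K s \<subseteq> carrier R" using Gc by (auto simp: K_def)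
    show "\<zero> \<in> K s" using partial_homD(3)[OF G] s by (auto simp: K_def)
    show "a \<oplus> b \<in> K s" if ab: "a \<in> K s" "b \<in> K s" for a b
    proof -
      obtain x y where "(a, x) \<in> G" "(b, y) \<in> G" "s \<odot>\<^bsub>E\<^esub> x = \<zero>\<^bsub>E\<^esub>" "s \<odot>\<^bsub>E\<^esub> y = \<zero>\<^bsub>E\<^esub>"
        using ab by (auto simp: K_def)
      then show ?thesis
        using partial_homD(4)[OF G, of a x b y] s Gc
        by (auto simp: K_def E.smult_r_distr intro!: exI[of _ "x \<oplus>\<^bsub>E\<^esub> y"])
    qed
    show "r \<otimes> a \<in> K s" if a: "a \<in> K s" and r: "r \<in> carrier R" for a r
    proof -
      obtain x where x: "(a, x) \<in> G" "s \<odot>\<^bsub>E\<^esub> x = \<zero>\<^bsub>E\<^esub>" using a by (auto simp: K_def)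
      have "s \<odot>\<^bsub>E\<^esub> (r \<odot>\<^bsub>E\<^esub> x) = r \<odot>\<^bsub>E\<^esub> (s \<odot>\<^bsub>E\<^esub> x)"
        using s r Gc[OF x(1)] by (simp add: E.smult_assoc1[symmetric] m_comm)
      then show ?thesis
        using partial_homD(5)[OF G r x(1)] x r by (auto simp: K_def intro!: exI[of _ "r \<odot>\<^bsub>E\<^esub> x"])
    qed
  qed
  have K_mono: "K s \<subseteq> K (t \<otimes> s)" if st: "s \<in> S" "t \<in> S" for s t
  proof
    fix r assume "r \<in> K s"
    then obtain x where x: "(r, x) \<in> G" "s \<odot>\<^bsub>E\<^esub> x = \<zero>\<^bsub>E\<^esub>" by (auto simp: K_def)
    have "(t \<otimes> s) \<odot>\<^bsub>E\<^esub> x = \<zero>\<^bsub>E\<^esub>" using st x Gc[OF x(1)] by (simp add: E.smult_assoc1)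
    then show "r \<in> K (t \<otimes> s)" using x by (auto simp: K_def)
  qed
  obtain A where A: "A \<subseteq> carrier R" "finite A" "Domain G = Idl A"
    using finetely_gen[OF partial_hom_domain_ideal[OF T G]] by auto
  have "\<exists>s\<in>S. B \<subseteq> K s" if "finite B" "B \<subseteq> Domain G" for B
    using that
  proof (induction B)
    case empty then show ?case using S_one by blast
  next
    case (insert b B)
    then obtain s where s: "s \<in> S" "B \<subseteq> K s" by auto
    obtain x where x: "(b, x) \<in> G" using insert by auto
    then obtain t where t: "t \<in> S" "t \<odot>\<^bsub>E\<^esub> x = \<zero>\<^bsub>E\<^esub>" using Gc[OF x] by (auto simp: torsion_def)
    then have "b \<in> K t" using x by (auto simp: K_def)
    then have "insert b B \<subseteq> K (t \<otimes> s)"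
      using K_mono[OF s(1) t(1)] K_mono[OF t(1) s(1)] s t by (auto simp: m_comm)
    then show ?case using s t by (intro bexI[of _ "t \<otimes> s"]) auto
  qed
  then obtain s where s: "s \<in> S" "A \<subseteq> K s"
    using A genideal_self[OF A(1)] by metis
  have "Domain G \<subseteq> K s"
    unfolding A(3) by (rule genideal_minimal[OF K_ideal[OF s(1)] s(2)])
  have "s \<odot>\<^bsub>E\<^esub> x = \<zero>\<^bsub>E\<^esub>" if rx: "(r, x) \<in> G" for r x
  proof -
    have "r \<in> K s" using rx \<open>Domain G \<subseteq> K s\<close> by blast
    then obtain y where y: "(r, y) \<in> G" "s \<odot>\<^bsub>E\<^esub> y = \<zero>\<^bsub>E\<^esub>" by (auto simp: K_def)
    then show ?thesis using partial_hom_unique[OF RM T G rx y(1)] by simp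
  qed
  then show ?thesis using s(1) by blast
qed

text \<open>
  Let \<open>s\<close> annihilate all values of a homomorphism from an ideal \<open>J\<close> to the torsion of \<open>E\<close>. The ideals
  \<open>(J : s ^ n)\<close> become constant from some \<open>n0\<close> on, so every multiple of \<open>s ^ (n0 + 1)\<close> in \<open>J\<close> is \<open>s\<close> times an
  element of \<open>J\<close> and has value zero (a case of the Artin-Rees lemma). Hence the
  homomorphism extends to the ideal generated by \<open>J\<close> and \<open>s ^ (n0 + 1)\<close> with value zero at
  \<open>s ^ (n0 + 1)\<close>. An element of \<open>E\<close> that represents the extension is annihilated by \<open>s ^ (n0 + 1)\<close>, so it is torsion.
\<close>

lemma torsion_baer_injective:
  assumes noeth: "noetherian_ring R" and E: "module R E" and baer: "baer_injective R E"
  shows "baer_injective R (E\<lparr>carrier := torsion E\<rparr>)"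
  unfolding baer_injective_def
proof (intro allI impI)
  interpret E: module R E by fact
  interpret noetherian_ring R by fact
  note T = torsion_module[OF E]
  have RM: "module R (regular_module R)" by (rule module_regular_module) unfold_locales
  fix G assume G: "partial_hom R (regular_module R) (E\<lparr>carrier := torsion E\<rparr>) G"
  have Gc: "r \<in> carrier R" "x \<in> carrier E" "x \<in> torsion E" if "(r, x) \<in> G" for r x
    using partial_homD(1,2)[OF G that] by (auto simp: torsion_def)
  obtain s where s: "s \<in> S" and s0: "\<And>r x. (r, x) \<in> G \<Longrightarrow> s \<odot>\<^bsub>E\<^esub> x = \<zero>\<^bsub>E\<^esub>"
    using torsion_partial_hom_annihilated[OF noeth E G] by auto
  interpret J: ideal "Domain G" R by (rule partial_hom_domain_ideal[OF T G])
  define C where "C n = {r \<in> carrier R. s [^] n \<otimes> r \<in> Domain G}" for n :: nat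
  have C_ideal: "ideal (C n) R" for n
  proof (rule idealI_commutative)
    show "r \<otimes> a \<in> C n" if "a \<in> C n" "r \<in> carrier R" for a r
    proof -
      have "s [^] n \<otimes> (r \<otimes> a) = r \<otimes> (s [^] n \<otimes> a)" using that s by (simp add: C_def m_lcomm)
      then show ?thesis using that J.I_l_closed unfolding C_def by auto
    qed
  qed (use s J.a_closed J.zero_closed in \<open>auto simp: C_def r_distr\<close>)
  have C_Suc: "C n \<subseteq> C (Suc n)" for n
  proof
    fix r assume r: "r \<in> C n"
    then have "s \<otimes> (s [^] n \<otimes> r) \<in> Domain G" using s J.I_l_closed unfolding C_def by auto
    moreover have "s \<otimes> (s [^] n \<otimes> r) = s [^] Suc n \<otimes> r" using r s by (simp add: C_def m_ac)
    ultimately show "r \<in> C (Suc n)" using r by (simp add: C_def)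
  qed
  have C_mono: "C m \<subseteq> C n" if "m \<le> n" for m n
    using that by (induction n rule: dec_induct) (use C_Suc in auto)
  have "\<Union>(range C) \<in> range C"
  proof (rule ideal_chain_is_trivial)
    show "subset.chain {I. ideal I R} (range C)"
      unfolding subset_chain_def
    proof (intro conjI ballI)
      show "X \<subseteq> Y \<or> Y \<subseteq> X" if "X \<in> range C" "Y \<in> range C" for X Y
        using that C_mono by (metis imageE nat_le_linear)
    qed (use C_ideal in blast)
  qed auto
  then obtain n0 where n0: "\<And>n. C n \<subseteq> C n0" by blast
  \<comment> \<open>The extra factor \<open>s\<close> beyond \<open>s ^ n0\<close> is the one that annihilates the values.\<close>
  let ?t = "s [^] Suc n0"
  let ?G = "{(a \<oplus> b \<otimes> ?t, x) | a b x. (a, x) \<in> G \<and> b \<in> carrier R}"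
  have t: "?t \<in> S" using s by (rule S_pow)
  then have tc: "?t \<in> carrier R" by (rule S_carrier)
  have "partial_hom R (regular_module R) E ?G"
  proof (rule partial_homI)
    show "?G \<subseteq> carrier (regular_module R) \<times> carrier E" using Gc tc by auto
    have "(\<zero>, \<zero>\<^bsub>E\<^esub>) = (\<zero> \<oplus> \<zero> \<otimes> ?t, \<zero>\<^bsub>E\<^esub>)" using tc by simp
    moreover have "(\<zero>, \<zero>\<^bsub>E\<^esub>) \<in> G" using partial_homD(3)[OF G] by simp
    ultimately show "(\<zero>\<^bsub>regular_module R\<^esub>, \<zero>\<^bsub>E\<^esub>) \<in> ?G" by fastforce
    show "(x \<oplus>\<^bsub>regular_module R\<^esub> y, a \<oplus>\<^bsub>E\<^esub> b) \<in> ?G" if xa: "(x, a) \<in> ?G" and yb: "(y, b) \<in> ?G" for x a y b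
    proof -
      obtain c d c' d' where *: "x = c \<oplus> d \<otimes> ?t" "(c, a) \<in> G" "d \<in> carrier R"
        "y = c' \<oplus> d' \<otimes> ?t" "(c', b) \<in> G" "d' \<in> carrier R" using xa yb by blast
      have "x \<oplus> y = (c \<oplus> c') \<oplus> (d \<oplus> d') \<otimes> ?t"
        using * Gc[OF *(2)] Gc[OF *(5)] tc by (simp add: l_distr a_ac del: nat_pow_Suc)
      moreover have "(c \<oplus> c', a \<oplus>\<^bsub>E\<^esub> b) \<in> G" using partial_homD(4)[OF G *(2,5)] by simp
      ultimately show ?thesis using * by auto
    qed
    show "(r \<odot>\<^bsub>regular_module R\<^esub> x, r \<odot>\<^bsub>E\<^esub> a) \<in> ?G" if r: "r \<in> carrier R" and xa: "(x, a) \<in> ?G" for r x a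
    proof -
      obtain c d where *: "x = c \<oplus> d \<otimes> ?t" "(c, a) \<in> G" "d \<in> carrier R" using xa by blast
      have "r \<otimes> x = r \<otimes> c \<oplus> (r \<otimes> d) \<otimes> ?t"
        using * Gc[OF *(2)] tc r by (simp add: r_distr m_assoc del: nat_pow_Suc)
      moreover have "(r \<otimes> c, r \<odot>\<^bsub>E\<^esub> a) \<in> G" using partial_homD(5)[OF G r *(2)] by simp
      ultimately show ?thesis using * r by auto
    qed
    show "a = \<zero>\<^bsub>E\<^esub>" if 0: "(\<zero>\<^bsub>regular_module R\<^esub>, a) \<in> ?G" for a
    proof -
      obtain c d where *: "\<zero> = c \<oplus> d \<otimes> ?t" "(c, a) \<in> G" "d \<in> carrier R" using 0 by auto
      note cc = Gc[OF *(2)]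
      have "c = \<ominus> (d \<otimes> ?t)" using *(1) cc *(3) tc by (metis m_closed minus_equality)
      then have ceq: "c = ?t \<otimes> (\<ominus> d)" using *(3) tc l_minus m_comm a_inv_closed by metis
      then have "\<ominus> d \<in> C (Suc n0)" using *(2,3) by (auto simp: C_def simp del: nat_pow_Suc)
      then have "\<ominus> d \<in> C n0" using n0 by blast
      then obtain y where y: "(s [^] n0 \<otimes> (\<ominus> d), y) \<in> G" by (auto simp: C_def)
      have "(s \<otimes> (s [^] n0 \<otimes> (\<ominus> d)), s \<odot>\<^bsub>E\<^esub> y) \<in> G"
        using partial_homD(5)[OF G _ y, of s] s by simp
      moreover have "s \<otimes> (s [^] n0 \<otimes> (\<ominus> d)) = c" using ceq s *(3) by (simp add: m_ac)
      ultimately have "(c, \<zero>\<^bsub>E\<^esub>) \<in> G" using s0[OF y] by simp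
      then show ?thesis using partial_hom_unique[OF RM T G *(2)] by blast
    qed
  qed
  then obtain e where e: "e \<in> carrier E" and eG: "\<And>r x. (r, x) \<in> ?G \<Longrightarrow> x = r \<odot>\<^bsub>E\<^esub> e"
    by (rule baer_injectiveD[OF baer]) blast
  have "(?t, \<zero>\<^bsub>E\<^esub>) \<in> ?G"
  proof -
    have "?t = \<zero> \<oplus> \<one> \<otimes> ?t" using tc by (simp del: nat_pow_Suc)
    then show ?thesis using partial_homD(3)[OF G] by force
  qed
  then have "?t \<odot>\<^bsub>E\<^esub> e = \<zero>\<^bsub>E\<^esub>" by (rule eG[symmetric])
  then have "e \<in> torsion E" using e t unfolding torsion_def by blast
  moreover have "x = r \<odot>\<^bsub>E\<^esub> e" if rx: "(r, x) \<in> G" for r x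
  proof (rule eG)
    have "r = r \<oplus> \<zero> \<otimes> ?t" using tc Gc[OF rx] by (simp del: nat_pow_Suc)
    then show "(r, x) \<in> ?G" using rx zero_closed by blast
  qed
  ultimately show "\<exists>e\<in>carrier (E\<lparr>carrier := torsion E\<rparr>). \<forall>r x. (r, x) \<in> G \<longrightarrow> x = r \<odot>\<^bsub>E\<lparr>carrier := torsion E\<rparr>\<^esub> e"
    by auto
qed

text \<open>
  The identity of the torsion submodule extends to a retraction \<open>h\<close> of \<open>E\<close> onto it, as the torsion is
  injective, and \<open>\<kappa>\<close> is the complementary projection.
\<close>

lemma torsion_splits:
  assumes noeth: "noetherian_ring R" and E: "module R E" and baer: "baer_injective R E"
  shows "\<exists>\<kappa>\<in>mod_hom R E E. \<forall>e\<in>carrier E. \<kappa> (\<kappa> e) = \<kappa> e \<and> (\<kappa> e = \<zero>\<^bsub>E\<^esub> \<longleftrightarrow> e \<in> torsion E)"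
proof -
  interpret E: module R E by fact
  note T = torsion_module[OF E]
  interpret T: module R "E\<lparr>carrier := torsion E\<rparr>" by fact
  have sub: "torsion E \<subseteq> carrier E" by (auto simp: torsion_def)
  have "partial_hom R E (E\<lparr>carrier := torsion E\<rparr>) {(x, x) | x. x \<in> torsion E}"
    by (rule partial_homI) (use sub T.M.zero_closed T.M.a_closed T.smult_closed in auto)
  then obtain h where h: "h \<in> mod_hom R E (E\<lparr>carrier := torsion E\<rparr>)"
    and hT': "\<And>x y. (x, y) \<in> {(x, x) | x. x \<in> torsion E} \<Longrightarrow> h x = y"
    by (rule baer_criterion[OF E T torsion_baer_injective[OF assms]]) blast
  have hT: "h x = x" if "x \<in> torsion E" for x using hT' that by blast
  have hc: "h x \<in> torsion E" "h x \<in> carrier E" if "x \<in> carrier E" for x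
    using mod_homD(1)[OF h that] sub by auto
  have h_add: "h (x \<oplus>\<^bsub>E\<^esub> y) = h x \<oplus>\<^bsub>E\<^esub> h y" if "x \<in> carrier E" "y \<in> carrier E" for x y
    using mod_homD(2)[OF h that] by simp
  have h_smult: "h (r \<odot>\<^bsub>E\<^esub> x) = r \<odot>\<^bsub>E\<^esub> h x" if "r \<in> carrier R" "x \<in> carrier E" for r x
    using mod_homD(3)[OF h that] by simp
  define \<kappa> where "\<kappa> e = e \<ominus>\<^bsub>E\<^esub> h e" for e
  have \<kappa>: "\<kappa> \<in> mod_hom R E E"
  proof (rule mod_homI)
    show "\<kappa> (x \<oplus>\<^bsub>E\<^esub> y) = \<kappa> x \<oplus>\<^bsub>E\<^esub> \<kappa> y" if "x \<in> carrier E" "y \<in> carrier E" for x y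
      using that hc by (simp add: \<kappa>_def h_add a_minus_def E.minus_add E.M.a_ac)
    show "\<kappa> (r \<odot>\<^bsub>E\<^esub> x) = r \<odot>\<^bsub>E\<^esub> \<kappa> x" if "r \<in> carrier R" "x \<in> carrier E" for r x
      using that hc by (simp add: \<kappa>_def h_smult a_minus_def E.smult_r_distr E.smult_r_minus)
  qed (simp add: \<kappa>_def hc)
  have ker: "\<kappa> e = \<zero>\<^bsub>E\<^esub> \<longleftrightarrow> e \<in> torsion E" if e: "e \<in> carrier E" for e
  proof
    assume "\<kappa> e = \<zero>\<^bsub>E\<^esub>"
    then have "e = h e" using e hc(2)[OF e] by (metis \<kappa>_def a_minus_def E.M.add.inv_closed E.M.minus_equality E.M.minus_minus)
    then show "e \<in> torsion E" using hc(1)[OF e] by simp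
  next
    assume "e \<in> torsion E"
    then show "\<kappa> e = \<zero>\<^bsub>E\<^esub>" using e by (simp add: \<kappa>_def hT a_minus_def E.M.r_neg)
  qed
  have idem: "\<kappa> (\<kappa> e) = \<kappa> e" if e: "e \<in> carrier E" for e
  proof -
    have "e = h e \<oplus>\<^bsub>E\<^esub> \<kappa> e" using e hc(2)[OF e]
      by (simp add: \<kappa>_def a_minus_def E.M.a_lcomm E.M.r_neg)
    then have "\<kappa> e = \<kappa> (h e) \<oplus>\<^bsub>E\<^esub> \<kappa> (\<kappa> e)"
      using mod_homD(2)[OF \<kappa>, of "h e" "\<kappa> e"] hc(2)[OF e] mod_homD(1)[OF \<kappa> e] by metis
    moreover have "\<kappa> (h e) = \<zero>\<^bsub>E\<^esub>" using ker hc[OF e] by blast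
    ultimately show ?thesis using mod_homD(1)[OF \<kappa>] e by simp
  qed
  show ?thesis
    by (rule bexI[OF _ \<kappa>]) (intro ballI conjI idem ker)
qed

text \<open>
  These are the modules that come from modules over the ring of fractions.
\<close>

definition uniquely_divisible :: "('a, 'e, 'z) module_scheme \<Rightarrow> bool"
  where "uniquely_divisible M \<longleftrightarrow> (\<forall>s\<in>S. bij_betw (\<lambda>x. s \<odot>\<^bsub>M\<^esub> x) (carrier M) (carrier M))"

text \<open>
  The localization of \<open>E\<close> is found inside \<open>E\<close>, as the image of \<open>\<kappa>\<close>, with \<open>\<kappa>\<close> as the localization map. This
  image is a direct summand and thus injective. Elements of \<open>S\<close> act injectively on it as it has no
  torsion. For surjectivity, \<open>c s \<mapsto> c e\<close> is well defined on the ideal generated by \<open>s\<close>, again because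
  there is no torsion, and if the element \<open>e0\<close> represents this homomorphism, then \<open>s e0 = e\<close>.
\<close>

lemma localize_injective:
  assumes noeth: "noetherian_ring R" and E: "module R E" and baer: "baer_injective R E"
  shows "\<exists>\<kappa>\<in>mod_hom R E E.
    (\<forall>e\<in>carrier E. \<kappa> (\<kappa> e) = \<kappa> e \<and> (\<kappa> e = \<zero>\<^bsub>E\<^esub> \<longleftrightarrow> (\<exists>s\<in>S. s \<odot>\<^bsub>E\<^esub> e = \<zero>\<^bsub>E\<^esub>))) \<and>
    module R (E\<lparr>carrier := \<kappa> ` carrier E\<rparr>) \<and>
    baer_injective R (E\<lparr>carrier := \<kappa> ` carrier E\<rparr>) \<and>
    uniquely_divisible (E\<lparr>carrier := \<kappa> ` carrier E\<rparr>)"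
proof -
  interpret E: module R E by fact
  obtain \<kappa> where \<kappa>: "\<kappa> \<in> mod_hom R E E" and idem: "\<And>e. e \<in> carrier E \<Longrightarrow> \<kappa> (\<kappa> e) = \<kappa> e"
    and ker: "\<And>e. e \<in> carrier E \<Longrightarrow> \<kappa> e = \<zero>\<^bsub>E\<^esub> \<longleftrightarrow> e \<in> torsion E"
    using torsion_splits[OF assms] by auto
  let ?L = "E\<lparr>carrier := \<kappa> ` carrier E\<rparr>"
  have sub: "\<kappa> ` carrier E \<subseteq> carrier E" using mod_homD(1)[OF \<kappa>] by blast
  have fixed: "\<kappa> x = x" if "x \<in> \<kappa> ` carrier E" for x using that idem by auto
  have L: "module R ?L"
  proof (rule submodule_moduleI[OF E sub])
    show "\<zero>\<^bsub>E\<^esub> \<in> \<kappa> ` carrier E" using mod_hom_zero[OF E E \<kappa>] by (metis E.zero_closed image_eqI)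
    show "a \<oplus>\<^bsub>E\<^esub> b \<in> \<kappa> ` carrier E" if "a \<in> \<kappa> ` carrier E" "b \<in> \<kappa> ` carrier E" for a b
    proof -
      have "a \<oplus>\<^bsub>E\<^esub> b = \<kappa> (a \<oplus>\<^bsub>E\<^esub> b)"
        using mod_homD(2)[OF \<kappa>, of a b] fixed[OF that(1)] fixed[OF that(2)] that sub
        by (metis subsetD)
      moreover have "a \<oplus>\<^bsub>E\<^esub> b \<in> carrier E" using that sub by (metis E.a_closed subsetD)
      ultimately show ?thesis by (rule image_eqI)
    qed
    show "r \<odot>\<^bsub>E\<^esub> a \<in> \<kappa> ` carrier E" if "r \<in> carrier R" "a \<in> \<kappa> ` carrier E" for r a
    proof -
      have "r \<odot>\<^bsub>E\<^esub> a = \<kappa> (r \<odot>\<^bsub>E\<^esub> a)"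
        using mod_homD(3)[OF \<kappa> that(1), of a] fixed[OF that(2)] that sub by (metis subsetD)
      moreover have "r \<odot>\<^bsub>E\<^esub> a \<in> carrier E" using that sub by (metis E.smult_closed subsetD)
      ultimately show ?thesis by (rule image_eqI)
    qed
  qed
  have RM: "module R (regular_module R)" by (rule module_regular_module) unfold_locales
  interpret L: module R ?L by (rule L)
  have L_baer: "baer_injective R ?L"
    unfolding baer_injective_def
  proof (intro allI impI)
    fix G assume G: "partial_hom R (regular_module R) ?L G"
    have "partial_hom R (regular_module R) E G"
      by (rule partial_hom_codomain_mono[OF G sub])
    then obtain e where e: "e \<in> carrier E" and eG: "\<And>r x. (r, x) \<in> G \<Longrightarrow> x = r \<odot>\<^bsub>E\<^esub> e"
      by (rule baer_injectiveD[OF baer]) blast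
    have "x = r \<odot>\<^bsub>E\<^esub> \<kappa> e" if rx: "(r, x) \<in> G" for r x
    proof -
      have "\<kappa> x = \<kappa> (r \<odot>\<^bsub>E\<^esub> e)" using eG[OF rx] by simp
      then show ?thesis
        using fixed[of x] partial_homD(1,2)[OF G rx] mod_homD(3)[OF \<kappa> _ e, of r] by simp
    qed
    then show "\<exists>e\<in>carrier ?L. \<forall>r x. (r, x) \<in> G \<longrightarrow> x = r \<odot>\<^bsub>?L\<^esub> e"
      using e by auto
  qed
  have cancel: "x = \<zero>\<^bsub>E\<^esub>" if "s \<in> S" "x \<in> \<kappa> ` carrier E" "s \<odot>\<^bsub>E\<^esub> x = \<zero>\<^bsub>E\<^esub>" for s x
  proof -
    have "x \<in> torsion E" using that sub by (auto simp: torsion_def)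
    then show ?thesis using ker[of x] fixed[of x] that sub by auto
  qed
  have "uniquely_divisible ?L"
    unfolding uniquely_divisible_def bij_betw_def
  proof (intro ballI conjI)
    fix s assume s: "s \<in> S"
    show "inj_on (\<lambda>x. s \<odot>\<^bsub>?L\<^esub> x) (carrier ?L)"
    proof (rule inj_onI)
      fix x y assume xy: "x \<in> carrier ?L" "y \<in> carrier ?L" "s \<odot>\<^bsub>?L\<^esub> x = s \<odot>\<^bsub>?L\<^esub> y"
      have xyE: "x \<in> carrier E" "y \<in> carrier E" using xy sub by auto
      have m: "\<ominus>\<^bsub>E\<^esub> y \<in> \<kappa> ` carrier E"
        using L.smult_closed[of "\<ominus> \<one>" y] xy(2) xyE(2) by (simp add: E.smult_l_minus)
      have "s \<odot>\<^bsub>E\<^esub> (x \<oplus>\<^bsub>E\<^esub> \<ominus>\<^bsub>E\<^esub> y) = \<zero>\<^bsub>E\<^esub>"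
        using xy(3) xyE s by (simp add: E.smult_r_distr E.smult_r_minus E.M.r_neg)
      moreover have "x \<oplus>\<^bsub>E\<^esub> \<ominus>\<^bsub>E\<^esub> y \<in> \<kappa> ` carrier E" using L.M.a_closed[of x "\<ominus>\<^bsub>E\<^esub> y"] xy(1) m by simp
      ultimately have "x \<oplus>\<^bsub>E\<^esub> \<ominus>\<^bsub>E\<^esub> y = \<zero>\<^bsub>E\<^esub>" using cancel s by blast
      then show "x = y" using xyE by (metis E.M.add.inv_closed E.M.minus_equality E.M.minus_minus)
    qed
    show "(\<lambda>x. s \<odot>\<^bsub>?L\<^esub> x) ` carrier ?L = carrier ?L"
    proof
      show "(\<lambda>x. s \<odot>\<^bsub>?L\<^esub> x) ` carrier ?L \<subseteq> carrier ?L" using L.smult_closed s by auto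
      show "carrier ?L \<subseteq> (\<lambda>x. s \<odot>\<^bsub>?L\<^esub> x) ` carrier ?L"
      proof
        fix e assume e: "e \<in> carrier ?L"
        then have eE: "e \<in> carrier E" using sub by auto
        let ?G = "{(c \<otimes> s, c \<odot>\<^bsub>?L\<^esub> e) | c. c \<in> carrier (regular_module R)}"
        have "partial_hom R (regular_module R) ?L ?G"
        proof (rule partial_hom_image[OF RM RM L])
          show "(\<lambda>c. c \<otimes> s) \<in> mod_hom R (regular_module R) (regular_module R)"
            by (rule mod_homI) (use s in \<open>simp_all add: l_distr m_assoc\<close>)
          show "(\<lambda>c. c \<odot>\<^bsub>?L\<^esub> e) \<in> mod_hom R (regular_module R) ?L"
            by (rule mod_homI) (use e L.smult_closed[OF _ e] L.smult_l_distr[OF _ _ e] L.smult_assoc1[OF _ _ e] in simp_all)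
          fix c assume "c \<in> carrier (regular_module R)" and c0: "c \<otimes> s = \<zero>\<^bsub>regular_module R\<^esub>"
          then have c: "c \<in> carrier R" by simp
          have "s \<odot>\<^bsub>E\<^esub> (c \<odot>\<^bsub>E\<^esub> e) = (c \<otimes> s) \<odot>\<^bsub>E\<^esub> e" using c s eE by (simp add: E.smult_assoc1[symmetric] m_comm)
          also have "\<dots> = \<zero>\<^bsub>E\<^esub>" using c0 eE by simp
          finally show "c \<odot>\<^bsub>?L\<^esub> e = \<zero>\<^bsub>?L\<^esub>" using cancel[OF s] L.smult_closed[OF c e] by simp
        qed
        then obtain e0 where e0: "e0 \<in> carrier ?L" and e0G: "\<And>r x. (r, x) \<in> ?G \<Longrightarrow> x = r \<odot>\<^bsub>?L\<^esub> e0"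
          by (rule baer_injectiveD[OF L_baer]) blast
        have "(s, e) = (\<one> \<otimes> s, \<one> \<odot>\<^bsub>E\<^esub> e)" using s eE by simp
        then have "(s, e) \<in> ?G" by force
        then have "e = s \<odot>\<^bsub>?L\<^esub> e0" by (rule e0G)
        then show "e \<in> (\<lambda>x. s \<odot>\<^bsub>?L\<^esub> x) ` carrier ?L" using e0 by blast
      qed
    qed
  qed
  then show ?thesis
    using \<kappa> idem ker L L_baer by (auto simp: torsion_def intro!: bexI[of _ \<kappa>])
qed

end

section \<open>Localization of rings and modules at a prime ideal\<close>

locale prime_localization = cring R for R (structure) +
  fixes P
  assumes prime: "primeideal P R"
begin

sublocale denominators R "carrier R - P"
proof (unfold_locales)
  interpret P: primeideal P R by (rule prime)
  show "carrier R - P \<subseteq> carrier R" by blast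
  show "\<one> \<in> carrier R - P" using P.I_notcarr P.one_imp_carrier by auto
  show "s \<otimes> t \<in> carrier R - P" if "s \<in> carrier R - P" "t \<in> carrier R - P" for s t
    using that P.I_prime by auto
qed

declare S_carrier [simp del] S_mult [simp del]

abbreviation S where "S \<equiv> carrier R - P"

abbreviation frac where "frac \<equiv> fraction R P"

abbreviation L where "L \<equiv> localization R P"

lemma mem_frac_iff: "(b, t) \<in> frac a s \<longleftrightarrow>
    b \<in> carrier R \<and> t \<in> S \<and> (\<exists>u\<in>S. u \<otimes> (a \<otimes> t) = u \<otimes> (b \<otimes> s))"
  by (simp add: fraction_def)

lemma frac_refl: "a \<in> carrier R \<Longrightarrow> s \<in> S \<Longrightarrow> (a, s) \<in> frac a s"
  using S_one by (auto simp: mem_frac_iff simp del: S_one)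

lemma frac_trans:
  assumes a: "a \<in> carrier R" "s \<in> S" and b: "b \<in> carrier R" "t \<in> S" and c: "c \<in> carrier R" "w \<in> S"
    and u: "u \<in> S" "u \<otimes> (a \<otimes> t) = u \<otimes> (b \<otimes> s)"
    and v: "v \<in> S" "v \<otimes> (b \<otimes> w) = v \<otimes> (c \<otimes> t)"
  shows "\<exists>x\<in>S. x \<otimes> (a \<otimes> w) = x \<otimes> (c \<otimes> s)"
proof (rule bexI)
  note cc = a(1) S_carrier[OF a(2)] b(1) S_carrier[OF b(2)] c(1) S_carrier[OF c(2)]
    S_carrier[OF u(1)] S_carrier[OF v(1)]
  have "(u \<otimes> v \<otimes> t) \<otimes> (a \<otimes> w) = v \<otimes> w \<otimes> (u \<otimes> (a \<otimes> t))" using cc by (simp add: m_ac)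
  also have "\<dots> = u \<otimes> s \<otimes> (v \<otimes> (b \<otimes> w))" unfolding u(2) using cc by (simp add: m_ac)
  also have "\<dots> = (u \<otimes> v \<otimes> t) \<otimes> (c \<otimes> s)" unfolding v(2) using cc by (simp add: m_ac)
  finally show "(u \<otimes> v \<otimes> t) \<otimes> (a \<otimes> w) = (u \<otimes> v \<otimes> t) \<otimes> (c \<otimes> s)" .
  show "u \<otimes> v \<otimes> t \<in> S" by (rule S_mult[OF S_mult[OF u(1) v(1)] b(2)])
qed

lemma frac_eq_iff:
  assumes a: "a \<in> carrier R" "s \<in> S" and b: "b \<in> carrier R" "t \<in> S"
  shows "frac a s = frac b t \<longleftrightarrow> (\<exists>u\<in>S. u \<otimes> (a \<otimes> t) = u \<otimes> (b \<otimes> s))"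
proof
  assume "frac a s = frac b t"
  then have "(b, t) \<in> frac a s" using frac_refl[OF b] by simp
  then show "\<exists>u\<in>S. u \<otimes> (a \<otimes> t) = u \<otimes> (b \<otimes> s)" by (simp add: mem_frac_iff)
next
  assume "\<exists>u\<in>S. u \<otimes> (a \<otimes> t) = u \<otimes> (b \<otimes> s)"
  then obtain u where u: "u \<in> S" "u \<otimes> (a \<otimes> t) = u \<otimes> (b \<otimes> s)" ..
  show "frac a s = frac b t"
  proof (intro equalityI subrelI)
    fix c w assume "(c, w) \<in> frac a s"
    then obtain v where v: "c \<in> carrier R" "w \<in> S" "v \<in> S" "v \<otimes> (a \<otimes> w) = v \<otimes> (c \<otimes> s)"
      unfolding mem_frac_iff by blast
    show "(c, w) \<in> frac b t"
      unfolding mem_frac_iff using v frac_trans[OF b a v(1,2) u(1) u(2)[symmetric] v(3,4)] by simp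
  next
    fix c w assume "(c, w) \<in> frac b t"
    then obtain v where v: "c \<in> carrier R" "w \<in> S" "v \<in> S" "v \<otimes> (b \<otimes> w) = v \<otimes> (c \<otimes> t)"
      unfolding mem_frac_iff by blast
    show "(c, w) \<in> frac a s"
      unfolding mem_frac_iff using v frac_trans[OF a b v(1,2) u v(3,4)] by simp
  qed
qed

lemma frac_eqI:
  assumes "a \<in> carrier R" "s \<in> S" "b \<in> carrier R" "t \<in> S" "a \<otimes> t = b \<otimes> s"
  shows "frac a s = frac b t"
  using assms frac_eq_iff S_one by metis

lemma mem_frac_eq: "(b, t) \<in> frac a s \<Longrightarrow> a \<in> carrier R \<Longrightarrow> s \<in> S \<Longrightarrow>
    b \<in> carrier R \<and> t \<in> S \<and> frac b t = frac a s"
  using frac_eq_iff mem_frac_iff by metis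

lemma L_carrier: "carrier L = {frac a s | a s. a \<in> carrier R \<and> s \<in> S}"
  by (simp add: localization_def)

lemma frac_closed [simp]: "a \<in> carrier R \<Longrightarrow> s \<in> S \<Longrightarrow> frac a s \<in> carrier L"
  by (auto simp: L_carrier)

lemma L_one: "\<one>\<^bsub>L\<^esub> = frac \<one> \<one>" and L_zero: "\<zero>\<^bsub>L\<^esub> = frac \<zero> \<one>"
  by (simp_all add: localization_def)

text \<open>
  Addition and multiplication of the localization are unions over all representatives; this
  lemma reduces them to a check of well-definedness.
\<close>

lemma frac_union_const:
  assumes a: "a \<in> carrier R" "s \<in> S" and b: "b \<in> carrier R" "t \<in> S"
    and f: "\<And>a' s' b' t'. \<lbrakk>a' \<in> carrier R; s' \<in> S; frac a' s' = frac a s;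
      b' \<in> carrier R; t' \<in> S; frac b' t' = frac b t\<rbrakk> \<Longrightarrow> f a' s' b' t' = f a s b t"
  shows "(\<Union>(a', s') \<in> frac a s. \<Union>(b', t') \<in> frac b t. f a' s' b' t') = f a s b t"
proof -
  have "f a' s' b' t' = f a s b t" if "(a', s') \<in> frac a s" "(b', t') \<in> frac b t" for a' s' b' t'
    using mem_frac_eq[OF that(1) a] mem_frac_eq[OF that(2) b] f by blast
  then show ?thesis using frac_refl[OF a] frac_refl[OF b] by fast
qed

lemma L_mult:
  assumes a: "a \<in> carrier R" "s \<in> S" and b: "b \<in> carrier R" "t \<in> S"
  shows "frac a s \<otimes>\<^bsub>L\<^esub> frac b t = frac (a \<otimes> b) (s \<otimes> t)"
proof -
  have "(\<Union>(a', s') \<in> frac a s. \<Union>(b', t') \<in> frac b t. frac (a' \<otimes> b') (s' \<otimes> t')) = frac (a \<otimes> b) (s \<otimes> t)"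
  proof (rule frac_union_const[OF a b])
    fix a' s' b' t'
    assume *: "a' \<in> carrier R" "s' \<in> S" "frac a' s' = frac a s" "b' \<in> carrier R" "t' \<in> S" "frac b' t' = frac b t"
    obtain u where u: "u \<in> S" "u \<otimes> (a' \<otimes> s) = u \<otimes> (a \<otimes> s')"
      using frac_eq_iff[OF *(1,2) a] *(3) by blast
    obtain v where v: "v \<in> S" "v \<otimes> (b' \<otimes> t) = v \<otimes> (b \<otimes> t')"
      using frac_eq_iff[OF *(4,5) b] *(6) by blast
    note cc = a(1) S_carrier[OF a(2)] b(1) S_carrier[OF b(2)] *(1) S_carrier[OF *(2)] *(4) S_carrier[OF *(5)]
      S_carrier[OF u(1)] S_carrier[OF v(1)]
    have "(u \<otimes> v) \<otimes> ((a' \<otimes> b') \<otimes> (s \<otimes> t)) = (u \<otimes> (a' \<otimes> s)) \<otimes> (v \<otimes> (b' \<otimes> t))"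
      using cc by (simp add: m_ac)
    also have "\<dots> = (u \<otimes> v) \<otimes> ((a \<otimes> b) \<otimes> (s' \<otimes> t'))"
      unfolding u(2) v(2) using cc by (simp add: m_ac)
    finally show "frac (a' \<otimes> b') (s' \<otimes> t') = frac (a \<otimes> b) (s \<otimes> t)"
      using S_mult[OF u(1) v(1)]
      by (subst frac_eq_iff[OF m_closed[OF *(1,4)] S_mult[OF *(2,5)] m_closed[OF a(1) b(1)] S_mult[OF a(2) b(2)]]) blast
  qed
  then show ?thesis by (simp add: localization_def)
qed

lemma L_add:
  assumes a: "a \<in> carrier R" "s \<in> S" and b: "b \<in> carrier R" "t \<in> S"
  shows "frac a s \<oplus>\<^bsub>L\<^esub> frac b t = frac (a \<otimes> t \<oplus> b \<otimes> s) (s \<otimes> t)"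
proof -
  have "(\<Union>(a', s') \<in> frac a s. \<Union>(b', t') \<in> frac b t. frac (a' \<otimes> t' \<oplus> b' \<otimes> s') (s' \<otimes> t'))
      = frac (a \<otimes> t \<oplus> b \<otimes> s) (s \<otimes> t)"
  proof (rule frac_union_const[OF a b])
    fix a' s' b' t'
    assume *: "a' \<in> carrier R" "s' \<in> S" "frac a' s' = frac a s" "b' \<in> carrier R" "t' \<in> S" "frac b' t' = frac b t"
    obtain u where u: "u \<in> S" "u \<otimes> (a' \<otimes> s) = u \<otimes> (a \<otimes> s')"
      using frac_eq_iff[OF *(1,2) a] *(3) by blast
    obtain v where v: "v \<in> S" "v \<otimes> (b' \<otimes> t) = v \<otimes> (b \<otimes> t')"
      using frac_eq_iff[OF *(4,5) b] *(6) by blast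
    note cc = a(1) S_carrier[OF a(2)] b(1) S_carrier[OF b(2)] *(1) S_carrier[OF *(2)] *(4) S_carrier[OF *(5)]
      S_carrier[OF u(1)] S_carrier[OF v(1)]
    have "(u \<otimes> v) \<otimes> ((a' \<otimes> t' \<oplus> b' \<otimes> s') \<otimes> (s \<otimes> t))
        = v \<otimes> t \<otimes> t' \<otimes> (u \<otimes> (a' \<otimes> s)) \<oplus> u \<otimes> s \<otimes> s' \<otimes> (v \<otimes> (b' \<otimes> t))"
      using cc by (simp add: m_ac l_distr r_distr)
    also have "\<dots> = (u \<otimes> v) \<otimes> ((a \<otimes> t \<oplus> b \<otimes> s) \<otimes> (s' \<otimes> t'))"
      unfolding u(2) v(2) using cc by (simp add: m_ac l_distr r_distr)
    finally have eq: "(u \<otimes> v) \<otimes> ((a' \<otimes> t' \<oplus> b' \<otimes> s') \<otimes> (s \<otimes> t)) = \<dots>" .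
    have "a' \<otimes> t' \<oplus> b' \<otimes> s' \<in> carrier R" "a \<otimes> t \<oplus> b \<otimes> s \<in> carrier R" using cc by simp_all
    then show "frac (a' \<otimes> t' \<oplus> b' \<otimes> s') (s' \<otimes> t') = frac (a \<otimes> t \<oplus> b \<otimes> s) (s \<otimes> t)"
      using S_mult[OF u(1) v(1)] eq
      by (subst frac_eq_iff[OF _ S_mult[OF *(2,5)] _ S_mult[OF a(2) b(2)]]) blast+
  qed
  then show ?thesis by (simp add: localization_def)
qed

lemma L_cases:
  assumes "X \<in> carrier L"
  obtains a s where "X = frac a s" "a \<in> carrier R" "s \<in> S"
  using assms unfolding L_carrier by blast

lemma L_cring: "cring L"
proof (intro cringI abelian_groupI comm_monoidI)
  fix X assume X: "X \<in> carrier L"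
  then obtain a s where Xa: "X = frac a s" and a: "a \<in> carrier R" "s \<in> S" by (rule L_cases)
  have sc: "s \<in> carrier R" using a by (rule_tac S_carrier)
  show "\<one>\<^bsub>L\<^esub> \<otimes>\<^bsub>L\<^esub> X = X" "\<zero>\<^bsub>L\<^esub> \<oplus>\<^bsub>L\<^esub> X = X"
    unfolding Xa L_one L_zero using a sc S_one by (simp_all add: L_mult L_add del: Diff_iff)
  have "frac (\<ominus> a) s \<oplus>\<^bsub>L\<^esub> X = \<zero>\<^bsub>L\<^esub>"
    unfolding Xa L_zero L_add[OF a_inv_closed[OF a(1)] a(2) a]
    by (rule frac_eqI) (use a sc S_one S_mult in \<open>simp_all add: l_minus l_neg del: Diff_iff\<close>)
  then show "\<exists>Y\<in>carrier L. Y \<oplus>\<^bsub>L\<^esub> X = \<zero>\<^bsub>L\<^esub>" using a by (meson a_inv_closed frac_closed)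
  fix Y assume "Y \<in> carrier L"
  then obtain b t where Yb: "Y = frac b t" and b: "b \<in> carrier R" "t \<in> S" by (rule L_cases)
  have tc: "t \<in> carrier R" using b by (rule_tac S_carrier)
  have st: "s \<otimes> t \<in> S" using a b by (rule_tac S_mult)
  show "X \<otimes>\<^bsub>L\<^esub> Y \<in> carrier L" "X \<oplus>\<^bsub>L\<^esub> Y \<in> carrier L"
    unfolding Xa Yb L_mult[OF a b] L_add[OF a b] using a b sc tc st by (simp_all del: Diff_iff)
  show "X \<otimes>\<^bsub>L\<^esub> Y = Y \<otimes>\<^bsub>L\<^esub> X"
    unfolding Xa Yb L_mult[OF a b] L_mult[OF b a] using a b sc tc by (simp add: m_comm del: Diff_iff)
  show "X \<oplus>\<^bsub>L\<^esub> Y = Y \<oplus>\<^bsub>L\<^esub> X"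
    unfolding Xa Yb L_add[OF a b] L_add[OF b a] using a b sc tc
    by (simp add: m_comm[of s t] a_comm[of "a \<otimes> t"] del: Diff_iff)
  fix Z assume "Z \<in> carrier L"
  then obtain c w where Zc: "Z = frac c w" and c: "c \<in> carrier R" "w \<in> S" by (rule L_cases)
  have wc: "w \<in> carrier R" using c by (rule_tac S_carrier)
  have tw: "t \<otimes> w \<in> S" "s \<otimes> w \<in> S" using a b c by (rule_tac S_mult, simp, simp)+
  have m: "a \<otimes> b \<in> carrier R" "b \<otimes> c \<in> carrier R" "a \<otimes> c \<in> carrier R"
    "a \<otimes> t \<oplus> b \<otimes> s \<in> carrier R" "b \<otimes> w \<oplus> c \<otimes> t \<in> carrier R"
    using a b c sc tc wc by simp_all
  show "X \<otimes>\<^bsub>L\<^esub> Y \<otimes>\<^bsub>L\<^esub> Z = X \<otimes>\<^bsub>L\<^esub> (Y \<otimes>\<^bsub>L\<^esub> Z)"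
    unfolding Xa Yb Zc L_mult[OF a b] L_mult[OF b c] L_mult[OF m(1) st c] L_mult[OF a m(2) tw(1)]
    using a b c sc tc wc by (simp add: m_assoc del: Diff_iff)
  show "X \<oplus>\<^bsub>L\<^esub> Y \<oplus>\<^bsub>L\<^esub> Z = X \<oplus>\<^bsub>L\<^esub> (Y \<oplus>\<^bsub>L\<^esub> Z)"
    unfolding Xa Yb Zc L_add[OF a b] L_add[OF b c] L_add[OF m(4) st c] L_add[OF a m(5) tw(1)]
    using a b c sc tc wc by (simp add: m_ac l_distr r_distr a_ac del: Diff_iff)
  show "(X \<oplus>\<^bsub>L\<^esub> Y) \<otimes>\<^bsub>L\<^esub> Z = X \<otimes>\<^bsub>L\<^esub> Z \<oplus>\<^bsub>L\<^esub> Y \<otimes>\<^bsub>L\<^esub> Z"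
    unfolding Xa Yb Zc L_add[OF a b] L_mult[OF b c] L_mult[OF a c] L_mult[OF m(4) st c] L_add[OF m(3) tw(2) m(2) tw(1)]
  proof (rule frac_eqI)
    show "(a \<otimes> t \<oplus> b \<otimes> s) \<otimes> c \<otimes> (s \<otimes> w \<otimes> (t \<otimes> w)) =
        (a \<otimes> c \<otimes> (t \<otimes> w) \<oplus> b \<otimes> c \<otimes> (s \<otimes> w)) \<otimes> (s \<otimes> t \<otimes> w)"
      using a b c sc tc wc by (simp add: m_ac l_distr r_distr del: Diff_iff)
    show "s \<otimes> t \<otimes> w \<in> S" "s \<otimes> w \<otimes> (t \<otimes> w) \<in> S"
      by (rule S_mult[OF st c(2)], rule S_mult[OF tw(2,1)])
  qed (use a b c sc tc wc in \<open>simp_all del: Diff_iff\<close>)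
qed (use S_one in \<open>simp_all add: L_one L_zero del: Diff_iff\<close>)


text \<open>
  The product of \<open>a / s\<close> and \<open>e\<close> is the \<open>f\<close> with \<open>s f = a e\<close>, for an arbitrary representative of the fraction.
\<close>

definition loc_smult :: "('a, 'e, 'z) module_scheme \<Rightarrow> ('a \<times> 'a) set \<Rightarrow> 'e \<Rightarrow> 'e"
  where "loc_smult M X e = (THE f. f \<in> carrier M \<and> (\<exists>a s. (a, s) \<in> X \<and> s \<odot>\<^bsub>M\<^esub> f = a \<odot>\<^bsub>M\<^esub> e))"

definition loc_module :: "('a, 'e, 'z) module_scheme \<Rightarrow> (('a \<times> 'a) set, 'e) module"
  where "loc_module M = \<lparr>carrier = carrier M, mult = mult M, one = one M,
    zero = zero M, add = add M, smult = loc_smult M\<rparr>"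

lemma loc_module_simps [simp]:
  "carrier (loc_module M) = carrier M"
  "x \<oplus>\<^bsub>loc_module M\<^esub> y = x \<oplus>\<^bsub>M\<^esub> y"
  "\<zero>\<^bsub>loc_module M\<^esub> = \<zero>\<^bsub>M\<^esub>"
  "X \<odot>\<^bsub>loc_module M\<^esub> y = loc_smult M X y"
  by (simp_all add: loc_module_def)

lemma uniquely_divisible_cancel:
  assumes "uniquely_divisible M" "s \<in> S" "x \<in> carrier M" "y \<in> carrier M" "s \<odot>\<^bsub>M\<^esub> x = s \<odot>\<^bsub>M\<^esub> y"
  shows "x = y"
  using assms unfolding uniquely_divisible_def bij_betw_def inj_on_def by blast

lemma uniquely_divisible_obtain:
  assumes "uniquely_divisible M" "s \<in> S" "x \<in> carrier M"
  obtains y where "y \<in> carrier M" "s \<odot>\<^bsub>M\<^esub> y = x"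
proof -
  have "x \<in> (\<lambda>x. s \<odot>\<^bsub>M\<^esub> x) ` carrier M"
    using assms unfolding uniquely_divisible_def bij_betw_def by blast
  then show ?thesis using that by blast
qed

context
  fixes M :: "('a, 'e, 'z) module_scheme"
  assumes M: "module R M" and div: "uniquely_divisible M"
begin

interpretation M: module R M by (rule M)

lemma loc_smult_eq:
  assumes a: "a \<in> carrier R" "s \<in> S" and e: "e \<in> carrier M" and f: "f \<in> carrier M" "s \<odot>\<^bsub>M\<^esub> f = a \<odot>\<^bsub>M\<^esub> e"
  shows "loc_smult M (frac a s) e = f"
  unfolding loc_smult_def
proof (rule the_equality)
  show "f \<in> carrier M \<and> (\<exists>b t. (b, t) \<in> frac a s \<and> t \<odot>\<^bsub>M\<^esub> f = b \<odot>\<^bsub>M\<^esub> e)"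
    using f frac_refl[OF a] by blast
  fix f' assume "f' \<in> carrier M \<and> (\<exists>b t. (b, t) \<in> frac a s \<and> t \<odot>\<^bsub>M\<^esub> f' = b \<odot>\<^bsub>M\<^esub> e)"
  then obtain b t where f': "f' \<in> carrier M" "(b, t) \<in> frac a s" "t \<odot>\<^bsub>M\<^esub> f' = b \<odot>\<^bsub>M\<^esub> e" by blast
  obtain u where u: "u \<in> S" "u \<otimes> (a \<otimes> t) = u \<otimes> (b \<otimes> s)" and b: "b \<in> carrier R" "t \<in> S"
    using f'(2) unfolding mem_frac_iff by blast
  note cc = a(1) S_carrier[OF a(2)] b(1) S_carrier[OF b(2)] S_carrier[OF u(1)]
  have "(u \<otimes> s \<otimes> t) \<odot>\<^bsub>M\<^esub> f' = (u \<otimes> s) \<odot>\<^bsub>M\<^esub> (t \<odot>\<^bsub>M\<^esub> f')"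
    using cc f'(1) by (simp add: M.smult_assoc1)
  also have "\<dots> = (u \<otimes> (b \<otimes> s)) \<odot>\<^bsub>M\<^esub> e"
    unfolding f'(3) using cc e by (simp add: M.smult_assoc1[symmetric] m_ac)
  also have "\<dots> = (u \<otimes> t) \<odot>\<^bsub>M\<^esub> (a \<odot>\<^bsub>M\<^esub> e)"
    unfolding u(2)[symmetric] using cc e by (simp add: M.smult_assoc1[symmetric] m_ac)
  also have "\<dots> = (u \<otimes> s \<otimes> t) \<odot>\<^bsub>M\<^esub> f"
    unfolding f(2)[symmetric] using cc f(1) by (simp add: M.smult_assoc1[symmetric] m_ac)
  finally show "f' = f"
    using uniquely_divisible_cancel[OF div S_mult[OF S_mult[OF u(1) a(2)] b(2)] f'(1) f(1)] by blast
qed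

lemma loc_smult_spec:
  assumes a: "a \<in> carrier R" "s \<in> S" and e: "e \<in> carrier M"
  shows "loc_smult M (frac a s) e \<in> carrier M" "s \<odot>\<^bsub>M\<^esub> loc_smult M (frac a s) e = a \<odot>\<^bsub>M\<^esub> e"
proof -
  obtain f where f: "f \<in> carrier M" "s \<odot>\<^bsub>M\<^esub> f = a \<odot>\<^bsub>M\<^esub> e"
    using uniquely_divisible_obtain[OF div a(2) M.smult_closed[OF a(1) e]] .
  show "loc_smult M (frac a s) e \<in> carrier M" "s \<odot>\<^bsub>M\<^esub> loc_smult M (frac a s) e = a \<odot>\<^bsub>M\<^esub> e"
    unfolding loc_smult_eq[OF a e f] by (rule f)+
qed

lemma loc_smult_one_denominator:
  assumes "a \<in> carrier R" "e \<in> carrier M"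
  shows "loc_smult M (frac a \<one>) e = a \<odot>\<^bsub>M\<^esub> e"
  by (rule loc_smult_eq) (use assms S_one in \<open>auto simp del: S_one\<close>)

lemma loc_module: "module L (loc_module M)"
proof (rule moduleI)
  show "cring L" by (rule L_cring)
  show "abelian_group (loc_module M)"
  proof (rule abelian_groupI)
    show "\<exists>y\<in>carrier (loc_module M). y \<oplus>\<^bsub>loc_module M\<^esub> x = \<zero>\<^bsub>loc_module M\<^esub>" if "x \<in> carrier (loc_module M)" for x
      using that M.M.l_neg[of x] M.M.a_inv_closed[of x] by auto
  qed (auto simp: M.M.a_assoc intro: M.M.a_comm)
  fix X x assume "X \<in> carrier L" and x': "x \<in> carrier (loc_module M)"
  then obtain a s where Xa: "X = frac a s" and a: "a \<in> carrier R" "s \<in> S" by (blast elim: L_cases)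
  have x: "x \<in> carrier M" using x' by simp
  note sc = S_carrier[OF a(2)]
  note 1 = loc_smult_spec[OF a x]
  show "X \<odot>\<^bsub>loc_module M\<^esub> x \<in> carrier (loc_module M)" using 1(1) Xa by simp
  {
    fix y assume "y \<in> carrier (loc_module M)"
    then have y: "y \<in> carrier M" by simp
    note 2 = loc_smult_spec[OF a y]
    have "loc_smult M (frac a s) (x \<oplus>\<^bsub>M\<^esub> y) = loc_smult M (frac a s) x \<oplus>\<^bsub>M\<^esub> loc_smult M (frac a s) y"
      by (rule loc_smult_eq[OF a]) (use 1 2 x y a sc in \<open>simp_all add: M.smult_r_distr del: Diff_iff\<close>)
    then show "X \<odot>\<^bsub>loc_module M\<^esub> (x \<oplus>\<^bsub>loc_module M\<^esub> y) = X \<odot>\<^bsub>loc_module M\<^esub> x \<oplus>\<^bsub>loc_module M\<^esub> X \<odot>\<^bsub>loc_module M\<^esub> y"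
      using Xa by simp
  }
  fix Y assume "Y \<in> carrier L"
  then obtain b t where Yb: "Y = frac b t" and b: "b \<in> carrier R" "t \<in> S" by (rule L_cases)
  note tc = S_carrier[OF b(2)]
  note 2 = loc_smult_spec[OF b x]
  have st: "s \<otimes> t \<in> S" by (rule S_mult[OF a(2) b(2)])
  have "loc_smult M (frac (a \<otimes> t \<oplus> b \<otimes> s) (s \<otimes> t)) x = loc_smult M (frac a s) x \<oplus>\<^bsub>M\<^esub> loc_smult M (frac b t) x"
  proof (rule loc_smult_eq)
    have "(s \<otimes> t) \<odot>\<^bsub>M\<^esub> (loc_smult M (frac a s) x \<oplus>\<^bsub>M\<^esub> loc_smult M (frac b t) x)
      = t \<odot>\<^bsub>M\<^esub> (s \<odot>\<^bsub>M\<^esub> loc_smult M (frac a s) x) \<oplus>\<^bsub>M\<^esub> s \<odot>\<^bsub>M\<^esub> (t \<odot>\<^bsub>M\<^esub> loc_smult M (frac b t) x)"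
      using 1(1) 2(1) sc tc by (simp add: M.smult_r_distr M.smult_assoc1[symmetric] m_comm)
    also have "\<dots> = (a \<otimes> t \<oplus> b \<otimes> s) \<odot>\<^bsub>M\<^esub> x"
      unfolding 1(2) 2(2) using a(1) b(1) sc tc x by (simp add: M.smult_l_distr M.smult_assoc1[symmetric] m_comm)
    finally show "(s \<otimes> t) \<odot>\<^bsub>M\<^esub> (loc_smult M (frac a s) x \<oplus>\<^bsub>M\<^esub> loc_smult M (frac b t) x) = (a \<otimes> t \<oplus> b \<otimes> s) \<odot>\<^bsub>M\<^esub> x" .
  qed (use 1(1) 2(1) a(1) b(1) sc tc st x in \<open>simp_all del: Diff_iff\<close>)
  then show "(X \<oplus>\<^bsub>L\<^esub> Y) \<odot>\<^bsub>loc_module M\<^esub> x = X \<odot>\<^bsub>loc_module M\<^esub> x \<oplus>\<^bsub>loc_module M\<^esub> Y \<odot>\<^bsub>loc_module M\<^esub> x"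
    unfolding Xa Yb L_add[OF a b] by simp
  note 3 = loc_smult_spec[OF a 2(1)]
  have "loc_smult M (frac (a \<otimes> b) (s \<otimes> t)) x = loc_smult M (frac a s) (loc_smult M (frac b t) x)"
  proof (rule loc_smult_eq)
    have "(s \<otimes> t) \<odot>\<^bsub>M\<^esub> loc_smult M (frac a s) (loc_smult M (frac b t) x)
      = t \<odot>\<^bsub>M\<^esub> (s \<odot>\<^bsub>M\<^esub> loc_smult M (frac a s) (loc_smult M (frac b t) x))"
      using 3(1) sc tc by (simp add: M.smult_assoc1[symmetric] m_comm)
    also have "\<dots> = a \<odot>\<^bsub>M\<^esub> (t \<odot>\<^bsub>M\<^esub> loc_smult M (frac b t) x)"
      unfolding 3(2) using 2(1) a(1) tc by (simp add: M.smult_assoc1[symmetric] m_comm)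
    also have "\<dots> = (a \<otimes> b) \<odot>\<^bsub>M\<^esub> x"
      unfolding 2(2) using a(1) b(1) x by (simp add: M.smult_assoc1)
    finally show "(s \<otimes> t) \<odot>\<^bsub>M\<^esub> loc_smult M (frac a s) (loc_smult M (frac b t) x) = (a \<otimes> b) \<odot>\<^bsub>M\<^esub> x" .
  qed (use 3(1) a(1) b(1) st x in \<open>simp_all del: Diff_iff\<close>)
  then show "(X \<otimes>\<^bsub>L\<^esub> Y) \<odot>\<^bsub>loc_module M\<^esub> x = X \<odot>\<^bsub>loc_module M\<^esub> (Y \<odot>\<^bsub>loc_module M\<^esub> x)"
    unfolding Xa Yb L_mult[OF a b] by simp
next
  fix x assume "x \<in> carrier (loc_module M)"
  then show "\<one>\<^bsub>L\<^esub> \<odot>\<^bsub>loc_module M\<^esub> x = x"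
    using loc_smult_one_denominator[of \<one> x] by (simp add: L_one)
qed

text \<open>
  A homomorphism from an ideal of \<open>L\<close> is restricted to the numerators, where it is given by some \<open>e\<close> as
  \<open>M\<close> is injective over \<open>R\<close>. Then the same \<open>e\<close> works for the fractions because denominators can be cancelled in \<open>M\<close>.
\<close>

lemma loc_module_baer_injective:
  assumes baer: "baer_injective R M"
  shows "baer_injective L (loc_module M)"
  unfolding baer_injective_def
proof (intro allI impI)
  fix G assume G: "partial_hom L (regular_module L) (loc_module M) G"
  note one = S_one
  let ?G = "{(r, x). r \<in> carrier R \<and> (frac r \<one>, x) \<in> G}"
  have "partial_hom R (regular_module R) M ?G"
  proof (rule partial_homI)
    show "?G \<subseteq> carrier (regular_module R) \<times> carrier M"
      using partial_homD(2)[OF G] by auto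
    show "(\<zero>\<^bsub>regular_module R\<^esub>, \<zero>\<^bsub>M\<^esub>) \<in> ?G"
      using partial_homD(3)[OF G] by (simp add: L_zero)
    show "(x \<oplus>\<^bsub>regular_module R\<^esub> y, a \<oplus>\<^bsub>M\<^esub> b) \<in> ?G" if xa: "(x, a) \<in> ?G" and yb: "(y, b) \<in> ?G" for x a y b
    proof -
      have "(frac x \<one> \<oplus>\<^bsub>L\<^esub> frac y \<one>, a \<oplus>\<^bsub>M\<^esub> b) \<in> G"
        using partial_homD(4)[OF G, of "frac x \<one>" a "frac y \<one>" b] xa yb by simp
      moreover have "frac x \<one> \<oplus>\<^bsub>L\<^esub> frac y \<one> = frac (x \<oplus> y) \<one>"
        using L_add[OF _ one _ one, of x y] xa yb by simp
      ultimately show ?thesis using xa yb by simp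
    qed
    show "(r \<odot>\<^bsub>regular_module R\<^esub> x, r \<odot>\<^bsub>M\<^esub> a) \<in> ?G" if r: "r \<in> carrier R" and xa: "(x, a) \<in> ?G" for r x a
    proof -
      have aM: "a \<in> carrier M" using partial_homD(2)[OF G, of "frac x \<one>" a] xa by simp
      have "(frac r \<one> \<otimes>\<^bsub>L\<^esub> frac x \<one>, r \<odot>\<^bsub>M\<^esub> a) \<in> G"
        using partial_homD(5)[OF G frac_closed[OF r one], of "frac x \<one>" a] xa
          loc_smult_one_denominator[OF r aM] by simp
      moreover have "frac r \<one> \<otimes>\<^bsub>L\<^esub> frac x \<one> = frac (r \<otimes> x) \<one>"
        using L_mult[OF r one _ one, of x] xa by simp
      ultimately show ?thesis using r xa by simp
    qed
    show "a = \<zero>\<^bsub>M\<^esub>" if "(\<zero>\<^bsub>regular_module R\<^esub>, a) \<in> ?G" for a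
      using partial_homD(6)[OF G, of a] that by (simp add: L_zero)
  qed
  then obtain e where e: "e \<in> carrier M" and eG: "\<And>r x. (r, x) \<in> ?G \<Longrightarrow> x = r \<odot>\<^bsub>M\<^esub> e"
    by (rule baer_injectiveD[OF baer]) blast
  have "x = loc_smult M X e" if Xx: "(X, x) \<in> G" for X x
  proof -
    have XL: "X \<in> carrier L" and x: "x \<in> carrier M" using partial_homD(1,2)[OF G Xx] by simp_all
    obtain a s where Xa: "X = frac a s" and a: "a \<in> carrier R" "s \<in> S" using XL by (rule L_cases)
    note sc = S_carrier[OF a(2)]
    have "(frac s \<one> \<otimes>\<^bsub>L\<^esub> X, s \<odot>\<^bsub>M\<^esub> x) \<in> G"
      using partial_homD(5)[OF G frac_closed[OF sc one] Xx] loc_smult_one_denominator[OF sc x] by simp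
    moreover have "frac s \<one> \<otimes>\<^bsub>L\<^esub> X = frac a \<one>"
      unfolding Xa L_mult[OF sc one a]
      by (rule frac_eqI) (use a sc one in \<open>simp_all add: m_comm del: Diff_iff\<close>)
    ultimately have "s \<odot>\<^bsub>M\<^esub> x = a \<odot>\<^bsub>M\<^esub> e" using eG[of a "s \<odot>\<^bsub>M\<^esub> x"] a(1) by simp
    then show ?thesis unfolding Xa by (rule loc_smult_eq[OF a e x, symmetric])
  qed
  then show "\<exists>e\<in>carrier (loc_module M). \<forall>r x. (r, x) \<in> G \<longrightarrow> x = r \<odot>\<^bsub>loc_module M\<^esub> e"
    using e by auto
qed

end

lemma loc_module_hom:
  assumes M: "module R M" "uniquely_divisible M" and N: "module R N" "uniquely_divisible N"
    and f: "f \<in> mod_hom R M N"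
  shows "f \<in> mod_hom L (loc_module M) (loc_module N)"
proof (rule mod_homI)
  fix X x assume "X \<in> carrier L" and x': "x \<in> carrier (loc_module M)"
  then obtain a s where Xa: "X = frac a s" and a: "a \<in> carrier R" "s \<in> S" by (blast elim: L_cases)
  have x: "x \<in> carrier M" using x' by simp
  note 1 = loc_smult_spec[OF M a x]
  have "loc_smult N (frac a s) (f x) = f (loc_smult M (frac a s) x)"
  proof (rule loc_smult_eq[OF N a])
    show "s \<odot>\<^bsub>N\<^esub> f (loc_smult M (frac a s) x) = a \<odot>\<^bsub>N\<^esub> f x"
      using 1(2) mod_homD(3)[OF f S_carrier[OF a(2)] 1(1)] mod_homD(3)[OF f a(1) x] by simp
  qed (use mod_homD(1)[OF f] 1(1) x in simp_all)
  then show "f (X \<odot>\<^bsub>loc_module M\<^esub> x) = X \<odot>\<^bsub>loc_module N\<^esub> f x" using Xa by simp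
qed (use mod_homD(1,2)[OF f] in simp_all)

end

section \<open>Localization of injective resolutions\<close>

text \<open>
  Extending \<open>g\<close> along an injective \<open>f\<close> is extending the partial homomorphism \<open>f x \<mapsto> g x\<close>.
\<close>

lemma injective_module_if_baer:
  assumes E: "module R E" and baer: "baer_injective R E"
  shows "injective_module R E"
  unfolding injective_module_def
proof (intro conjI E allI impI, elim conjE)
  fix M N :: "'a umodule" and f g
  assume M: "module R M" and N: "module R N" and f: "f \<in> mod_hom R M N" and inj: "inj_on f (carrier M)"
    and g: "g \<in> mod_hom R M E"
  let ?G = "{(f x, g x) | x. x \<in> carrier M}"
  interpret M: module R M by fact
  have "partial_hom R N E ?G"
  proof (rule partial_hom_image[OF M N E f g])
    fix x assume x: "x \<in> carrier M" "f x = \<zero>\<^bsub>N\<^esub>"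
    then have "x = \<zero>\<^bsub>M\<^esub>" using inj_onD[OF inj, of x "\<zero>\<^bsub>M\<^esub>"] mod_hom_zero[OF M N f] by simp
    then show "g x = \<zero>\<^bsub>E\<^esub>" using mod_hom_zero[OF M E g] by simp
  qed
  then obtain h where h: "h \<in> mod_hom R N E" and hG: "\<And>x y. (x, y) \<in> ?G \<Longrightarrow> h x = y"
    by (rule baer_criterion[OF N E baer]) blast
  have "h (f x) = g x" if "x \<in> carrier M" for x
    by (rule hG) (use that in blast)
  then show "\<exists>h\<in>mod_hom R N E. \<forall>x\<in>carrier M. h (f x) = g x" using h by blast
qed

text \<open>
  The structure of \<open>M\<close> carried over to the image of an injection \<open>j\<close>. It brings modules into the type
  to which injective resolutions are confined.
\<close>

definition transport_module :: "('e \<Rightarrow> 'f) \<Rightarrow> ('r, 'e, 'z) module_scheme \<Rightarrow> ('r, 'f) module"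
  where "transport_module j M = \<lparr>carrier = j ` carrier M,
    mult = (\<lambda>x y. j (inv_into UNIV j x \<otimes>\<^bsub>M\<^esub> inv_into UNIV j y)), one = j \<one>\<^bsub>M\<^esub>, zero = j \<zero>\<^bsub>M\<^esub>,
    add = (\<lambda>x y. j (inv_into UNIV j x \<oplus>\<^bsub>M\<^esub> inv_into UNIV j y)), smult = (\<lambda>r x. j (r \<odot>\<^bsub>M\<^esub> inv_into UNIV j x))\<rparr>"

context
  fixes j :: "'e \<Rightarrow> 'f" and R :: "('r, 'p) ring_scheme" and M :: "('r, 'e, 'z) module_scheme"
  assumes j: "inj j" and M: "module R M"
begin

interpretation M: module R M by (rule M)

lemma transport_module_simps:
  "carrier (transport_module j M) = j ` carrier M"
  "j x \<oplus>\<^bsub>transport_module j M\<^esub> j y = j (x \<oplus>\<^bsub>M\<^esub> y)"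
  "\<zero>\<^bsub>transport_module j M\<^esub> = j \<zero>\<^bsub>M\<^esub>"
  "r \<odot>\<^bsub>transport_module j M\<^esub> j y = j (r \<odot>\<^bsub>M\<^esub> y)"
  using j by (simp_all add: transport_module_def)

lemma transport_module: "module R (transport_module j M)"
proof (intro moduleI abelian_groupI)
  show "cring R" by (rule M.R.is_cring)
  show "\<exists>y\<in>carrier (transport_module j M). y \<oplus>\<^bsub>transport_module j M\<^esub> x = \<zero>\<^bsub>transport_module j M\<^esub>"
    if xT: "x \<in> carrier (transport_module j M)" for x
  proof -
    obtain m where m: "x = j m" "m \<in> carrier M" using xT unfolding transport_module_simps by blast
    then have "j (\<ominus>\<^bsub>M\<^esub> m) \<oplus>\<^bsub>transport_module j M\<^esub> x = \<zero>\<^bsub>transport_module j M\<^esub>"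
      by (simp add: transport_module_simps M.M.l_neg)
    then show ?thesis using m by (metis M.M.a_inv_closed imageI transport_module_simps(1))
  qed
qed (auto simp: transport_module_simps M.M.a_assoc M.smult_l_distr M.smult_r_distr M.smult_assoc1
    intro!: arg_cong[where f = j] intro: M.M.a_comm)

lemma transport_baer_injective:
  assumes baer: "baer_injective R M"
  shows "baer_injective R (transport_module j M)"
  unfolding baer_injective_def
proof (intro allI impI)
  fix G assume G: "partial_hom R (regular_module R) (transport_module j M) G"
  let ?G = "{(r, x). (r, j x) \<in> G}"
  have "partial_hom R (regular_module R) M ?G"
  proof (rule partial_homI)
    show "?G \<subseteq> carrier (regular_module R) \<times> carrier M"
    proof clarify
      fix r x assume rx: "(r, j x) \<in> G"
      then show "r \<in> carrier (regular_module R) \<and> x \<in> carrier M"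
        using partial_homD(1,2)[OF G rx] by (simp add: transport_module_simps inj_image_mem_iff[OF j])
    qed
    show "(\<zero>\<^bsub>regular_module R\<^esub>, \<zero>\<^bsub>M\<^esub>) \<in> ?G"
      using partial_homD(3)[OF G] by (simp add: transport_module_simps)
    show "(x \<oplus>\<^bsub>regular_module R\<^esub> y, a \<oplus>\<^bsub>M\<^esub> b) \<in> ?G" if "(x, a) \<in> ?G" "(y, b) \<in> ?G" for x a y b
      using partial_homD(4)[OF G, of x "j a" y "j b"] that by (simp add: transport_module_simps)
    show "(r \<odot>\<^bsub>regular_module R\<^esub> x, r \<odot>\<^bsub>M\<^esub> a) \<in> ?G" if "r \<in> carrier R" "(x, a) \<in> ?G" for r x a
      using partial_homD(5)[OF G that(1), of x "j a"] that by (simp add: transport_module_simps)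
    show "a = \<zero>\<^bsub>M\<^esub>" if "(\<zero>\<^bsub>regular_module R\<^esub>, a) \<in> ?G" for a
      using partial_homD(6)[OF G, of "j a"] that injD[OF j] by (simp add: transport_module_simps)
  qed
  then obtain e where e: "e \<in> carrier M" and eG: "\<And>r x. (r, x) \<in> ?G \<Longrightarrow> x = r \<odot>\<^bsub>M\<^esub> e"
    by (rule baer_injectiveD[OF baer]) blast
  have "x = r \<odot>\<^bsub>transport_module j M\<^esub> j e" if rx: "(r, x) \<in> G" for r x
  proof -
    obtain y where y: "x = j y" using partial_homD(2)[OF G rx] unfolding transport_module_simps by blast
    then show ?thesis using eG[of r y] rx by (simp add: transport_module_simps)
  qed
  then show "\<exists>e\<in>carrier (transport_module j M). \<forall>r x. (r, x) \<in> G \<longrightarrow> x = r \<odot>\<^bsub>transport_module j M\<^esub> e"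
    using e by (auto simp: transport_module_simps)
qed

end

text \<open>
  Replace each \<open>E i\<close> by its localization \<open>F i\<close>, the image of the projection \<open>\<kappa> i\<close>, and each differential
  \<open>\<delta> i\<close> by \<open>\<kappa> (Suc i) \<circ> \<delta> i\<close>. Exactness survives for the usual reason: an equation that holds after
  applying \<open>\<kappa>\<close> holds before after multiplication by some \<open>s\<close> in \<open>S\<close>, and \<open>s\<close> can be
  divided out again in \<open>F i\<close>.
\<close>

theorem finite_injective_dimension_localization:
  fixes E :: "nat \<Rightarrow> ('a, 'e) module" and j :: "'e \<Rightarrow> (nat \<times> ('a \<times> 'a) set) set"
  assumes R: "cring R" and noeth: "noetherian_ring R" and P: "primeideal P R"
    and E: "\<And>i. module R (E i)" "\<And>i. baer_injective R (E i)"
    and eps: "\<epsilon> \<in> mod_hom R (regular_module R) (E 0)" "inj_on \<epsilon> (carrier R)"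
    and del: "\<And>i. \<delta> i \<in> mod_hom R (E i) (E (Suc i))"
    and ex0: "\<epsilon> ` carrier R = {e \<in> carrier (E 0). \<delta> 0 e = \<zero>\<^bsub>E 1\<^esub>}"
    and ex: "\<And>i. \<delta> i ` carrier (E i) = {e \<in> carrier (E (Suc i)). \<delta> (Suc i) e = \<zero>\<^bsub>E (Suc (Suc i))\<^esub>}"
    and triv: "\<And>i. i > d \<Longrightarrow> carrier (E i) = {\<zero>\<^bsub>E i\<^esub>}"
    and j: "inj j"
  shows "finite_injective_dimension (localization R P) (regular_module (localization R P))"
proof -
  interpret prime_localization R P
    by (intro prime_localization.intro prime_localization_axioms.intro R P)
  interpret E: module R "E i" for i by (rule E)
  have "\<forall>i. \<exists>\<kappa>. \<kappa> \<in> mod_hom R (E i) (E i) \<and>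
    (\<forall>e\<in>carrier (E i). \<kappa> (\<kappa> e) = \<kappa> e \<and> (\<kappa> e = \<zero>\<^bsub>E i\<^esub> \<longleftrightarrow> (\<exists>s\<in>S. s \<odot>\<^bsub>E i\<^esub> e = \<zero>\<^bsub>E i\<^esub>))) \<and>
    module R (E i\<lparr>carrier := \<kappa> ` carrier (E i)\<rparr>) \<and>
    baer_injective R (E i\<lparr>carrier := \<kappa> ` carrier (E i)\<rparr>) \<and>
    uniquely_divisible (E i\<lparr>carrier := \<kappa> ` carrier (E i)\<rparr>)"
    using localize_injective[OF noeth E] by meson
  then obtain \<kappa> where \<kappa>': "\<forall>i. \<kappa> i \<in> mod_hom R (E i) (E i) \<and>
    (\<forall>e\<in>carrier (E i). \<kappa> i (\<kappa> i e) = \<kappa> i e \<and> (\<kappa> i e = \<zero>\<^bsub>E i\<^esub> \<longleftrightarrow> (\<exists>s\<in>S. s \<odot>\<^bsub>E i\<^esub> e = \<zero>\<^bsub>E i\<^esub>))) \<and>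
    module R (E i\<lparr>carrier := \<kappa> i ` carrier (E i)\<rparr>) \<and>
    baer_injective R (E i\<lparr>carrier := \<kappa> i ` carrier (E i)\<rparr>) \<and>
    uniquely_divisible (E i\<lparr>carrier := \<kappa> i ` carrier (E i)\<rparr>)"
    by (rule choice[THEN exE])
  define F where "F i = E i\<lparr>carrier := \<kappa> i ` carrier (E i)\<rparr>" for i
  have F_simps [simp]: "carrier (F i) = \<kappa> i ` carrier (E i)" "x \<oplus>\<^bsub>F i\<^esub> y = x \<oplus>\<^bsub>E i\<^esub> y"
    "\<zero>\<^bsub>F i\<^esub> = \<zero>\<^bsub>E i\<^esub>" "r \<odot>\<^bsub>F i\<^esub> y = r \<odot>\<^bsub>E i\<^esub> y" for i x y r
    by (simp_all add: F_def)
  have \<kappa>: "\<kappa> i \<in> mod_hom R (E i) (E i)" for i using \<kappa>' by blast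
  have idem: "\<kappa> i (\<kappa> i e) = \<kappa> i e" if "e \<in> carrier (E i)" for i e using \<kappa>' that by blast
  have ker: "\<kappa> i e = \<zero>\<^bsub>E i\<^esub> \<longleftrightarrow> (\<exists>s\<in>S. s \<odot>\<^bsub>E i\<^esub> e = \<zero>\<^bsub>E i\<^esub>)" if "e \<in> carrier (E i)" for i e
    using \<kappa>' that by blast
  have FM: "module R (F i)" and F_baer: "baer_injective R (F i)" and F_div: "uniquely_divisible (F i)" for i
    using \<kappa>' by (simp_all add: F_def)
  interpret F: module R "F i" for i by (rule FM)
  note \<kappa>c = mod_homD(1)[OF \<kappa>]
  have FE: "x \<in> carrier (E i)" if "x \<in> carrier (F i)" for i x using that \<kappa>c by auto
  have fixed: "\<kappa> i x = x" if "x \<in> carrier (F i)" for i x using that idem by auto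
  have \<kappa>F: "\<kappa> i e \<in> carrier (F i)" if "e \<in> carrier (E i)" for i e using that by simp
  have \<kappa>_hom: "\<kappa> i \<in> mod_hom R (E i) (F i)" for i
    by (rule mod_homI) (use mod_homD(2,3)[OF \<kappa>] in auto)
  have incl: "(\<lambda>x. x) \<in> mod_hom R (F i) (E i)" for i
    by (rule mod_homI) (use FE in auto)
  have d_hom: "(\<lambda>x. \<kappa> (Suc i) (\<delta> i x)) \<in> mod_hom R (F i) (F (Suc i))" for i
    by (rule mod_hom_compose[OF mod_hom_compose[OF incl del] \<kappa>_hom])
  note del_c = mod_homD(1)[OF del]
  have del0: "\<delta> i \<zero>\<^bsub>E i\<^esub> = \<zero>\<^bsub>E (Suc i)\<^esub>" for i by (rule mod_hom_zero[OF E(1) E(1) del])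
  have \<kappa>0: "\<kappa> i \<zero>\<^bsub>E i\<^esub> = \<zero>\<^bsub>E i\<^esub>" for i by (rule mod_hom_zero[OF E(1) E(1) \<kappa>])
  \<comment> \<open>The differential maps torsion to torsion, which the projection kills.\<close>
  have nat: "\<kappa> (Suc i) (\<delta> i (\<kappa> i e)) = \<kappa> (Suc i) (\<delta> i e)" if e: "e \<in> carrier (E i)" for i e
  proof -
    let ?g = "e \<ominus>\<^bsub>E i\<^esub> \<kappa> i e"
    have g: "?g \<in> carrier (E i)" using e \<kappa>c by simp
    have ee: "e = \<kappa> i e \<oplus>\<^bsub>E i\<^esub> ?g" using e \<kappa>c[OF e] by (simp add: a_minus_def E.M.a_lcomm E.M.r_neg)
    have "\<kappa> i e = \<kappa> i (\<kappa> i e) \<oplus>\<^bsub>E i\<^esub> \<kappa> i ?g"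
      using mod_homD(2)[OF \<kappa> \<kappa>c[OF e] g] ee by metis
    then have "\<kappa> i e = \<kappa> i e \<oplus>\<^bsub>E i\<^esub> \<kappa> i ?g" unfolding idem[OF e] .
    then have "\<kappa> i ?g = \<zero>\<^bsub>E i\<^esub>"
      using E.M.add.l_cancel_one'[OF \<kappa>c[OF e] \<kappa>c[OF g]] by simp
    then obtain s where s: "s \<in> S" "s \<odot>\<^bsub>E i\<^esub> ?g = \<zero>\<^bsub>E i\<^esub>" using ker[OF g] by blast
    have "s \<odot>\<^bsub>E (Suc i)\<^esub> \<delta> i ?g = \<zero>\<^bsub>E (Suc i)\<^esub>"
      using mod_homD(3)[OF del S_carrier[OF s(1)] g] s(2) del0 by simp
    then have 0: "\<kappa> (Suc i) (\<delta> i ?g) = \<zero>\<^bsub>E (Suc i)\<^esub>" using ker[OF del_c[OF g]] s(1) by blast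
    have "\<delta> i e = \<delta> i (\<kappa> i e) \<oplus>\<^bsub>E (Suc i)\<^esub> \<delta> i ?g"
      using mod_homD(2)[OF del \<kappa>c[OF e] g] ee by metis
    then have "\<kappa> (Suc i) (\<delta> i e) = \<kappa> (Suc i) (\<delta> i (\<kappa> i e)) \<oplus>\<^bsub>E (Suc i)\<^esub> \<kappa> (Suc i) (\<delta> i ?g)"
      using mod_homD(2)[OF \<kappa> del_c[OF \<kappa>c[OF e]] del_c[OF g]] by metis
    then show ?thesis using 0 \<kappa>c[OF del_c[OF \<kappa>c[OF e]]] by simp
  qed
  note one = S_one
  have epsc: "\<epsilon> a \<in> carrier (E 0)" if "a \<in> carrier R" for a using mod_homD(1)[OF eps(1)] that by simp
  have eps_mult: "\<epsilon> (r \<otimes>\<^bsub>R\<^esub> a) = r \<odot>\<^bsub>E 0\<^esub> \<epsilon> a" if "r \<in> carrier R" "a \<in> carrier R" for r a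
    using mod_homD(3)[OF eps(1), of r a] that by simp
  have eps0: "\<epsilon> \<zero>\<^bsub>R\<^esub> = \<zero>\<^bsub>E 0\<^esub>" using eps_mult[of "\<zero>\<^bsub>R\<^esub>" "\<zero>\<^bsub>R\<^esub>"] epsc by simp
  \<comment> \<open>By linearity, the augmentation of the localized resolution is \<open>X \<mapsto> X q\<close>.\<close>
  define q where "q = \<kappa> 0 (\<epsilon> \<one>\<^bsub>R\<^esub>)"
  have q: "q \<in> carrier (F 0)" unfolding q_def by (rule \<kappa>F[OF epsc]) simp
  have qa: "\<kappa> 0 (\<epsilon> a) = a \<odot>\<^bsub>E 0\<^esub> q" if a: "a \<in> carrier R" for a
    using eps_mult[OF a one_closed] mod_homD(3)[OF \<kappa> a epsc[OF one_closed]] a by (simp add: q_def)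
  define \<eta> where "\<eta> X = loc_smult (F 0) X q" for X
  note LF = loc_module[OF FM F_div]
  interpret LF: module L "loc_module (F i)" for i by (rule LF)
  have \<eta>_hom: "\<eta> \<in> mod_hom L (regular_module L) (loc_module (F 0))"
  proof (rule mod_homI)
    show "\<eta> X \<in> carrier (loc_module (F 0))" if "X \<in> carrier (regular_module L)" for X
      using LF.smult_closed[of X q 0] q that by (simp add: \<eta>_def)
    show "\<eta> (X \<oplus>\<^bsub>regular_module L\<^esub> Y) = \<eta> X \<oplus>\<^bsub>loc_module (F 0)\<^esub> \<eta> Y"
      if "X \<in> carrier (regular_module L)" "Y \<in> carrier (regular_module L)" for X Y
      using LF.smult_l_distr[of X Y q 0] q that by (simp add: \<eta>_def)
    show "\<eta> (X \<odot>\<^bsub>regular_module L\<^esub> Y) = X \<odot>\<^bsub>loc_module (F 0)\<^esub> \<eta> Y"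
      if "X \<in> carrier L" "Y \<in> carrier (regular_module L)" for X Y
      using LF.smult_assoc1[of X Y q 0] q that by (simp add: \<eta>_def)
  qed
  have \<eta>_frac: "\<eta> (frac a s) = f" if "a \<in> carrier R" "s \<in> S" "f \<in> carrier (F 0)" "s \<odot>\<^bsub>E 0\<^esub> f = \<kappa> 0 (\<epsilon> a)" for a s f
    unfolding \<eta>_def by (rule loc_smult_eq[OF FM F_div that(1,2) q that(3)]) (use that(4) qa[OF that(1)] in simp)
  have \<eta>_spec: "\<eta> (frac a s) \<in> carrier (F 0)" "s \<odot>\<^bsub>E 0\<^esub> \<eta> (frac a s) = \<kappa> 0 (\<epsilon> a)" if "a \<in> carrier R" "s \<in> S" for a s
    using loc_smult_spec[OF FM F_div that q] qa[OF that(1)] by (simp_all add: \<eta>_def)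
  have \<eta>_inj: "inj_on \<eta> (carrier L)"
  proof (rule inj_onI)
    fix X Y assume XY: "X \<in> carrier L" "Y \<in> carrier L" "\<eta> X = \<eta> Y"
    obtain a s where X: "X = frac a s" and a: "a \<in> carrier R" "s \<in> S" using XY(1) by (rule L_cases)
    obtain b t where Y: "Y = frac b t" and b: "b \<in> carrier R" "t \<in> S" using XY(2) by (rule L_cases)
    note sc = S_carrier[OF a(2)] and tc = S_carrier[OF b(2)]
    let ?c = "a \<otimes>\<^bsub>R\<^esub> t" and ?d = "b \<otimes>\<^bsub>R\<^esub> s"
    have cd: "?c \<in> carrier R" "?d \<in> carrier R" using a(1) b(1) sc tc by simp_all
    have "\<kappa> 0 (\<epsilon> ?c) = t \<odot>\<^bsub>E 0\<^esub> \<kappa> 0 (\<epsilon> a)"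
      using a(1) sc tc epsc[OF a(1)] by (simp add: m_comm[of a t] eps_mult mod_homD(3)[OF \<kappa>])
    also have "\<dots> = s \<odot>\<^bsub>E 0\<^esub> \<kappa> 0 (\<epsilon> b)"
      unfolding \<eta>_spec(2)[OF a, symmetric] \<eta>_spec(2)[OF b, symmetric]
      using XY(3)[unfolded X Y] \<eta>_spec(1)[OF a, THEN FE] sc tc
      by (simp add: E.smult_assoc1[symmetric] m_comm)
    also have "\<dots> = \<kappa> 0 (\<epsilon> ?d)"
      using b(1) sc tc epsc[OF b(1)] by (simp add: m_comm[of b s] eps_mult mod_homD(3)[OF \<kappa>])
    finally have eq: "\<kappa> 0 (\<epsilon> ?c) = \<kappa> 0 (\<epsilon> ?d)" .
    have m: "?c \<oplus>\<^bsub>R\<^esub> \<ominus>\<^bsub>R\<^esub> ?d \<in> carrier R" using cd by simp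
    have "\<epsilon> (?c \<oplus>\<^bsub>R\<^esub> \<ominus>\<^bsub>R\<^esub> ?d) = \<epsilon> ?c \<oplus>\<^bsub>E 0\<^esub> \<epsilon> (\<ominus>\<^bsub>R\<^esub> ?d)"
      using mod_homD(2)[OF eps(1), of ?c "\<ominus>\<^bsub>R\<^esub> ?d"] cd by simp
    moreover have "\<epsilon> ?d \<oplus>\<^bsub>E 0\<^esub> \<epsilon> (\<ominus>\<^bsub>R\<^esub> ?d) = \<zero>\<^bsub>E 0\<^esub>"
      using mod_homD(2)[OF eps(1), of ?d "\<ominus>\<^bsub>R\<^esub> ?d"] cd eps0 by (simp add: r_neg)
    ultimately have "\<kappa> 0 (\<epsilon> (?c \<oplus>\<^bsub>R\<^esub> \<ominus>\<^bsub>R\<^esub> ?d)) = \<zero>\<^bsub>E 0\<^esub>"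
      using mod_homD(2)[OF \<kappa>[of 0], of "\<epsilon> ?c" "\<epsilon> (\<ominus>\<^bsub>R\<^esub> ?d)"] mod_homD(2)[OF \<kappa>[of 0], of "\<epsilon> ?d" "\<epsilon> (\<ominus>\<^bsub>R\<^esub> ?d)"]
        epsc cd eq \<kappa>0[of 0] by simp
    then obtain u where u: "u \<in> S" "u \<odot>\<^bsub>E 0\<^esub> \<epsilon> (?c \<oplus>\<^bsub>R\<^esub> \<ominus>\<^bsub>R\<^esub> ?d) = \<zero>\<^bsub>E 0\<^esub>"
      using ker[OF epsc[OF m]] by blast
    note uc = S_carrier[OF u(1)]
    have "\<epsilon> (u \<otimes>\<^bsub>R\<^esub> (?c \<oplus>\<^bsub>R\<^esub> \<ominus>\<^bsub>R\<^esub> ?d)) = \<epsilon> \<zero>\<^bsub>R\<^esub>" using eps_mult[OF uc m] u(2) eps0 by simp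
    then have "u \<otimes>\<^bsub>R\<^esub> (?c \<oplus>\<^bsub>R\<^esub> \<ominus>\<^bsub>R\<^esub> ?d) = \<zero>\<^bsub>R\<^esub>" using inj_onD[OF eps(2)] m uc by simp
    then have "u \<otimes>\<^bsub>R\<^esub> ?c \<oplus>\<^bsub>R\<^esub> \<ominus>\<^bsub>R\<^esub> (u \<otimes>\<^bsub>R\<^esub> ?d) = \<zero>\<^bsub>R\<^esub>"
      using cd uc by (simp add: r_distr r_minus)
    then have "u \<otimes>\<^bsub>R\<^esub> ?c = u \<otimes>\<^bsub>R\<^esub> ?d"
      using cd uc by (metis a_inv_closed minus_equality minus_minus m_closed)
    then show "X = Y" unfolding X Y using frac_eq_iff[OF a b] u(1) by blast
  qed
  have eps_del: "\<delta> 0 (\<epsilon> a) = \<zero>\<^bsub>E 1\<^esub>" if "a \<in> carrier R" for a using ex0 that by blast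
  have \<eta>_image: "\<eta> ` carrier L = {e \<in> carrier (F 0). \<kappa> 1 (\<delta> 0 e) = \<zero>\<^bsub>E 1\<^esub>}"
  proof (intro equalityI subsetI)
    fix e assume "e \<in> \<eta> ` carrier L"
    then obtain X where "X \<in> carrier L" and eX: "e = \<eta> X" by blast
    then obtain a s where X: "X = frac a s" and a: "a \<in> carrier R" "s \<in> S" by (blast elim: L_cases)
    note sc = S_carrier[OF a(2)]
    have e: "e \<in> carrier (F 0)" "s \<odot>\<^bsub>E 0\<^esub> e = \<kappa> 0 (\<epsilon> a)" unfolding eX X by (rule \<eta>_spec[OF a])+
    have "s \<odot>\<^bsub>E 1\<^esub> \<kappa> 1 (\<delta> 0 e) = \<kappa> 1 (\<delta> 0 (s \<odot>\<^bsub>E 0\<^esub> e))"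
      using mod_homD(3)[OF d_hom sc e(1)] by simp
    also have "\<dots> = \<zero>\<^bsub>E 1\<^esub>"
      unfolding e(2) using nat[OF epsc[OF a(1)]] eps_del[OF a(1)] \<kappa>0[of 1] by simp
    finally have "s \<odot>\<^bsub>E 1\<^esub> \<kappa> 1 (\<delta> 0 e) = s \<odot>\<^bsub>E 1\<^esub> \<zero>\<^bsub>E 1\<^esub>" using sc by simp
    then have "\<kappa> 1 (\<delta> 0 e) = \<zero>\<^bsub>E 1\<^esub>"
      using uniquely_divisible_cancel[OF F_div[of 1] a(2), of "\<kappa> 1 (\<delta> 0 e)" "\<zero>\<^bsub>E 1\<^esub>"]
        mod_homD(1)[OF d_hom[of 0] e(1)] F.M.zero_closed[of 1] by simp
    then show "e \<in> {e \<in> carrier (F 0). \<kappa> 1 (\<delta> 0 e) = \<zero>\<^bsub>E 1\<^esub>}" using e(1) by blast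
  next
    fix e assume "e \<in> {e \<in> carrier (F 0). \<kappa> 1 (\<delta> 0 e) = \<zero>\<^bsub>E 1\<^esub>}"
    then have e: "e \<in> carrier (F 0)" "\<kappa> 1 (\<delta> 0 e) = \<zero>\<^bsub>E 1\<^esub>" by blast+
    have eE: "e \<in> carrier (E 0)" by (rule FE[OF e(1)])
    obtain s where s: "s \<in> S" "s \<odot>\<^bsub>E 1\<^esub> \<delta> 0 e = \<zero>\<^bsub>E 1\<^esub>"
      using ker[of "\<delta> 0 e" 1] del_c[OF eE] e(2) by auto
    note sc = S_carrier[OF s(1)]
    have "\<delta> 0 (s \<odot>\<^bsub>E 0\<^esub> e) = \<zero>\<^bsub>E 1\<^esub>" using mod_homD(3)[OF del[of 0] sc eE] s(2) by simp
    then have "s \<odot>\<^bsub>E 0\<^esub> e \<in> \<epsilon> ` carrier R" unfolding ex0 using E.smult_closed[OF sc eE] by blast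
    then obtain a where a: "a \<in> carrier R" "s \<odot>\<^bsub>E 0\<^esub> e = \<epsilon> a" by blast
    have "s \<odot>\<^bsub>E 0\<^esub> e = \<kappa> 0 (\<epsilon> a)"
      using mod_homD(3)[OF \<kappa> sc eE] fixed[OF e(1)] a(2) by simp
    then have "\<eta> (frac a s) = e" by (rule \<eta>_frac[OF a(1) s(1) e(1)])
    then show "e \<in> \<eta> ` carrier L" using frac_closed[OF a(1) s(1)] by blast
  qed
  have d_image: "(\<lambda>x. \<kappa> (Suc i) (\<delta> i x)) ` carrier (F i) =
    {e \<in> carrier (F (Suc i)). \<kappa> (Suc (Suc i)) (\<delta> (Suc i) e) = \<zero>\<^bsub>E (Suc (Suc i))\<^esub>}" for i
  proof (intro equalityI subsetI)
    fix y assume "y \<in> (\<lambda>x. \<kappa> (Suc i) (\<delta> i x)) ` carrier (F i)"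
    then obtain x where x: "x \<in> carrier (F i)" "y = \<kappa> (Suc i) (\<delta> i x)" by blast
    have "\<delta> (Suc i) (\<delta> i x) = \<zero>\<^bsub>E (Suc (Suc i))\<^esub>" using ex[of i] FE[OF x(1)] by blast
    then have "\<kappa> (Suc (Suc i)) (\<delta> (Suc i) y) = \<zero>\<^bsub>E (Suc (Suc i))\<^esub>"
      unfolding x(2) using nat[OF del_c[OF FE[OF x(1)]]] \<kappa>0 by simp
    then show "y \<in> {e \<in> carrier (F (Suc i)). \<kappa> (Suc (Suc i)) (\<delta> (Suc i) e) = \<zero>\<^bsub>E (Suc (Suc i))\<^esub>}"
      unfolding x(2) using \<kappa>F[OF del_c[OF FE[OF x(1)]]] by blast
  next
    fix e assume "e \<in> {e \<in> carrier (F (Suc i)). \<kappa> (Suc (Suc i)) (\<delta> (Suc i) e) = \<zero>\<^bsub>E (Suc (Suc i))\<^esub>}"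
    then have e: "e \<in> carrier (F (Suc i))" "\<kappa> (Suc (Suc i)) (\<delta> (Suc i) e) = \<zero>\<^bsub>E (Suc (Suc i))\<^esub>" by blast+
    have eE: "e \<in> carrier (E (Suc i))" by (rule FE[OF e(1)])
    obtain s where s: "s \<in> S" "s \<odot>\<^bsub>E (Suc (Suc i))\<^esub> \<delta> (Suc i) e = \<zero>\<^bsub>E (Suc (Suc i))\<^esub>"
      using ker[OF del_c[OF eE]] e(2) by blast
    note sc = S_carrier[OF s(1)]
    have "\<delta> (Suc i) (s \<odot>\<^bsub>E (Suc i)\<^esub> e) = \<zero>\<^bsub>E (Suc (Suc i))\<^esub>" using mod_homD(3)[OF del sc eE] s(2) by simp
    then have "s \<odot>\<^bsub>E (Suc i)\<^esub> e \<in> \<delta> i ` carrier (E i)" unfolding ex using E.smult_closed[OF sc eE] by blast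
    then obtain f where f: "f \<in> carrier (E i)" "s \<odot>\<^bsub>E (Suc i)\<^esub> e = \<delta> i f" by blast
    obtain g where g: "g \<in> carrier (F i)" "s \<odot>\<^bsub>F i\<^esub> g = \<kappa> i f"
      using uniquely_divisible_obtain[OF F_div s(1) \<kappa>F[OF f(1)]] .
    have "s \<odot>\<^bsub>F (Suc i)\<^esub> e = \<kappa> (Suc i) (\<delta> i f)"
      using mod_homD(3)[OF \<kappa> sc eE] fixed[OF e(1)] f(2) by simp
    also have "\<dots> = s \<odot>\<^bsub>F (Suc i)\<^esub> \<kappa> (Suc i) (\<delta> i g)"
      using nat[OF f(1)] mod_homD(3)[OF d_hom sc g(1)] g(2) by simp
    finally have "e = \<kappa> (Suc i) (\<delta> i g)"
      by (rule uniquely_divisible_cancel[OF F_div s(1) e(1) \<kappa>F[OF del_c[OF FE[OF g(1)]]]])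
    then show "e \<in> (\<lambda>x. \<kappa> (Suc i) (\<delta> i x)) ` carrier (F i)" using g(1) by blast
  qed
  define T where "T i = transport_module j (loc_module (F i))" for i
  note T_simps = transport_module_simps[OF j LF, folded T_def]
  have T: "module L (T i)" "injective_module L (T i)" for i
    unfolding T_def using transport_module[OF j LF]
      injective_module_if_baer[OF transport_module[OF j LF] transport_baer_injective[OF j LF loc_module_baer_injective[OF FM F_div F_baer]]]
    by blast+
  have invj [simp]: "inv_into UNIV j (j x) = x" for x using j by simp
  let ?\<epsilon> = "\<lambda>X. j (\<eta> X)" and ?\<delta> = "\<lambda>i x. j (\<kappa> (Suc i) (\<delta> i (inv_into UNIV j x)))"
  have "injective_resolution L (regular_module L) T ?\<epsilon> ?\<delta>"
    unfolding injective_resolution_def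
  proof (intro conjI allI)
    show "injective_module L (T i)" for i by (rule T)
    show "?\<epsilon> \<in> mod_hom L (regular_module L) (T 0)"
      by (rule mod_homI) (use mod_homD[OF \<eta>_hom] in \<open>simp_all add: T_simps\<close>)
    show "?\<delta> i \<in> mod_hom L (T i) (T (Suc i))" for i
      by (rule mod_homI) (use mod_homD[OF loc_module_hom[OF FM F_div FM F_div d_hom, of i]] in \<open>auto simp: T_simps\<close>)
    show "inj_on ?\<epsilon> (carrier (regular_module L))"
      using inj_on_subset[OF j] \<eta>_inj by (simp add: inj_on_def) (use injD[OF j] in blast)
    have "?\<epsilon> ` carrier L = j ` \<eta> ` carrier L" by blast
    also have "\<dots> = {e \<in> carrier (T 0). ?\<delta> 0 e = \<zero>\<^bsub>T 1\<^esub>}"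
      unfolding \<eta>_image by (auto simp: T_simps inj_eq[OF j])
    finally show "?\<epsilon> ` carrier (regular_module L) = {e \<in> carrier (T 0). ?\<delta> 0 e = \<zero>\<^bsub>T 1\<^esub>}" by simp
    fix i
    have "?\<delta> i ` carrier (T i) = j ` (\<lambda>x. \<kappa> (Suc i) (\<delta> i x)) ` carrier (F i)"
      by (simp add: T_simps image_image)
    also have "\<dots> = {e \<in> carrier (T (Suc i)). ?\<delta> (Suc i) e = \<zero>\<^bsub>T (Suc (Suc i))\<^esub>}"
      unfolding d_image by (auto simp: T_simps inj_eq[OF j])
    finally show "?\<delta> i ` carrier (T i) = {e \<in> carrier (T (Suc i)). ?\<delta> (Suc i) e = \<zero>\<^bsub>T (Suc (Suc i))\<^esub>}" .
  qed
  moreover have "carrier (T i) = {\<zero>\<^bsub>T i\<^esub>}" if "i > d" for i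
    using triv[OF that] \<kappa>0 by (simp add: T_simps)
  ultimately show ?thesis
    unfolding finite_injective_dimension_def using module_regular_module[OF L_cring] by blast
qed

section \<open>Hilbert's basis theorem\<close>

text \<open>
  The ring of polynomials in the variables of \<open>V\<close> consists of all polynomials of the type that
  avoid other variables. Therefore rings are subsets of a type here, and ideals are relative to them.
\<close>

definition subring_of :: "'a::comm_ring_1 set \<Rightarrow> bool"
  where "subring_of R \<longleftrightarrow> 1 \<in> R \<and> (\<forall>a\<in>R. \<forall>b\<in>R. a - b \<in> R \<and> a * b \<in> R)"

definition ideal_of :: "'a::comm_ring_1 set \<Rightarrow> 'a set \<Rightarrow> bool"
  where "ideal_of R J \<longleftrightarrow> J \<subseteq> R \<and> 0 \<in> J \<and> (\<forall>a\<in>J. \<forall>b\<in>J. a + b \<in> J) \<and> (\<forall>r\<in>R. \<forall>a\<in>J. r * a \<in> J)"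

definition noetherian_subring :: "'a::comm_ring_1 set \<Rightarrow> bool"
  where "noetherian_subring R \<longleftrightarrow> subring_of R \<and>
    (\<forall>J :: nat \<Rightarrow> 'a set. (\<forall>i. ideal_of R (J i)) \<and> (\<forall>i. J i \<subseteq> J (Suc i)) \<longrightarrow> (\<exists>N. \<forall>i\<ge>N. J i = J N))"

lemma subring_ofD:
  assumes "subring_of R"
  shows "1 \<in> R" "0 \<in> R" "a \<in> R \<Longrightarrow> b \<in> R \<Longrightarrow> a - b \<in> R" "a \<in> R \<Longrightarrow> b \<in> R \<Longrightarrow> a * b \<in> R"
    "a \<in> R \<Longrightarrow> - a \<in> R" "a \<in> R \<Longrightarrow> b \<in> R \<Longrightarrow> a + b \<in> R"
proof -
  show 1: "1 \<in> R" and d: "a \<in> R \<Longrightarrow> b \<in> R \<Longrightarrow> a - b \<in> R" and "a \<in> R \<Longrightarrow> b \<in> R \<Longrightarrow> a * b \<in> R" for a b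
    using assms by (auto simp: subring_of_def)
  show 0: "0 \<in> R" using d[OF 1 1] by simp
  show m: "a \<in> R \<Longrightarrow> - a \<in> R" for a using d[OF 0] by fastforce
  show "a \<in> R \<Longrightarrow> b \<in> R \<Longrightarrow> a + b \<in> R" using d[OF _ m, of a b] by simp
qed

lemma ideal_ofD:
  assumes "ideal_of R J"
  shows "a \<in> J \<Longrightarrow> a \<in> R" "0 \<in> J" "a \<in> J \<Longrightarrow> b \<in> J \<Longrightarrow> a + b \<in> J" "r \<in> R \<Longrightarrow> a \<in> J \<Longrightarrow> r * a \<in> J"
  using assms by (auto simp: ideal_of_def)

lemma ideal_of_diff:
  assumes "subring_of R" "ideal_of R J" "a \<in> J" "b \<in> J"
  shows "a - b \<in> J"
  using ideal_ofD(3)[OF assms(2,3) ideal_ofD(4)[OF assms(2) subring_ofD(5)[OF assms(1) subring_ofD(1)[OF assms(1)]] assms(4)]]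
  by simp

definition polys_over :: "'a::comm_ring_1 set \<Rightarrow> 'a poly set"
  where "polys_over R = {p. \<forall>i. coeff p i \<in> R}"

definition adjoin :: "'a::comm_ring_1 set \<Rightarrow> 'a \<Rightarrow> 'a set"
  where "adjoin R v = (\<lambda>p. poly p v) ` polys_over R"

lemma sum_in_subring: "subring_of R \<Longrightarrow> (\<And>i. i \<in> A \<Longrightarrow> f i \<in> R) \<Longrightarrow> sum f A \<in> R"
  by (induction A rule: infinite_finite_induct) (auto simp: subring_ofD)

lemma power_in_subring: "subring_of R \<Longrightarrow> a \<in> R \<Longrightarrow> a ^ n \<in> R"
  by (induction n) (auto simp: subring_ofD)

lemma polys_over_closed:
  assumes R: "subring_of R"
  shows "0 \<in> polys_over R" "p \<in> polys_over R \<Longrightarrow> q \<in> polys_over R \<Longrightarrow> p + q \<in> polys_over R"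
    "p \<in> polys_over R \<Longrightarrow> q \<in> polys_over R \<Longrightarrow> p - q \<in> polys_over R"
    "p \<in> polys_over R \<Longrightarrow> q \<in> polys_over R \<Longrightarrow> p * q \<in> polys_over R"
    "r \<in> R \<Longrightarrow> p \<in> polys_over R \<Longrightarrow> pCons r p \<in> polys_over R"
    "r \<in> R \<Longrightarrow> p \<in> polys_over R \<Longrightarrow> Polynomial.smult r p \<in> polys_over R"
  using subring_ofD[OF R]
  by (auto simp: polys_over_def coeff_mult coeff_pCons split: nat.split intro!: sum_in_subring[OF R])

lemma subring_adjoin:
  assumes R: "subring_of R"
  shows "subring_of (adjoin R v)"
  unfolding subring_of_def
proof (intro conjI ballI)
  show "1 \<in> adjoin R v"
    unfolding adjoin_def
    by (rule image_eqI[of _ _ "[:1:]"]) (use polys_over_closed[OF R] subring_ofD(1)[OF R] in auto)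
  fix a b assume "a \<in> adjoin R v" "b \<in> adjoin R v"
  then obtain p q where "a = poly p v" "b = poly q v" "p \<in> polys_over R" "q \<in> polys_over R"
    unfolding adjoin_def by blast
  then have "a - b = poly (p - q) v" "a * b = poly (p * q) v" "p - q \<in> polys_over R" "p * q \<in> polys_over R"
    using polys_over_closed[OF R] by auto
  then show "a - b \<in> adjoin R v" "a * b \<in> adjoin R v"
    unfolding adjoin_def by blast+
qed

lemma adjoin_base:
  assumes R: "subring_of R"
  shows "R \<subseteq> adjoin R v" "v \<in> adjoin R v"
proof -
  show "R \<subseteq> adjoin R v"
  proof
    fix r assume "r \<in> R"
    then have "[:r:] \<in> polys_over R" using polys_over_closed[OF R] by auto
    then show "r \<in> adjoin R v" unfolding adjoin_def by (rule rev_image_eqI) simp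
  qed
  have "[:0, 1:] \<in> polys_over R" using polys_over_closed[OF R] subring_ofD[OF R] by auto
  then show "v \<in> adjoin R v" unfolding adjoin_def by (rule rev_image_eqI) simp
qed

lemma adjoin_least:
  assumes R: "subring_of R" "R \<subseteq> T" "v \<in> T" "subring_of T"
  shows "adjoin R v \<subseteq> T"
proof
  fix x assume "x \<in> adjoin R v"
  then obtain p where p: "p \<in> polys_over R" "x = poly p v" unfolding adjoin_def by blast
  have "(\<Sum>i\<le>degree p. coeff p i * v ^ i) \<in> T"
    by (rule sum_in_subring[OF R(4)])
      (use p(1) R in \<open>auto simp: polys_over_def intro!: subring_ofD(4)[OF R(4)] power_in_subring[OF R(4)]\<close>)
  then show "x \<in> T" using p(2) by (simp add: poly_altdef)
qed

text \<open>
  Since \<open>v\<close> may be algebraic over \<open>R\<close>, an element of \<open>J\<close> can have several expressions of degree at most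
  \<open>d\<close> in \<open>v\<close>; the coefficients at \<open>v ^ d\<close> of all of them are collected.
\<close>

definition lead_ideal :: "'a::comm_ring_1 set \<Rightarrow> 'a \<Rightarrow> nat \<Rightarrow> 'a set \<Rightarrow> 'a set"
  where "lead_ideal R v d J = {coeff p d | p. p \<in> polys_over R \<and> degree p \<le> d \<and> poly p v \<in> J}"

lemma lead_ideal_ideal:
  assumes R: "subring_of R" and J: "ideal_of (adjoin R v) J"
  shows "ideal_of R (lead_ideal R v d J)"
  unfolding ideal_of_def
proof (intro conjI ballI)
  show "lead_ideal R v d J \<subseteq> R" by (auto simp: lead_ideal_def polys_over_def)
  show "0 \<in> lead_ideal R v d J"
    unfolding lead_ideal_def using polys_over_closed(1)[OF R] ideal_ofD(2)[OF J] by (auto intro!: exI[of _ 0])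
  fix a assume "a \<in> lead_ideal R v d J"
  then obtain p where p: "a = coeff p d" "p \<in> polys_over R" "degree p \<le> d" "poly p v \<in> J"
    unfolding lead_ideal_def by blast
  {
    fix b assume "b \<in> lead_ideal R v d J"
    then obtain q where q: "b = coeff q d" "q \<in> polys_over R" "degree q \<le> d" "poly q v \<in> J"
      unfolding lead_ideal_def by blast
    have "a + b = coeff (p + q) d" "p + q \<in> polys_over R" "degree (p + q) \<le> d" "poly (p + q) v \<in> J"
      using p q polys_over_closed[OF R] ideal_ofD(3)[OF J] degree_add_le by auto
    then show "a + b \<in> lead_ideal R v d J" unfolding lead_ideal_def by blast
  }
  fix r assume r: "r \<in> R"
  then have "r * a = coeff (Polynomial.smult r p) d" "Polynomial.smult r p \<in> polys_over R"
    "degree (Polynomial.smult r p) \<le> d" "poly (Polynomial.smult r p) v \<in> J"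
    using p polys_over_closed[OF R] ideal_ofD(4)[OF J, of r "poly p v"] adjoin_base(1)[OF R, of v]
      degree_smult_le[of r p] by auto
  then show "r * a \<in> lead_ideal R v d J" unfolding lead_ideal_def by blast
qed

lemma lead_ideal_mono_degree:
  assumes R: "subring_of R" and J: "ideal_of (adjoin R v) J"
  shows "lead_ideal R v d J \<subseteq> lead_ideal R v (Suc d) J"
proof
  fix a assume "a \<in> lead_ideal R v d J"
  then obtain p where p: "a = coeff p d" "p \<in> polys_over R" "degree p \<le> d" "poly p v \<in> J"
    unfolding lead_ideal_def by blast
  have "a = coeff (pCons 0 p) (Suc d)" "pCons 0 p \<in> polys_over R" "degree (pCons 0 p) \<le> Suc d" "poly (pCons 0 p) v \<in> J"
    using p polys_over_closed(5)[OF R subring_ofD(2)[OF R]] ideal_ofD(4)[OF J adjoin_base(2)[OF R]] by auto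
  then show "a \<in> lead_ideal R v (Suc d) J" unfolding lead_ideal_def by blast
qed

lemma lead_ideal_mono:
  "J \<subseteq> J' \<Longrightarrow> lead_ideal R v d J \<subseteq> lead_ideal R v d J'"
  by (auto simp: lead_ideal_def)

text \<open>
  An element of \<open>J'\<close> with an expression of degree \<open>d\<close> differs by an element of \<open>J\<close> from one with an
  expression of smaller degree.
\<close>

lemma ideal_eq_if_lead_ideals_eq:
  assumes R: "subring_of R" and J: "ideal_of (adjoin R v) J" and J': "ideal_of (adjoin R v) J'"
    and sub: "J \<subseteq> J'" and lead: "\<And>d. lead_ideal R v d J' = lead_ideal R v d J"
  shows "J' = J"
proof -
  have "poly p v \<in> J" if "p \<in> polys_over R" "poly p v \<in> J'" "\<And>i. i \<ge> d \<Longrightarrow> coeff p i = 0" for p d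
    using that
  proof (induction d arbitrary: p)
    case 0
    then have "p = 0" by (simp add: poly_eq_iff)
    then show ?case using ideal_ofD(2)[OF J] by simp
  next
    case (Suc d)
    have "degree p \<le> d" using Suc.prems(3) by (intro degree_le) auto
    then have "coeff p d \<in> lead_ideal R v d J'" unfolding lead_ideal_def using Suc.prems(1,2) by blast
    then have "coeff p d \<in> lead_ideal R v d J" by (simp only: lead)
    then obtain q where q: "coeff p d = coeff q d" "q \<in> polys_over R" "degree q \<le> d" "poly q v \<in> J"
      unfolding lead_ideal_def by blast
    have "poly (p - q) v \<in> J"
    proof (rule Suc.IH)
      show "p - q \<in> polys_over R" by (rule polys_over_closed(3)[OF R Suc.prems(1) q(2)])
      show "poly (p - q) v \<in> J'"
        using ideal_of_diff[OF subring_adjoin[OF R] J' Suc.prems(2)] q(4) sub by auto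
      show "coeff (p - q) i = 0" if "i \<ge> d" for i
      proof (cases "i = d")
        case False
        then have "coeff p i = 0" "coeff q i = 0"
          using that Suc.prems(3)[of i] coeff_eq_0[of q i] q(3) by auto
        then show ?thesis by simp
      qed (simp add: q(1))
    qed
    then have "poly (p - q) v + poly q v \<in> J" using q(4) by (rule ideal_ofD(3)[OF J])
    then show ?case by simp
  qed
  then have "poly p v \<in> J" if "p \<in> polys_over R" "poly p v \<in> J'" for p
    using that coeff_eq_0[of p] by (metis Suc_le_lessD)
  moreover have "J' \<subseteq> adjoin R v" using ideal_ofD(1)[OF J'] by blast
  ultimately show ?thesis using sub unfolding adjoin_def by blast
qed

text \<open>
  For an ascending sequence of ideals \<open>J k\<close> the ideals \<open>I d k\<close> of leading coefficients ascend in both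
  \<open>d\<close> and \<open>k\<close>. If the diagonal sequence is constant from \<open>m\<close> on, then \<open>I d k\<close> is constant for all
  \<open>d, k \<ge> m\<close>. For each of the finitely many \<open>d < m\<close> the sequence \<open>I d\<close> becomes constant as well, so from
  some \<open>k\<close> on all leading coefficients agree and hence so do the ideals.
\<close>

lemma noetherian_adjoin:
  assumes "noetherian_subring R"
  shows "noetherian_subring (adjoin R v)"
  unfolding noetherian_subring_def
proof (rule conjI)
  have R: "subring_of R" using assms by (simp add: noetherian_subring_def)
  have acc: "\<exists>N. \<forall>i\<ge>N. J i = J N" if "\<And>i. ideal_of R (J i)" "\<And>i. J i \<subseteq> J (Suc i)" for J :: "nat \<Rightarrow> 'a set"
    using assms that by (simp add: noetherian_subring_def)
  show "subring_of (adjoin R v)" by (rule subring_adjoin[OF R])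
  have "\<exists>N. \<forall>i\<ge>N. J i = J N"
    if J': "\<forall>i. ideal_of (adjoin R v) (J i)" and inc: "\<forall>i. J i \<subseteq> J (Suc i)" for J :: "nat \<Rightarrow> 'a set"
  proof -
  have J: "ideal_of (adjoin R v) (J i)" for i using J' by blast
  have J_mono: "J i \<subseteq> J k" if "i \<le> k" for i k
    by (rule lift_Suc_mono_le[of J, OF _ that]) (use inc in blast)
  define I where "I d k = lead_ideal R v d (J k)" for d k
  have I_ideal: "ideal_of R (I d k)" for d k unfolding I_def by (rule lead_ideal_ideal[OF R J])
  have I_mono: "I d k \<subseteq> I d' k'" if "d \<le> d'" "k \<le> k'" for d d' k k'
  proof -
    have "I d k \<subseteq> I d' k"
      unfolding I_def
      by (rule lift_Suc_mono_le[of "\<lambda>d. lead_ideal R v d (J k)", OF _ that(1)]) (rule lead_ideal_mono_degree[OF R J])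
    also have "\<dots> \<subseteq> I d' k'" unfolding I_def by (rule lead_ideal_mono[OF J_mono[OF that(2)]])
    finally show ?thesis .
  qed
  obtain m where m: "\<And>i. i \<ge> m \<Longrightarrow> I i i = I m m"
    using acc[of "\<lambda>i. I i i"] I_ideal I_mono by (metis le_SucI order_refl)
  have "\<exists>N. \<forall>k\<ge>N. I d k = I d N" for d
    using acc[of "I d"] I_ideal I_mono by (metis le_SucI order_refl)
  then obtain N where N: "\<And>d k. k \<ge> N d \<Longrightarrow> I d k = I d (N d)" by metis
  define M where "M = Max (insert m (N ` {..<m}))"
  have M: "m \<le> M" "\<And>d. d < m \<Longrightarrow> N d \<le> M" by (auto simp: M_def intro!: Max_ge)
  have "J k = J M" if k: "k \<ge> M" for k
  proof (rule ideal_eq_if_lead_ideals_eq[OF R J J J_mono[OF k]])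
    show "lead_ideal R v d (J k) = lead_ideal R v d (J M)" for d
    proof (cases "d < m")
      case True
      then show ?thesis using N[of d k] N[of d M] M(2)[of d] k unfolding I_def by simp
    next
      case False
      have "I d k \<subseteq> I (max d k) (max d k)" by (rule I_mono) auto
      also have "\<dots> = I m m" using m[of "max d k"] False by simp
      also have "\<dots> \<subseteq> I d M" by (rule I_mono) (use False M in auto)
      finally show ?thesis using I_mono[of d d M k] k unfolding I_def by blast
    qed
  qed
  then show "\<exists>N. \<forall>i\<ge>N. J i = J N" by blast
  qed
  then show "\<forall>J. (\<forall>i. ideal_of (adjoin R v) (J i)) \<and> (\<forall>i. J i \<subseteq> J (Suc i)) \<longrightarrow> (\<exists>N. \<forall>i\<ge>N. J i = J N)"
    by blast
qed

text \<open>
  A chain of ideals that does not contain its union contains a strictly increasing sequence of ideals,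
  whose preimages strictly increase as well.
\<close>

lemma noetherian_ring_if_surjective_image:
  fixes A (structure)
  assumes A: "ring A" and R: "noetherian_subring R"
    and \<rho>: "\<rho> ` R = carrier A"
    and add: "\<And>a b. a \<in> R \<Longrightarrow> b \<in> R \<Longrightarrow> \<rho> (a + b) = \<rho> a \<oplus>\<^bsub>A\<^esub> \<rho> b"
    and mult: "\<And>a b. a \<in> R \<Longrightarrow> b \<in> R \<Longrightarrow> \<rho> (a * b) = \<rho> a \<otimes>\<^bsub>A\<^esub> \<rho> b"
  shows "noetherian_ring A"
proof -
  interpret ring A by fact
  have sR: "subring_of R" using R by (simp add: noetherian_subring_def)
  have c: "\<rho> a \<in> carrier A" if "a \<in> R" for a using \<rho> that by blast
  have \<rho>0: "\<rho> 0 = \<zero>\<^bsub>A\<^esub>" using add[of 0 0] subring_ofD(2)[OF sR] c[of 0] by simp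
  show ?thesis
  proof (rule trivial_ideal_chain_imp_noetherian, rule ccontr)
    fix C assume C: "C \<noteq> {}" "subset.chain {I. ideal I A} C" and not: "\<Union>C \<notin> C"
    have id: "ideal I A" if "I \<in> C" for I using C(2) that by (auto simp: subset_chain_def)
    have step: "\<exists>I'. I' \<in> C \<and> I \<subset> I'" if I: "I \<in> C" for I
    proof -
      have "\<Union>C \<noteq> I" using not I by blast
      then obtain x I' where I': "I' \<in> C" "x \<in> I'" "x \<notin> I" using I by blast
      have "I \<subseteq> I' \<or> I' \<subseteq> I" using C(2) I I'(1) unfolding subset_chain_def by meson
      then show ?thesis using I' by blast
    qed
    have "\<exists>f. \<forall>n. f n \<in> C \<and> f n \<subset> f (Suc n)"
      by (rule dependent_nat_choice) (use C(1) step in auto)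
    then obtain f where f: "\<And>n. f n \<in> C" "\<And>n. f n \<subset> f (Suc n)" by blast
    define J where "J n = {a \<in> R. \<rho> a \<in> f n}" for n :: nat
    have "ideal_of R (J n)" for n
    proof -
      interpret I: ideal "f n" A by (rule id[OF f(1)])
      show ?thesis
        unfolding ideal_of_def J_def using subring_ofD[OF sR] add mult \<rho>0 c I.I_l_closed by auto
    qed
    moreover have "J n \<subseteq> J (Suc n)" for n using f(2)[of n] by (auto simp: J_def)
    ultimately obtain N where N: "\<forall>i\<ge>N. J i = J N" using R unfolding noetherian_subring_def by meson
    obtain y where y: "y \<in> f (Suc N)" "y \<notin> f N" using f(2)[of N] by blast
    interpret I: ideal "f (Suc N)" A by (rule id[OF f(1)])
    obtain a where "a \<in> R" "y = \<rho> a" using y(1) I.a_subset \<rho> by blast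
    then have "a \<in> J (Suc N)" "a \<notin> J N" using y by (auto simp: J_def)
    then show False using N by (metis le_SucI order_refl)
  qed
qed

lemma noetherian_field_image:
  fixes c :: "'k::field \<Rightarrow> 'a::comm_ring_1"
  assumes "c 1 = 1" "\<And>a b. c (a - b) = c a - c b" "\<And>a b. c (a * b) = c a * c b"
  shows "noetherian_subring (range c)"
  unfolding noetherian_subring_def
proof (rule conjI)
  show "subring_of (range c)"
    unfolding subring_of_def using assms by (metis (no_types, lifting) imageE rangeI)
  have "\<exists>N. \<forall>i\<ge>N. J i = J N"
    if J: "\<forall>i. ideal_of (range c) (J i)" and inc: "\<forall>i. J i \<subseteq> J (Suc i)" for J :: "nat \<Rightarrow> 'a set"
  proof -
  have J_mono: "J i \<subseteq> J k" if "i \<le> k" for i k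
    by (rule lift_Suc_mono_le[of J, OF _ that]) (use inc in blast)
  have c0: "c 0 = 0" using assms(2)[of 0 0] by simp
  have full: "J i = range c" if x: "x \<in> J i" "x \<noteq> 0" for i x
  proof -
    have Ji: "ideal_of (range c) (J i)" using J by blast
    obtain a where a: "x = c a" using ideal_ofD(1)[OF Ji x(1)] by blast
    then have "a \<noteq> 0" using x(2) c0 by auto
    have "c b \<in> J i" for b
    proof -
      have "c (b / a) * x \<in> J i" using ideal_ofD(4)[OF Ji _ x(1)] by blast
      moreover have "c (b / a) * x = c b" using a \<open>a \<noteq> 0\<close> by (simp flip: assms(3))
      ultimately show ?thesis by simp
    qed
    then show ?thesis using ideal_ofD(1)[OF Ji] by blast
  qed
  show "\<exists>N. \<forall>i\<ge>N. J i = J N"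
  proof (cases "\<exists>N x. x \<in> J N \<and> x \<noteq> 0")
    case True
    then obtain N x where "x \<in> J N" "x \<noteq> 0" by blast
    then have "J i = range c" if "i \<ge> N" for i using full[of x i] J_mono[OF that] by blast
    then show ?thesis by (metis order_refl)
  next
    case False
    then have "J i = {0}" for i using J unfolding ideal_of_def by blast
    then show ?thesis by simp
  qed
  qed
  then show "\<forall>J. (\<forall>i. ideal_of (range c) (J i)) \<and> (\<forall>i. J i \<subseteq> J (Suc i)) \<longrightarrow> (\<exists>N. \<forall>i\<ge>N. J i = J N)"
    by blast
qed

lemma poly_mapping_sum_single: "(p :: 'a \<Rightarrow>\<^sub>0 'b::comm_monoid_add) = (\<Sum>m\<in>Poly_Mapping.keys p. Poly_Mapping.single m (Poly_Mapping.lookup p m))"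
  by (rule poly_mapping_eqI) (auto simp: lookup_sum lookup_single when_def in_keys_iff)

lemma poly_mapping_single_induct [case_names zero single add]:
  fixes p :: "'a \<Rightarrow>\<^sub>0 'b::comm_monoid_add"
  assumes "P 0" "\<And>m c. m \<in> Poly_Mapping.keys p \<Longrightarrow> P (Poly_Mapping.single m c)" "\<And>p q. P p \<Longrightarrow> P q \<Longrightarrow> P (p + q)"
  shows "P p"
proof -
  have "P (\<Sum>m\<in>A. Poly_Mapping.single m (Poly_Mapping.lookup p m))" if "A \<subseteq> Poly_Mapping.keys p" for A
    using finite_subset[OF that finite_keys] that
    by (induction A rule: finite_induct) (use assms in auto)
  then show ?thesis using poly_mapping_sum_single[of p] by (metis order_refl)
qed

definition polys_in :: "'v set \<Rightarrow> (('v \<Rightarrow>\<^sub>0 nat) \<Rightarrow>\<^sub>0 'k::field) set"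
  where "polys_in V = {p. \<forall>m\<in>Poly_Mapping.keys p. Poly_Mapping.keys m \<subseteq> V}"

lemma keys_add_nat: "Poly_Mapping.keys (m + m') = Poly_Mapping.keys m \<union> Poly_Mapping.keys (m' :: 'v \<Rightarrow>\<^sub>0 nat)"
  by (auto simp: in_keys_iff lookup_add)

lemma subring_polys_in: "subring_of (polys_in V :: (('v \<Rightarrow>\<^sub>0 nat) \<Rightarrow>\<^sub>0 'k::field) set)"
  unfolding subring_of_def
proof (intro conjI ballI)
  show "1 \<in> (polys_in V :: (('v \<Rightarrow>\<^sub>0 nat) \<Rightarrow>\<^sub>0 'k::field) set)" by (auto simp: polys_in_def)
  fix p q :: "('v \<Rightarrow>\<^sub>0 nat) \<Rightarrow>\<^sub>0 'k" assume pq: "p \<in> polys_in V" "q \<in> polys_in V"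
  have "Poly_Mapping.keys (p - q) \<subseteq> Poly_Mapping.keys p \<union> Poly_Mapping.keys q"
    by (auto simp: in_keys_iff lookup_minus)
  then show "p - q \<in> polys_in V" using pq unfolding polys_in_def by blast
  show "p * q \<in> polys_in V"
  proof -
    have "Poly_Mapping.keys m \<subseteq> V" if m: "m \<in> Poly_Mapping.keys (p * q)" for m
    proof -
      obtain a b where "m = a + b" "a \<in> Poly_Mapping.keys p" "b \<in> Poly_Mapping.keys q"
        using keys_mult[of p q] m by blast
      then show ?thesis using pq unfolding polys_in_def by (auto simp: keys_add_nat)
    qed
    then show ?thesis unfolding polys_in_def by blast
  qed
qed

lemma single_eq_pvar_power:
  fixes c :: "'k::field"
  shows "Poly_Mapping.single (Poly_Mapping.single v k) c = Poly_Mapping.single 0 c * pvar v ^ k"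
proof (induction k)
  case (Suc k)
  have "Poly_Mapping.single 0 c * pvar v ^ Suc k = pvar v * (Poly_Mapping.single 0 c * pvar v ^ k)"
    by (simp add: mult.left_commute)
  also have "\<dots> = Poly_Mapping.single (Poly_Mapping.single v 1 + Poly_Mapping.single v k) c"
    unfolding Suc[symmetric] by (simp add: pvar_def mult_single)
  also have "Poly_Mapping.single v 1 + Poly_Mapping.single v k = Poly_Mapping.single v (Suc k)"
    by (simp flip: single_add)
  finally show ?case by simp
qed simp

lemma polys_in_insert: "polys_in (insert v V) = adjoin (polys_in V) (pvar v :: ('v \<Rightarrow>\<^sub>0 nat) \<Rightarrow>\<^sub>0 'k::field)"
proof (rule antisym)
  note R = subring_polys_in[of V, where 'k = 'k]
  note T = subring_adjoin[OF R, of "pvar v"]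
  show "polys_in (insert v V) \<subseteq> adjoin (polys_in V) (pvar v :: ('v \<Rightarrow>\<^sub>0 nat) \<Rightarrow>\<^sub>0 'k)"
  proof
    fix p :: "('v \<Rightarrow>\<^sub>0 nat) \<Rightarrow>\<^sub>0 'k" assume p: "p \<in> polys_in (insert v V)"
    show "p \<in> adjoin (polys_in V) (pvar v)"
    proof (induction p rule: poly_mapping_single_induct)
      case (single m c)
      define k where "k = Poly_Mapping.lookup m v"
      define m' where "m' = m - Poly_Mapping.single v k"
      have mm: "m = m' + Poly_Mapping.single v k"
        by (rule poly_mapping_eqI) (simp add: m'_def k_def lookup_add lookup_minus lookup_single when_def)
      have "Poly_Mapping.keys m' \<subseteq> V"
      proof
        fix w assume w: "w \<in> Poly_Mapping.keys m'"
        then have "w \<noteq> v" by (auto simp: m'_def k_def in_keys_iff lookup_minus lookup_single)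
        moreover have "w \<in> Poly_Mapping.keys m" using w by (auto simp: mm in_keys_iff lookup_add)
        ultimately show "w \<in> V" using p single unfolding polys_in_def by blast
      qed
      then have "Poly_Mapping.single m' c \<in> polys_in V" by (simp add: polys_in_def)
      then have 1: "Poly_Mapping.single m' c \<in> adjoin (polys_in V) (pvar v)" using adjoin_base(1)[OF R] by blast
      have "Poly_Mapping.single m c = Poly_Mapping.single m' c * pvar v ^ k"
      proof -
        have "pvar v ^ k = Poly_Mapping.single (Poly_Mapping.single v k) (1::'k)"
          using single_eq_pvar_power[of v k "1::'k"] by simp
        then show ?thesis by (simp add: mm mult_single)
      qed
      then show ?case
        using subring_ofD(4)[OF T 1 power_in_subring[OF T adjoin_base(2)[OF R]]] by simp
    qed (use subring_ofD[OF T] in auto)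
  qed
  show "adjoin (polys_in V) (pvar v :: ('v \<Rightarrow>\<^sub>0 nat) \<Rightarrow>\<^sub>0 'k) \<subseteq> polys_in (insert v V)"
    by (rule adjoin_least[OF R _ _ subring_polys_in]) (auto simp: polys_in_def pvar_def)
qed

lemma noetherian_polys_in:
  assumes "finite V"
  shows "noetherian_subring (polys_in V :: (('v \<Rightarrow>\<^sub>0 nat) \<Rightarrow>\<^sub>0 'k::field) set)"
  using assms
proof (induction V)
  case empty
  have "polys_in {} = range (Poly_Mapping.single (0 :: 'v \<Rightarrow>\<^sub>0 nat) :: 'k \<Rightarrow> _)"
  proof (intro equalityI subsetI)
    fix p :: "('v \<Rightarrow>\<^sub>0 nat) \<Rightarrow>\<^sub>0 'k" assume "p \<in> polys_in {}"
    then have "Poly_Mapping.keys p \<subseteq> {0}" by (auto simp: polys_in_def)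
    then have "p = Poly_Mapping.single 0 (Poly_Mapping.lookup p 0)"
      by (intro poly_mapping_eqI) (auto simp: lookup_single when_def in_keys_iff)
    then show "p \<in> range (Poly_Mapping.single 0)" by blast
  qed (auto simp: polys_in_def split: if_splits)
  then show ?case
    using noetherian_field_image[of "Poly_Mapping.single (0 :: 'v \<Rightarrow>\<^sub>0 nat) :: 'k \<Rightarrow> _"]
    by (simp add: single_diff mult_single)
next
  case (insert v V)
  then show ?case using noetherian_adjoin by (simp add: polys_in_insert)
qed

section \<open>The Koszul complex of a polynomial ring in two variables\<close>

lemma shift_sum_bound:
  fixes k :: "'a::comm_ring_1 poly \<Rightarrow> 'w::ab_group_add" and b :: "'w \<Rightarrow> 'w"
  assumes k0: "k 0 = 0" and b0: "b 0 = 0" and n: "degree p \<le> n"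
  shows "(\<Sum>i<n. (b ^^ i) (k (poly_shift (Suc i) p))) = (\<Sum>i<degree p. (b ^^ i) (k (poly_shift (Suc i) p)))"
proof (rule sum.mono_neutral_right)
  have bi: "(b ^^ i) 0 = 0" for i by (induction i) (simp_all add: b0)
  have "poly_shift (Suc i) p = 0" if "degree p \<le> i" for i
    using that by (simp add: poly_eq_iff coeff_poly_shift coeff_eq_0)
  then show "\<forall>i\<in>{..<n} - {..<degree p}. (b ^^ i) (k (poly_shift (Suc i) p)) = 0"
    by (simp add: k0 bi)
qed (use n in auto)

text \<open>
  The solution \<open>f\<close> of the equation \<open>f (X p) = k p + b (f p)\<close> with value zero at constants, where \<open>X\<close>
  is the variable: iterate \<open>f (a + X p) = k p + b (f p)\<close>.
\<close>

definition shift_solution :: "('a::comm_ring_1 poly \<Rightarrow> 'w::ab_group_add) \<Rightarrow> ('w \<Rightarrow> 'w) \<Rightarrow> 'a poly \<Rightarrow> 'w"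
  where "shift_solution k b p = (\<Sum>i<degree p. (b ^^ i) (k (poly_shift (Suc i) p)))"

text \<open>
  The last property is about linearity: \<open>\<phi>\<close> and \<open>s\<close> are going to be multiplications by the same scalar.
\<close>

lemma shift_solution:
  fixes k :: "'a::comm_ring_1 poly \<Rightarrow> 'w::ab_group_add" and b :: "'w \<Rightarrow> 'w"
  assumes k: "\<And>p q. k (p + q) = k p + k q" and b: "\<And>x y. b (x + y) = b x + b y"
  shows "shift_solution k b (p + q) = shift_solution k b p + shift_solution k b q"
    and "shift_solution k b (pCons a p) = k p + b (shift_solution k b p)"
    and "\<lbrakk>\<And>p. k (\<phi> p) = s (k p); \<And>x. b (s x) = s (b x); \<And>x y. s (x + y) = s x + s y;
      \<And>i p. poly_shift i (\<phi> p) = \<phi> (poly_shift i p)\<rbrakk>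
      \<Longrightarrow> shift_solution k b (\<phi> p) = s (shift_solution k b p)"
proof -
  have k0: "k 0 = 0" using k[of 0 0] by simp
  have b0: "b 0 = 0" using b[of 0 0] by simp
  note bound = shift_sum_bound[of k b, OF k0 b0, folded shift_solution_def]
  have bsum: "b (sum f A) = (\<Sum>i\<in>A. b (f i))" for f :: "nat \<Rightarrow> 'w" and A
    by (induction A rule: infinite_finite_induct) (simp_all add: b b0)
  have bi: "(b ^^ i) (x + y) = (b ^^ i) x + (b ^^ i) y" for i x y by (induction i) (simp_all add: b)
  have sh: "poly_shift i (p + q) = poly_shift i p + poly_shift i q" for i and p q :: "'a poly"
    by (simp add: poly_eq_iff coeff_poly_shift)
  show "shift_solution k b (p + q) = shift_solution k b p + shift_solution k b q"
  proof -
    let ?n = "max (degree p) (degree q)"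
    have "degree (p + q) \<le> ?n" by (rule degree_add_le_max)
    then show ?thesis
      using bound[of "p + q" ?n] bound[of p ?n] bound[of q ?n] by (simp add: sh k bi sum.distrib)
  qed
  show "shift_solution k b (pCons a p) = k p + b (shift_solution k b p)"
  proof -
    have "degree (pCons a p) \<le> Suc (degree p)" by (rule degree_pCons_le)
    then have "shift_solution k b (pCons a p) = (\<Sum>i<Suc (degree p). (b ^^ i) (k (poly_shift (Suc i) (pCons a p))))"
      by (rule bound[symmetric])
    also have "\<dots> = (\<Sum>i<Suc (degree p). (b ^^ i) (k (poly_shift i p)))"
    proof -
      have "poly_shift (Suc i) (pCons a p) = poly_shift i p" for i
        by (simp add: poly_eq_iff coeff_poly_shift)
      then show ?thesis by simp
    qed
    also have "\<dots> = k p + b (shift_solution k b p)"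
      unfolding sum.lessThan_Suc_shift shift_solution_def bsum by simp
    finally show ?thesis .
  qed
  assume s: "\<And>p. k (\<phi> p) = s (k p)" "\<And>x. b (s x) = s (b x)" "\<And>x y. s (x + y) = s x + s y"
    "\<And>i p. poly_shift i (\<phi> p) = \<phi> (poly_shift i p)"
  have s0: "s 0 = 0" using s(3)[of 0 0] by simp
  have ssum: "s (sum f A) = (\<Sum>i\<in>A. s (f i))" for f :: "nat \<Rightarrow> 'w" and A
    by (induction A rule: infinite_finite_induct) (simp_all add: s s0)
  have bs: "(b ^^ i) (s x) = s ((b ^^ i) x)" for i x by (induction i) (simp_all add: s)
  let ?n = "max (degree (\<phi> p)) (degree p)"
  show "shift_solution k b (\<phi> p) = s (shift_solution k b p)"
    using bound[of "\<phi> p" ?n] bound[of p ?n] by (simp add: s bs ssum[symmetric])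
qed

text \<open>
  The ring \<open>T = K[u, c]\<close>. The outer variable \<open>TX\<close> is \<open>c\<close> and the inner variable \<open>TU\<close> is \<open>u\<close>.
\<close>

type_synonym 'k poly2 = "'k poly poly"

abbreviation TX :: "'k::field poly2" where "TX \<equiv> [:0, 1:]"
abbreviation TU :: "'k::field poly2" where "TU \<equiv> [:[:0, 1:]:]"
abbreviation TC :: "'k::field \<Rightarrow> 'k poly2" where "TC k \<equiv> [:[:k:]:]"

lemma poly2_induct [case_names const add TX TU]:
  fixes \<tau> :: "'k::field poly2"
  assumes C: "\<And>k. P (TC k)" and add: "\<And>\<sigma> \<tau>. P \<sigma> \<Longrightarrow> P \<tau> \<Longrightarrow> P (\<sigma> + \<tau>)"
    and X: "\<And>\<tau>. P \<tau> \<Longrightarrow> P (TX * \<tau>)" and U: "\<And>\<tau>. P \<tau> \<Longrightarrow> P (TU * \<tau>)"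
  shows "P \<tau>"
proof -
  have q: "P [:q:]" for q
  proof (induction q)
    case 0
    then show ?case using C[of 0] by simp
  next
    case (pCons a q)
    have "[:pCons a q:] = TC a + TU * [:q:]" by simp
    then show ?case using add[OF C U[OF pCons(2)], of a] by (simp only:)
  qed
  show ?thesis
  proof (induction \<tau>)
    case 0
    then show ?case using q[of 0] by simp
  next
    case (pCons a p)
    have "pCons a p = [:a:] + TX * p" by simp
    then show ?case using add[OF q X[OF pCons(2)], of a] by (simp only:)
  qed
qed

definition Tlin :: "('k::field poly2 \<Rightarrow> 'k poly2) \<Rightarrow> bool"
  where "Tlin f \<longleftrightarrow> (\<forall>\<sigma> \<tau>. f (\<sigma> + \<tau>) = f \<sigma> + f \<tau>) \<and> (\<forall>k \<tau>. f (TC k * \<tau>) = TC k * f \<tau>)"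

lemma Tlin_TX_solve:
  fixes k :: "'k::field poly2 \<Rightarrow> 'k poly2"
  assumes k: "Tlin k"
  shows "\<exists>f. Tlin f \<and> (\<forall>\<tau>. f (TX * \<tau>) - TX * f \<tau> = k \<tau>)"
proof -
  have ka: "k (\<sigma> + \<tau>) = k \<sigma> + k \<tau>" and kc: "k (TC c * \<tau>) = TC c * k \<tau>" for \<sigma> \<tau> c
    using k by (auto simp: Tlin_def)
  let ?b = "\<lambda>x. TX * x"
  have b: "?b (x + y) = ?b x + ?b y" for x y by (rule distrib_left)
  let ?f = "shift_solution k ?b"
  have "?f (TC c * \<tau>) = TC c * ?f \<tau>" for c \<tau>
  proof (rule shift_solution(3)[OF ka b])
    show "poly_shift i (TC c * p) = TC c * poly_shift i p" for i and p :: "'k poly2"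
      by (simp add: poly_eq_iff coeff_poly_shift)
  qed (rule kc mult.left_commute distrib_left)+
  then have "Tlin ?f" using shift_solution(1)[OF ka b] by (simp add: Tlin_def)
  moreover have "?f (TX * \<tau>) - TX * ?f \<tau> = k \<tau>" for \<tau>
    using shift_solution(2)[OF ka b, of 0 \<tau>] by simp
  ultimately show ?thesis by blast
qed

text \<open>
  A \<open>K[c]\<close>-linear map on \<open>T\<close> is determined by its restriction to \<open>K[u]\<close>. On \<open>K[u]\<close> the equation is solved by
  \<open>s\<close>, and \<open>h\<close> is the \<open>K[c]\<close>-linear extension of \<open>s\<close>.
\<close>

lemma Tlin_TU_solve:
  fixes g :: "'k::field poly2 \<Rightarrow> 'k poly2"
  assumes g: "Tlin g" and gX: "\<And>\<tau>. g (TX * \<tau>) = TX * g \<tau>"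
  shows "\<exists>h. Tlin h \<and> (\<forall>\<tau>. h (TX * \<tau>) = TX * h \<tau>) \<and> (\<forall>\<tau>. h (TU * \<tau>) - TU * h \<tau> = g \<tau>)"
proof -
  have ga: "g (\<sigma> + \<tau>) = g \<sigma> + g \<tau>" and gc: "g (TC c * \<tau>) = TC c * g \<tau>" for \<sigma> \<tau> c
    using g by (auto simp: Tlin_def)
  let ?b = "\<lambda>x. TU * x" and ?k = "\<lambda>q. g [:q:]"
  have b: "?b (x + y) = ?b x + ?b y" for x y by (rule distrib_left)
  have ka: "?k (p + q) = ?k p + ?k q" for p q using ga[of "[:p:]" "[:q:]"] by simp
  define s where "s = shift_solution ?k ?b"
  have s_add: "s (p + q) = s p + s q" for p q unfolding s_def by (rule shift_solution(1)[OF ka b])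
  have s_shift: "s (pCons 0 q) = g [:q:] + TU * s q" for q unfolding s_def by (rule shift_solution(2)[OF ka b])
  have s0: "s 0 = 0" using s_add[of 0 0] by (metis add_0 add_cancel_left_right)
  have s_c: "s ([:c:] * q) = TC c * s q" for c q
    unfolding s_def
  proof (rule shift_solution(3)[OF ka b])
    show "poly_shift i ([:c:] * p) = [:c:] * poly_shift i p" for i and p :: "'k poly"
      by (simp add: poly_eq_iff coeff_poly_shift)
    show "g [:[:c:] * p:] = TC c * g [:p:]" for p using gc[of c "[:p:]"] by simp
  qed (rule mult.left_commute distrib_left)+
  define h where "h \<tau> = poly (map_poly s \<tau>) TX" for \<tau>
  have h_pCons: "h (pCons q \<tau>) = s q + TX * h \<tau>" for q \<tau> by (simp add: h_def map_poly_pCons s0)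
  have h0: "h 0 = 0" by (simp add: h_def)
  have h_add: "h (\<sigma> + \<tau>) = h \<sigma> + h \<tau>" for \<sigma> \<tau>
  proof (induction \<sigma> arbitrary: \<tau>)
    case (pCons a p)
    obtain b q where t: "\<tau> = pCons b q" by (metis pCons_cases)
    show ?case unfolding t by (simp only: add_pCons h_pCons s_add pCons(2)[of q]) (simp only: algebra_simps)
  qed (simp add: h0)
  have h_c: "h (TC c * \<tau>) = TC c * h \<tau>" for c \<tau>
  proof (induction \<tau>)
    case (pCons a p)
    have "TC c * pCons a p = pCons ([:c:] * a) (TC c * p)" by simp
    then show ?case by (simp only: h_pCons s_c pCons(2)) (simp only: algebra_simps)
  qed (simp add: h0)
  have h_X: "h (TX * \<tau>) = TX * h \<tau>" for \<tau>
  proof -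
    have "TX * \<tau> = pCons 0 \<tau>" by simp
    then show ?thesis by (simp only: h_pCons s0 add_0)
  qed
  have "h (TU * \<tau>) - TU * h \<tau> = g \<tau>" for \<tau>
  proof (induction \<tau>)
    case 0
    have "g 0 = 0" using ga[of 0 0] by (metis add_0 add_cancel_left_right)
    then show ?case by (simp add: h0)
  next
    case (pCons q p)
    have "TU * pCons q p = pCons (pCons 0 q) (TU * p)" by simp
    then have "h (TU * pCons q p) - TU * h (pCons q p) = g [:q:] + TX * (h (TU * p) - TU * h p)"
      by (simp only: h_pCons s_shift) (simp only: algebra_simps)
    also have "\<dots> = g ([:q:] + TX * p)" by (simp only: pCons(2) ga gX)
    also have "[:q:] + TX * p = pCons q p" by simp
    finally show ?case .
  qed
  then show ?thesis using h_add h_c h_X unfolding Tlin_def by blast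
qed

text \<open>
  Solve the first equation by some \<open>h1\<close>. By the hypothesis, what is then missing in the second equation
  commutes with \<open>TX\<close>, so it can be supplied by a map that commutes with \<open>TX\<close>
  and leaves the first equation intact.
\<close>

lemma Tlin_Koszul:
  fixes f g :: "'k::field poly2 \<Rightarrow> 'k poly2"
  assumes f: "Tlin f" and g: "Tlin g"
    and fg: "\<And>\<tau>. f (TU * \<tau>) - TU * f \<tau> = g (TX * \<tau>) - TX * g \<tau>"
  shows "\<exists>h. Tlin h \<and> (\<forall>\<tau>. h (TX * \<tau>) - TX * h \<tau> = f \<tau>) \<and> (\<forall>\<tau>. h (TU * \<tau>) - TU * h \<tau> = g \<tau>)"
proof -
  obtain h1 where h1: "Tlin h1" and h1X: "\<And>\<tau>. h1 (TX * \<tau>) - TX * h1 \<tau> = f \<tau>"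
    using Tlin_TX_solve[OF f] by blast
  have h1a: "h1 (\<sigma> + \<tau>) = h1 \<sigma> + h1 \<tau>" and h1c: "h1 (TC c * \<tau>) = TC c * h1 \<tau>" for \<sigma> \<tau> c
    using h1 by (auto simp: Tlin_def)
  have ga: "g (\<sigma> + \<tau>) = g \<sigma> + g \<tau>" and gc: "g (TC c * \<tau>) = TC c * g \<tau>" for \<sigma> \<tau> c
    using g by (auto simp: Tlin_def)
  have X: "h1 (TX * \<tau>) = f \<tau> + TX * h1 \<tau>" for \<tau> using h1X[of \<tau>] by (simp add: algebra_simps)
  define g' where "g' \<tau> = g \<tau> - (h1 (TU * \<tau>) - TU * h1 \<tau>)" for \<tau>
  have "g' (\<sigma> + \<tau>) = g' \<sigma> + g' \<tau>" for \<sigma> \<tau>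
    unfolding g'_def ga distrib_left[of TU] h1a by (simp only: algebra_simps)
  moreover have "g' (TC c * \<tau>) = TC c * g' \<tau>" for c \<tau>
  proof -
    have "TU * (TC c * \<tau>) = TC c * (TU * \<tau>)" by (rule mult.left_commute)
    then show ?thesis unfolding g'_def by (simp only: gc h1c) (simp only: algebra_simps)
  qed
  ultimately have g': "Tlin g'" unfolding Tlin_def by blast
  have "g' (TX * \<tau>) = TX * g' \<tau>" for \<tau>
  proof -
    have e: "TU * (TX * \<tau>) = TX * (TU * \<tau>)" by (rule mult.left_commute)
    have gX: "g (TX * \<tau>) = f (TU * \<tau>) - TU * f \<tau> + TX * g \<tau>"
      using fg[of \<tau>] by (simp only: algebra_simps)
    show ?thesis unfolding g'_def e X gX by (simp only: algebra_simps)
  qed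
  then obtain h2 where h2: "Tlin h2" "\<And>\<tau>. h2 (TX * \<tau>) = TX * h2 \<tau>" "\<And>\<tau>. h2 (TU * \<tau>) - TU * h2 \<tau> = g' \<tau>"
    using Tlin_TU_solve[OF g'] by blast
  let ?h = "\<lambda>\<tau>. h1 \<tau> + h2 \<tau>"
  have h2a: "h2 (\<sigma> + \<tau>) = h2 \<sigma> + h2 \<tau>" and h2c: "h2 (TC c * \<tau>) = TC c * h2 \<tau>" for \<sigma> \<tau> c
    using h2(1) by (auto simp: Tlin_def)
  have "Tlin ?h" unfolding Tlin_def h1a h2a h1c h2c by (simp only: algebra_simps) simp
  moreover have "?h (TX * \<tau>) - TX * ?h \<tau> = f \<tau>" for \<tau>
    unfolding X h2(2) by (simp only: algebra_simps)
  moreover have "?h (TU * \<tau>) - TU * ?h \<tau> = g \<tau>" for \<tau>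
    using h2(3)[of \<tau>] unfolding g'_def by (simp only: algebra_simps)
  ultimately show ?thesis by blast
qed

section \<open>Products of modules and evaluation of polynomials\<close>

definition prod_module :: "('r, 'm, 'x) module_scheme \<Rightarrow> ('r, 'n, 'y) module_scheme \<Rightarrow> ('r, 'm \<times> 'n) module"
  where "prod_module M N = \<lparr>carrier = carrier M \<times> carrier N,
    mult = (\<lambda>x y. (fst x \<otimes>\<^bsub>M\<^esub> fst y, snd x \<otimes>\<^bsub>N\<^esub> snd y)), one = (\<one>\<^bsub>M\<^esub>, \<one>\<^bsub>N\<^esub>), zero = (\<zero>\<^bsub>M\<^esub>, \<zero>\<^bsub>N\<^esub>),
    add = (\<lambda>x y. (fst x \<oplus>\<^bsub>M\<^esub> fst y, snd x \<oplus>\<^bsub>N\<^esub> snd y)),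
    smult = (\<lambda>r x. (r \<odot>\<^bsub>M\<^esub> fst x, r \<odot>\<^bsub>N\<^esub> snd x))\<rparr>"

lemma prod_module_simps [simp]:
  "carrier (prod_module M N) = carrier M \<times> carrier N"
  "(a, b) \<oplus>\<^bsub>prod_module M N\<^esub> (c, d) = (a \<oplus>\<^bsub>M\<^esub> c, b \<oplus>\<^bsub>N\<^esub> d)"
  "\<zero>\<^bsub>prod_module M N\<^esub> = (\<zero>\<^bsub>M\<^esub>, \<zero>\<^bsub>N\<^esub>)"
  "r \<odot>\<^bsub>prod_module M N\<^esub> (a, b) = (r \<odot>\<^bsub>M\<^esub> a, r \<odot>\<^bsub>N\<^esub> b)"
  by (simp_all add: prod_module_def)

lemma prod_module:
  assumes M: "module R M" and N: "module R N"
  shows "module R (prod_module M N)"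
proof -
  interpret M: module R M by fact
  interpret N: module R N by fact
  show ?thesis
  proof (intro moduleI abelian_groupI)
    show "\<exists>y\<in>carrier (prod_module M N). y \<oplus>\<^bsub>prod_module M N\<^esub> x = \<zero>\<^bsub>prod_module M N\<^esub>"
      if x: "x \<in> carrier (prod_module M N)" for x
    proof -
      obtain a b where ab: "x = (a, b)" "a \<in> carrier M" "b \<in> carrier N" using x by auto
      then show ?thesis by (intro bexI[of _ "(\<ominus>\<^bsub>M\<^esub> a, \<ominus>\<^bsub>N\<^esub> b)"]) (simp_all add: M.M.l_neg N.M.l_neg)
    qed
    show "cring R" by (rule M.R.is_cring)
    show "x \<oplus>\<^bsub>prod_module M N\<^esub> y = y \<oplus>\<^bsub>prod_module M N\<^esub> x"
      if "x \<in> carrier (prod_module M N)" "y \<in> carrier (prod_module M N)" for x y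
      using that M.M.a_comm N.M.a_comm by auto
  qed (auto simp: M.M.a_assoc N.M.a_assoc M.smult_l_distr N.smult_l_distr
      M.smult_r_distr N.smult_r_distr M.smult_assoc1 N.smult_assoc1)
qed

lemma prod_baer_injective:
  assumes M: "baer_injective R M" and N: "baer_injective R N"
  shows "baer_injective R (prod_module M N)"
  unfolding baer_injective_def
proof (intro allI impI)
  fix G assume G: "partial_hom R (regular_module R) (prod_module M N) G"
  have add: "(r \<oplus>\<^bsub>R\<^esub> s, (a \<oplus>\<^bsub>M\<^esub> a', b \<oplus>\<^bsub>N\<^esub> b')) \<in> G" if "(r, (a, b)) \<in> G" "(s, (a', b')) \<in> G" for r s a a' b b'
    using partial_homD(4)[OF G that] by simp
  have smult: "(s \<otimes>\<^bsub>R\<^esub> r, (s \<odot>\<^bsub>M\<^esub> a, s \<odot>\<^bsub>N\<^esub> b)) \<in> G" if "s \<in> carrier R" "(r, (a, b)) \<in> G" for r s a b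
    using partial_homD(5)[OF G that] by simp
  have zero: "(\<zero>\<^bsub>R\<^esub>, (\<zero>\<^bsub>M\<^esub>, \<zero>\<^bsub>N\<^esub>)) \<in> G" using partial_homD(3)[OF G] by simp
  have uniq: "a = \<zero>\<^bsub>M\<^esub>" "b = \<zero>\<^bsub>N\<^esub>" if "(\<zero>\<^bsub>R\<^esub>, (a, b)) \<in> G" for a b
    using partial_homD(6)[OF G, of "(a, b)"] that by simp_all
  have car: "r \<in> carrier R" "a \<in> carrier M" "b \<in> carrier N" if "(r, (a, b)) \<in> G" for r a b
    using partial_homD(1,2)[OF G that] by simp_all
  let ?G1 = "{(r, a). \<exists>b. (r, (a, b)) \<in> G}" and ?G2 = "{(r, b). \<exists>a. (r, (a, b)) \<in> G}"
  have "partial_hom R (regular_module R) M ?G1"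
  proof (rule partial_homI)
    show "?G1 \<subseteq> carrier (regular_module R) \<times> carrier M" using car by auto
    show "(\<zero>\<^bsub>regular_module R\<^esub>, \<zero>\<^bsub>M\<^esub>) \<in> ?G1" using zero by auto
    show "(x \<oplus>\<^bsub>regular_module R\<^esub> y, a \<oplus>\<^bsub>M\<^esub> b) \<in> ?G1" if "(x, a) \<in> ?G1" "(y, b) \<in> ?G1" for x a y b
      using that add[of x a _ y b] by fastforce
    show "(r \<odot>\<^bsub>regular_module R\<^esub> x, r \<odot>\<^bsub>M\<^esub> a) \<in> ?G1" if "r \<in> carrier R" "(x, a) \<in> ?G1" for r x a
      using that smult[of r x a] by fastforce
    show "a = \<zero>\<^bsub>M\<^esub>" if "(\<zero>\<^bsub>regular_module R\<^esub>, a) \<in> ?G1" for a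
      using that uniq by auto
  qed
  then obtain e1 where e1: "e1 \<in> carrier M" "\<And>r x. (r, x) \<in> ?G1 \<Longrightarrow> x = r \<odot>\<^bsub>M\<^esub> e1"
    by (rule baer_injectiveD[OF M]) blast
  have "partial_hom R (regular_module R) N ?G2"
  proof (rule partial_homI)
    show "?G2 \<subseteq> carrier (regular_module R) \<times> carrier N" using car by auto
    show "(\<zero>\<^bsub>regular_module R\<^esub>, \<zero>\<^bsub>N\<^esub>) \<in> ?G2" using zero by auto
    show "(x \<oplus>\<^bsub>regular_module R\<^esub> y, a \<oplus>\<^bsub>N\<^esub> b) \<in> ?G2" if "(x, a) \<in> ?G2" "(y, b) \<in> ?G2" for x a y b
      using that add[of x _ a y _ b] by fastforce
    show "(r \<odot>\<^bsub>regular_module R\<^esub> x, r \<odot>\<^bsub>N\<^esub> a) \<in> ?G2" if "r \<in> carrier R" "(x, a) \<in> ?G2" for r x a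
      using that smult[of r x _ a] by fastforce
    show "a = \<zero>\<^bsub>N\<^esub>" if "(\<zero>\<^bsub>regular_module R\<^esub>, a) \<in> ?G2" for a
      using that uniq by auto
  qed
  then obtain e2 where e2: "e2 \<in> carrier N" "\<And>r x. (r, x) \<in> ?G2 \<Longrightarrow> x = r \<odot>\<^bsub>N\<^esub> e2"
    by (rule baer_injectiveD[OF N]) blast
  have "x = r \<odot>\<^bsub>prod_module M N\<^esub> (e1, e2)" if rx: "(r, x) \<in> G" for r x
  proof -
    obtain a b where "x = (a, b)" by (cases x)
    then show ?thesis using e1(2)[of r a] e2(2)[of r b] rx by auto
  qed
  then show "\<exists>e\<in>carrier (prod_module M N). \<forall>r x. (r, x) \<in> G \<longrightarrow> x = r \<odot>\<^bsub>prod_module M N\<^esub> e"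
    using e1(1) e2(1) by (intro bexI[of _ "(e1, e2)"]) auto
qed

definition eval1 :: "('k::field \<Rightarrow> 'p::comm_ring_1) \<Rightarrow> 'p \<Rightarrow> 'k poly \<Rightarrow> 'p"
  where "eval1 C u q = poly (map_poly C q) u"

definition eval2 :: "('k::field \<Rightarrow> 'p::comm_ring_1) \<Rightarrow> 'p \<Rightarrow> 'p \<Rightarrow> 'k poly2 \<Rightarrow> 'p"
  where "eval2 C c u \<tau> = poly (map_poly (eval1 C u) \<tau>) c"

locale scalars =
  fixes C :: "'k::field \<Rightarrow> 'p::comm_ring_1"
  assumes C_one [simp]: "C 1 = 1" and C_add: "C (a + b) = C a + C b" and C_mult: "C (a * b) = C a * C b"
begin

lemma C_zero [simp]: "C 0 = 0"
  using C_add[of 0 0] by simp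

lemma eval1_pCons: "eval1 C u (pCons a q) = C a + u * eval1 C u q"
  by (simp add: eval1_def map_poly_pCons)

lemma eval1_zero [simp]: "eval1 C u 0 = 0"
  by (simp add: eval1_def)

lemma eval1_add: "eval1 C u (p + q) = eval1 C u p + eval1 C u q"
proof (induction p arbitrary: q)
  case (pCons a p)
  obtain b q' where q: "q = pCons b q'" by (metis pCons_cases)
  show ?case unfolding q by (simp add: eval1_pCons C_add pCons algebra_simps)
qed simp

lemma eval2_pCons: "eval2 C c u (pCons q \<tau>) = eval1 C u q + c * eval2 C c u \<tau>"
  by (simp add: eval2_def map_poly_pCons)

lemma eval2_zero [simp]: "eval2 C c u 0 = 0"
  by (simp add: eval2_def)

lemma eval2_add: "eval2 C c u (\<sigma> + \<tau>) = eval2 C c u \<sigma> + eval2 C c u \<tau>"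
proof (induction \<sigma> arbitrary: \<tau>)
  case (pCons a p)
  obtain b q where t: "\<tau> = pCons b q" by (metis pCons_cases)
  show ?case unfolding t by (simp add: eval2_pCons eval1_add pCons algebra_simps)
qed simp

lemma eval2_TC: "eval2 C c u (TC k) = C k"
  by (simp add: eval2_pCons eval1_pCons)

lemma eval2_TX: "eval2 C c u (TX * \<tau>) = c * eval2 C c u \<tau>"
  by (simp add: eval2_pCons)

lemma eval2_TU: "eval2 C c u (TU * \<tau>) = u * eval2 C c u \<tau>"
proof (induction \<tau>)
  case (pCons q \<tau>)
  have "TU * pCons q \<tau> = pCons (pCons 0 q) (TU * \<tau>)" by simp
  then have "eval2 C c u (TU * pCons q \<tau>) = u * eval1 C u q + c * eval2 C c u (TU * \<tau>)"
    by (simp only: eval2_pCons eval1_pCons) simp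
  then show ?case
    unfolding pCons(2) eval2_pCons by (simp only: distrib_left mult.left_commute[of c u])
qed simp

lemma eval2_TC_mult: "eval2 C c u (TC k * \<tau>) = C k * eval2 C c u \<tau>"
proof (induction \<tau> rule: poly2_induct)
  case (const a)
  have "TC k * TC a = TC (k * a)" by simp
  then show ?case by (simp only: eval2_TC C_mult)
qed (simp_all only: distrib_left eval2_add eval2_TX eval2_TU mult.left_commute[of "TC k"] mult.left_commute[of "C k"])

definition klin :: "('p \<Rightarrow> 'k poly2) \<Rightarrow> bool"
  where "klin h \<longleftrightarrow> (\<forall>p q. h (p + q) = h p + h q) \<and> (\<forall>k p. h (C k * p) = TC k * h p)"

lemma klinD:
  assumes "klin h"
  shows "h (p + q) = h p + h q" "h (C k * p) = TC k * h p" "h 0 = 0" "h (p - q) = h p - h q"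
    "h (sum f A) = (\<Sum>i\<in>A. h (f i))"
proof -
  have a: "h (p + q) = h p + h q" for p q
    using assms by (auto simp: klin_def)
  then show "h (p + q) = h p + h q" .
  show "h (C k * p) = TC k * h p"
    using assms unfolding klin_def by blast
  show 0: "h 0 = 0" using a[of 0 0] by (metis add_0 add_cancel_left_right)
  show "h (p - q) = h p - h q" using a[of "p - q" q] by (metis add_diff_cancel diff_add_cancel)
  show "h (sum f A) = (\<Sum>i\<in>A. h (f i))"
    by (induction A rule: infinite_finite_induct) (simp_all add: a 0)
qed

lemma klin_extend:
  fixes g :: "'p \<Rightarrow> 'k poly2"
  assumes U: "\<And>p q. p \<in> U \<Longrightarrow> q \<in> U \<Longrightarrow> p + q \<in> U" "\<And>k p. p \<in> U \<Longrightarrow> C k * p \<in> U"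
    and g: "\<And>p q. p \<in> U \<Longrightarrow> q \<in> U \<Longrightarrow> g (p + q) = g p + g q" "\<And>k p. p \<in> U \<Longrightarrow> g (C k * p) = TC k * g p"
  obtains h where "klin h" "\<And>p. p \<in> U \<Longrightarrow> h p = g p"
proof (cases "U = {}")
  case True
  have "klin (\<lambda>_. 0)" by (simp add: klin_def)
  then show ?thesis using that True by blast
next
  case False
  interpret vector_space_pair "\<lambda>k p. C k * p" "\<lambda>k (\<tau> :: 'k poly2). TC k * \<tau>"
  proof unfold_locales
    have TC: "TC (a + b) = TC a + TC b" "TC (a * b) = TC a * TC b" "TC 1 = (1 :: 'k poly2)" for a b :: 'k
      by (simp_all add: one_pCons)
    fix a b :: 'k and x y :: "'k poly2"
    show "TC a * (x + y) = TC a * x + TC a * y" by (rule distrib_left)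
    show "TC (a + b) * x = TC a * x + TC b * x" unfolding TC by (rule distrib_right)
    show "TC a * (TC b * x) = TC (a * b) * x" unfolding TC by (rule mult.assoc[symmetric])
    show "TC 1 * x = x" unfolding TC by (rule mult_1)
  qed (simp_all add: C_add C_mult algebra_simps)
  obtain B where B: "B \<subseteq> U" "vs1.independent B" "U \<subseteq> vs1.span B"
    using vs1.maximal_independent_subset[of U] by blast
  interpret h: Vector_Spaces.linear "\<lambda>k p. C k * p" "\<lambda>k (\<tau> :: 'k poly2). TC k * \<tau>" "construct B g"
    by (rule linear_construct[OF B(2)])
  have U0: "0 \<in> U" using False U(2)[of _ 0] by fastforce
  have g0: "g 0 = 0" using g(2)[OF U0, of 0] by simp
  have "p \<in> U \<and> construct B g p = g p" if "p \<in> vs1.span B" for p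
    using that
  proof (induction rule: vs1.span_induct_alt)
    case base
    then show ?case using U0 g0 h.zero by simp
  next
    case (step k b p)
    then have b: "b \<in> U" and p: "p \<in> U" "construct B g p = g p" using B(1) by blast+
    have "construct B g (C k * b + p) = TC k * construct B g b + construct B g p"
      unfolding h.add h.scale ..
    also have "\<dots> = g (C k * b + p)"
      unfolding construct_basis[OF B(2) step(1)] p(2) g(1)[OF U(2)[OF b] p(1)] g(2)[OF b] ..
    finally show ?case using U(1)[OF U(2)[OF b] p(1)] by blast
  qed
  moreover have "klin (construct B g)" unfolding klin_def using h.add h.scale by blast
  ultimately show ?thesis using that B(3) by blast
qed

end

section \<open>Frobenius algebras over a polynomial ring in two variables\<close>

text \<open>
  A Frobenius algebra \<open>A\<close> over \<open>T = K[u, c]\<close>, presented as the image of a ring \<open>'p\<close> under \<open>\<rho>\<close>. The form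
  \<open>lam\<close> on \<open>A\<close> and the action of \<open>T\<close> are given on representatives in \<open>'p\<close>; the point of this is that linear
  algebra in \<open>'p\<close> does not need carriers. The \<open>e j\<close> generate \<open>A\<close> over \<open>T\<close> with coordinates \<open>lam (p * e' j)\<close>.
\<close>

locale frobenius_presentation = scalars C
  for C :: "'k::field \<Rightarrow> 'p::comm_ring_1" +
  fixes A :: "'a ring" and \<rho> :: "'p \<Rightarrow> 'a" and c u :: 'p
    and lam :: "'p \<Rightarrow> 'k poly2" and e e' :: "'i \<Rightarrow> 'p" and J :: "'i set"
  assumes A: "cring A"
    and \<rho>_add: "\<rho> (p + q) = \<rho> p \<oplus>\<^bsub>A\<^esub> \<rho> q" and \<rho>_mult: "\<rho> (p * q) = \<rho> p \<otimes>\<^bsub>A\<^esub> \<rho> q"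
    and \<rho>_one: "\<rho> 1 = \<one>\<^bsub>A\<^esub>" and \<rho>_range: "range \<rho> = carrier A"
    and lam_klin: "klin lam" and lam_c: "lam (c * p) = TX * lam p" and lam_u: "lam (u * p) = TU * lam p"
    and lam_ker: "\<rho> p = \<zero>\<^bsub>A\<^esub> \<Longrightarrow> lam p = 0"
    and finite_J: "finite J"
    and dual_basis: "\<rho> p = \<rho> (\<Sum>j\<in>J. eval2 C c u (lam (p * e' j)) * e j)"
begin

sublocale A: cring A by (rule A)

abbreviation \<psi> where "\<psi> \<equiv> eval2 C c u"

lemma \<rho>_closed [simp]: "\<rho> p \<in> carrier A"
  using \<rho>_range by blast

lemma \<rho>_zero: "\<rho> 0 = \<zero>\<^bsub>A\<^esub>"
  using \<rho>_add[of 0 0] by simp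

lemma \<rho>_uminus: "\<rho> (- p) = \<ominus>\<^bsub>A\<^esub> \<rho> p"
  using \<rho>_add[of "- p" p] \<rho>_zero by (simp add: A.minus_equality)

lemma \<rho>_diff_zero: "\<rho> p = \<rho> q \<Longrightarrow> \<rho> (p - q) = \<zero>\<^bsub>A\<^esub>"
  using \<rho>_add[of p "- q"] by (simp add: \<rho>_uminus A.r_neg)

definition rep :: "'a \<Rightarrow> 'p"
  where "rep a = (SOME p. \<rho> p = a)"

lemma \<rho>_rep: "a \<in> carrier A \<Longrightarrow> \<rho> (rep a) = a"
  unfolding rep_def by (rule someI_ex) (metis \<rho>_range imageE)

text \<open>
  \<open>Hom\<^sub>K(A, T)\<close>, as the linear maps on \<open>'p\<close> that vanish on the kernel of \<open>\<rho>\<close>.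
\<close>

definition H :: "('p \<Rightarrow> 'k poly2) set"
  where "H = {h. klin h \<and> (\<forall>p. \<rho> p = \<zero>\<^bsub>A\<^esub> \<longrightarrow> h p = 0)}"

lemma HI:
  assumes "\<And>p q. h (p + q) = h p + h q" "\<And>k p. h (C k * p) = TC k * h p" "\<And>p. \<rho> p = \<zero>\<^bsub>A\<^esub> \<Longrightarrow> h p = 0"
  shows "h \<in> H"
  using assms by (simp add: H_def klin_def)

lemma H_klin: "h \<in> H \<Longrightarrow> klin h"
  by (simp add: H_def)

lemma H_cong:
  assumes "h \<in> H" "\<rho> p = \<rho> q"
  shows "h p = h q"
proof -
  have "h (p - q) = 0" using assms \<rho>_diff_zero by (simp add: H_def)
  then show ?thesis using klinD(4)[OF H_klin[OF assms(1)]] by (metis eq_iff_diff_eq_0)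
qed

lemma H_rep: "h \<in> H \<Longrightarrow> h (rep (\<rho> p) * y) = h (p * y)"
  by (rule H_cong) (simp_all add: \<rho>_mult \<rho>_rep)

lemma lam_H: "lam \<in> H"
  using lam_klin lam_ker by (simp add: H_def)

lemma H_mult: "h \<in> H \<Longrightarrow> (\<lambda>y. h (p * y)) \<in> H"
proof (rule HI)
  assume h: "h \<in> H"
  note l = klinD[OF H_klin[OF h]]
  show "h (p * (x + y)) = h (p * x) + h (p * y)" for x y unfolding distrib_left l(1) ..
  show "h (p * (C k * x)) = TC k * h (p * x)" for k x unfolding mult.left_commute[of p] l(2) ..
  show "h (p * x) = 0" if "\<rho> x = \<zero>\<^bsub>A\<^esub>" for x
  proof -
    have "\<rho> (p * x) = \<zero>\<^bsub>A\<^esub>" using that by (simp add: \<rho>_mult)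
    then show ?thesis using h by (simp add: H_def)
  qed
qed

lemma H_scale: "h \<in> H \<Longrightarrow> (\<lambda>y. \<tau> * h y) \<in> H"
proof (rule HI)
  assume h: "h \<in> H"
  note l = klinD[OF H_klin[OF h]]
  show "\<tau> * h (x + y) = \<tau> * h x + \<tau> * h y" for x y unfolding l(1) by (rule distrib_left)
  show "\<tau> * h (C k * x) = TC k * (\<tau> * h x)" for k x unfolding l(2) by (rule mult.left_commute)
  show "\<tau> * h x = 0" if "\<rho> x = \<zero>\<^bsub>A\<^esub>" for x using h that by (simp add: H_def)
qed

lemma H_add: "f \<in> H \<Longrightarrow> g \<in> H \<Longrightarrow> (\<lambda>y. f y + g y) \<in> H"
proof (rule HI)
  assume f: "f \<in> H" and g: "g \<in> H"
  note l = klinD[OF H_klin[OF f]] and l' = klinD[OF H_klin[OF g]]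
  show "f (x + y) + g (x + y) = f x + g x + (f y + g y)" for x y unfolding l(1) l'(1) by (simp only: ac_simps)
  show "f (C k * x) + g (C k * x) = TC k * (f x + g x)" for k x
    unfolding l(2) l'(2) by (rule distrib_left[symmetric])
  show "f x + g x = 0" if "\<rho> x = \<zero>\<^bsub>A\<^esub>" for x using f g that by (simp add: H_def)
qed

lemma H_uminus: "f \<in> H \<Longrightarrow> (\<lambda>y. - f y) \<in> H"
  using H_scale[of f "- 1"] by simp

lemma H_diff: "f \<in> H \<Longrightarrow> g \<in> H \<Longrightarrow> (\<lambda>y. f y - g y) \<in> H"
  using H_add[OF _ H_uminus] by (simp only: diff_conv_add_uminus)

lemma H_zero: "(\<lambda>_. 0) \<in> H"
  by (rule HI) simp_all

definition HM :: "('a, 'p \<Rightarrow> 'k poly2) module"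
  where "HM = \<lparr>carrier = H, mult = (\<lambda>f g. f), one = (\<lambda>_. 0), zero = (\<lambda>_. 0),
    add = (\<lambda>f g y. f y + g y), smult = (\<lambda>a f y. f (rep a * y))\<rparr>"

lemma HM_simps [simp]: "carrier HM = H" "\<zero>\<^bsub>HM\<^esub> = (\<lambda>_. 0)" "f \<oplus>\<^bsub>HM\<^esub> g = (\<lambda>y. f y + g y)"
  "a \<odot>\<^bsub>HM\<^esub> f = (\<lambda>y. f (rep a * y))"
  by (simp_all add: HM_def)

lemma HM_module: "module A HM"
proof (intro moduleI abelian_groupI)
  show "cring A" by (rule A)
  show "\<exists>y\<in>carrier HM. y \<oplus>\<^bsub>HM\<^esub> x = \<zero>\<^bsub>HM\<^esub>" if "x \<in> carrier HM" for x
    using that H_uminus[of x] by (intro bexI[of _ "\<lambda>y. - x y"]) simp_all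
  fix a b x assume a: "a \<in> carrier A" and b: "b \<in> carrier A" and x': "x \<in> carrier HM"
  then have x: "x \<in> H" by simp
  note l = klinD[OF H_klin[OF x]]
  have "x (rep (a \<oplus>\<^bsub>A\<^esub> b) * y) = x (rep a * y) + x (rep b * y)" for y
  proof -
    have "x (rep (a \<oplus>\<^bsub>A\<^esub> b) * y) = x ((rep a + rep b) * y)"
      by (rule H_cong[OF x]) (use a b in \<open>simp add: \<rho>_mult \<rho>_add \<rho>_rep\<close>)
    then show ?thesis by (simp only: distrib_right l)
  qed
  then show "(a \<oplus>\<^bsub>A\<^esub> b) \<odot>\<^bsub>HM\<^esub> x = a \<odot>\<^bsub>HM\<^esub> x \<oplus>\<^bsub>HM\<^esub> b \<odot>\<^bsub>HM\<^esub> x" by simp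
  have "x (rep (a \<otimes>\<^bsub>A\<^esub> b) * y) = x (rep b * (rep a * y))" for y
    by (rule H_cong[OF x]) (use a b in \<open>simp add: \<rho>_mult \<rho>_rep A.m_assoc A.m_lcomm\<close>)
  then show "(a \<otimes>\<^bsub>A\<^esub> b) \<odot>\<^bsub>HM\<^esub> x = a \<odot>\<^bsub>HM\<^esub> (b \<odot>\<^bsub>HM\<^esub> x)" by simp
next
  fix x assume "x \<in> carrier HM"
  then have x: "x \<in> H" by simp
  have "x (rep \<one>\<^bsub>A\<^esub> * y) = x y" for y
    by (rule H_cong[OF x]) (simp add: \<rho>_mult \<rho>_rep)
  then show "\<one>\<^bsub>A\<^esub> \<odot>\<^bsub>HM\<^esub> x = x" by simp
qed (auto simp: H_add H_zero H_mult add.assoc add.commute)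

text \<open>
  Evaluation at \<open>1\<close> turns an \<open>A\<close>-linear map from an ideal to \<open>H\<close> into a \<open>K\<close>-linear map from the ideal to
  \<open>T\<close>. A \<open>K\<close>-linear extension of the latter to \<open>A\<close> is an element of \<open>H\<close> that represents the former.
\<close>

lemma HM_baer_injective: "baer_injective A HM"
  unfolding baer_injective_def
proof (intro allI impI)
  fix G assume G: "partial_hom A (regular_module A) HM G"
  have AM: "module A (regular_module A)" by (rule module_regular_module[OF A])
  note uniq = partial_hom_unique[OF AM HM_module G]
  have Gc: "r \<in> carrier A" "f \<in> H" if "(r, f) \<in> G" for r f using partial_homD(1,2)[OF G that] by simp_all
  define gg where "gg p = (THE f. (\<rho> p, f) \<in> G)" for p
  have gg: "gg p = f" if "(\<rho> p, f) \<in> G" for p f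
    unfolding gg_def using that uniq by (intro the_equality) blast+
  let ?U = "{p. \<rho> p \<in> Domain G}"
  have add: "(\<rho> (p + q), \<lambda>y. f y + g y) \<in> G" if "(\<rho> p, f) \<in> G" "(\<rho> q, g) \<in> G" for p q f g
    using partial_homD(4)[OF G that] by (simp add: \<rho>_add)
  have mult: "(\<rho> (q * p), \<lambda>y. f (q * y)) \<in> G" if pf: "(\<rho> p, f) \<in> G" for p q f
    using partial_homD(5)[OF G \<rho>_closed pf, of q] H_rep[OF Gc(2)[OF pf]] by (simp add: \<rho>_mult)
  obtain h where h: "klin h" and hU: "\<And>p. p \<in> ?U \<Longrightarrow> h p = gg p 1"
  proof (rule klin_extend[of ?U "\<lambda>p. gg p 1"])
    show "p + q \<in> ?U" if "p \<in> ?U" "q \<in> ?U" for p q using that add by blast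
    show "C k * p \<in> ?U" if "p \<in> ?U" for k p using that mult by blast
    show "gg (p + q) 1 = gg p 1 + gg q 1" if pq: "p \<in> ?U" "q \<in> ?U" for p q
    proof -
      obtain f g where f: "(\<rho> p, f) \<in> G" and g: "(\<rho> q, g) \<in> G" using pq by blast
      show ?thesis unfolding gg[OF add[OF f g]] gg[OF f] gg[OF g] ..
    qed
    show "gg (C k * p) 1 = TC k * gg p 1" if p: "p \<in> ?U" for k p
    proof -
      obtain f where f: "(\<rho> p, f) \<in> G" using p by blast
      have "gg (C k * p) 1 = f (C k * 1)" using gg[OF mult[OF f, of "C k"]] by simp
      also have "\<dots> = TC k * f 1" by (rule klinD(2)[OF H_klin[OF Gc(2)[OF f]]])
      finally show ?thesis using gg[OF f] by simp
    qed
  qed blast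
  have hG: "h p = f 1" if "(\<rho> p, f) \<in> G" for p f
    using hU[of p] gg[OF that] that by auto
  have "h \<in> H"
  proof (rule HI)
    show "h p = 0" if "\<rho> p = \<zero>\<^bsub>A\<^esub>" for p
      using hG[of p "\<lambda>_. 0"] partial_homD(3)[OF G] that by simp
  qed (rule klinD[OF h])+
  moreover have "f = r \<odot>\<^bsub>HM\<^esub> h" if rf: "(r, f) \<in> G" for r f
  proof
    fix y
    have r: "\<rho> (rep r) = r" by (rule \<rho>_rep[OF Gc(1)[OF rf]])
    have "(\<rho> (y * rep r), \<lambda>z. f (y * z)) \<in> G" using mult[of "rep r" f y] rf r by simp
    then have "h (y * rep r) = f (y * 1)" by (rule hG)
    then show "f y = (r \<odot>\<^bsub>HM\<^esub> h) y" by (simp add: mult.commute)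
  qed
  ultimately show "\<exists>e\<in>carrier HM. \<forall>r x. (r, x) \<in> G \<longrightarrow> x = r \<odot>\<^bsub>HM\<^esub> e" by auto
qed

abbreviation HZ where "HZ \<equiv> HM\<lparr>carrier := {\<lambda>_. 0}\<rparr>"

lemma HZ_module: "module A HZ"
  by (rule submodule_moduleI[OF HM_module]) (simp_all add: H_zero)

lemma HZ_baer_injective: "baer_injective A HZ"
  unfolding baer_injective_def
proof (intro allI impI)
  fix G assume G: "partial_hom A (regular_module A) HZ G"
  have "x = r \<odot>\<^bsub>HZ\<^esub> (\<lambda>_. 0)" if "(r, x) \<in> G" for r x
    using partial_homD(2)[OF G that] by (simp add: HM_def)
  then show "\<exists>e\<in>carrier HZ. \<forall>r x. (r, x) \<in> G \<longrightarrow> x = r \<odot>\<^bsub>HZ\<^esub> e" by auto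
qed

lemma commuting_eval2:
  assumes h: "klin h" and hc: "\<And>y. h (c * y) = TX * h y" and hu: "\<And>y. h (u * y) = TU * h y"
  shows "h (\<psi> \<tau> * y) = \<tau> * h y"
proof (induction \<tau> rule: poly2_induct)
  case (const k)
  then show ?case unfolding eval2_TC by (rule klinD(2)[OF h])
next
  case (add \<sigma> \<tau>)
  then show ?case unfolding eval2_add distrib_right klinD(1)[OF h] by simp
next
  case (TX \<tau>)
  then show ?case unfolding eval2_TX mult.assoc hc by simp
next
  case (TU \<tau>)
  then show ?case unfolding eval2_TU mult.assoc hu by simp
qed

lemma lam_eval2: "lam (\<psi> \<tau> * y) = \<tau> * lam y"
  by (rule commuting_eval2[OF lam_klin lam_c lam_u])

lemma lam_nondegenerate:
  assumes "\<And>y. lam (p * y) = 0"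
  shows "\<rho> p = \<zero>\<^bsub>A\<^esub>"
  using dual_basis[of p] assms by (simp add: \<rho>_zero)

text \<open>
  By linearity over \<open>T\<close> and the dual basis identity, \<open>h y = \<Sum>\<^sub>j lam (y * e' j) * h (e j)\<close>; the factors \<open>h (e j)\<close>
  move into the argument of \<open>lam\<close>.
\<close>

lemma commuting_is_lam:
  assumes h: "h \<in> H" and hc: "\<And>y. h (c * y) = TX * h y" and hu: "\<And>y. h (u * y) = TU * h y"
  obtains x where "\<And>y. h y = lam (x * y)"
proof
  fix y
  let ?x = "\<Sum>j\<in>J. \<psi> (h (e j)) * e' j"
  note l = klinD[OF H_klin[OF h]] and ll = klinD[OF lam_klin]
  have "h y = h (\<Sum>j\<in>J. \<psi> (lam (y * e' j)) * e j)" by (rule H_cong[OF h dual_basis])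
  also have "\<dots> = (\<Sum>j\<in>J. lam (y * e' j) * h (e j))"
    unfolding l(5) commuting_eval2[OF H_klin[OF h] hc hu] ..
  also have "\<dots> = (\<Sum>j\<in>J. lam (\<psi> (h (e j)) * (y * e' j)))"
    unfolding lam_eval2 by (simp add: mult.commute)
  also have "\<dots> = lam (?x * y)"
    unfolding ll(5)[symmetric] sum_distrib_right by (simp add: ac_simps)
  finally show "h y = lam (?x * y)" .
qed

text \<open>
  The maps \<open>h \<mapsto> (\<tau> \<mapsto> h (\<psi> \<tau> * e j))\<close>, for all \<open>j\<close>, and \<open>glue\<close> below exhibit \<open>Hom\<^sub>K(A, T)\<close> as a direct summand of a
  power of \<open>Hom\<^sub>K(T, T)\<close>, compatibly with the commutators. Thus the Koszul complex of \<open>A\<close> inherits exactness from that of \<open>T\<close>.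
\<close>

lemma restrict_Tlin:
  assumes h: "h \<in> H"
  shows "Tlin (\<lambda>\<tau>. h (\<psi> \<tau> * e j))"
  unfolding Tlin_def
proof (intro conjI allI)
  note l = klinD[OF H_klin[OF h]]
  show "h (\<psi> (\<sigma> + \<tau>) * e j) = h (\<psi> \<sigma> * e j) + h (\<psi> \<tau> * e j)" for \<sigma> \<tau>
    unfolding eval2_add distrib_right l(1) ..
  show "h (\<psi> (TC k * \<tau>) * e j) = TC k * h (\<psi> \<tau> * e j)" for k \<tau>
    unfolding eval2_TC_mult mult.assoc l(2) ..
qed

definition glue :: "('i \<Rightarrow> 'k poly2 \<Rightarrow> 'k poly2) \<Rightarrow> 'p \<Rightarrow> 'k poly2"
  where "glue F y = (\<Sum>j\<in>J. F j (lam (y * e' j)))"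

lemma glue_H:
  assumes F: "\<And>j. Tlin (F j)"
  shows "glue F \<in> H"
proof (rule HI)
  have Fa: "F j (\<sigma> + \<tau>) = F j \<sigma> + F j \<tau>" and Fc: "F j (TC k * \<tau>) = TC k * F j \<tau>" for j \<sigma> \<tau> k
    using F[of j] by (auto simp: Tlin_def)
  have F0: "F j 0 = 0" for j using Fa[of j 0 0] by (metis add_0 add_cancel_left_right)
  note ll = klinD[OF lam_klin]
  show "glue F (p + q) = glue F p + glue F q" for p q
    unfolding glue_def distrib_right ll(1) Fa by (rule sum.distrib)
  show "glue F (C k * p) = TC k * glue F p" for k p
    unfolding glue_def mult.assoc ll(2) Fc sum_distrib_left ..
  show "glue F p = 0" if "\<rho> p = \<zero>\<^bsub>A\<^esub>" for p
    using that by (simp add: glue_def lam_ker \<rho>_mult F0)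
qed

lemma glue_restrict:
  assumes h: "h \<in> H"
  shows "glue (\<lambda>j \<tau>. h (\<psi> \<tau> * e j)) y = h y"
  unfolding glue_def klinD(5)[OF H_klin[OF h], symmetric] by (rule H_cong[OF h dual_basis[symmetric]])

lemma glue_c: "glue F (c * y) - TX * glue F y = glue (\<lambda>j \<tau>. F j (TX * \<tau>) - TX * F j \<tau>) y"
  unfolding glue_def mult.assoc lam_c sum_distrib_left sum_subtractf ..

lemma glue_u: "glue F (u * y) - TU * glue F y = glue (\<lambda>j \<tau>. F j (TU * \<tau>) - TU * F j \<tau>) y"
  unfolding glue_def mult.assoc lam_u sum_distrib_left sum_subtractf ..

lemma koszul_last:
  assumes k: "k \<in> H"
  obtains h where "h \<in> H" "\<And>y. h (c * y) - TX * h y = k y"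
proof -
  have "\<forall>j. \<exists>f. Tlin f \<and> (\<forall>\<tau>. f (TX * \<tau>) - TX * f \<tau> = k (\<psi> \<tau> * e j))"
    using Tlin_TX_solve[OF restrict_Tlin[OF k]] by blast
  then obtain F where F: "\<And>j. Tlin (F j)" and FX: "\<And>j \<tau>. F j (TX * \<tau>) - TX * F j \<tau> = k (\<psi> \<tau> * e j)"
    by metis
  show ?thesis
  proof (rule that)
    show "glue F \<in> H" by (rule glue_H[OF F])
    show "glue F (c * y) - TX * glue F y = k y" for y
      unfolding glue_c FX by (rule glue_restrict[OF k])
  qed
qed

lemma koszul_middle:
  assumes f: "f \<in> H" and g: "g \<in> H"
    and fg: "\<And>y. f (u * y) - TU * f y = g (c * y) - TX * g y"
  obtains h where "h \<in> H" "\<And>y. h (c * y) - TX * h y = f y" "\<And>y. h (u * y) - TU * h y = g y"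
proof -
  have "\<forall>j. \<exists>h. Tlin h \<and> (\<forall>\<tau>. h (TX * \<tau>) - TX * h \<tau> = f (\<psi> \<tau> * e j)) \<and>
      (\<forall>\<tau>. h (TU * \<tau>) - TU * h \<tau> = g (\<psi> \<tau> * e j))"
  proof
    fix j
    have "f (\<psi> (TU * \<tau>) * e j) - TU * f (\<psi> \<tau> * e j) = g (\<psi> (TX * \<tau>) * e j) - TX * g (\<psi> \<tau> * e j)" for \<tau>
      unfolding eval2_TX eval2_TU mult.assoc by (rule fg)
    then show "\<exists>h. Tlin h \<and> (\<forall>\<tau>. h (TX * \<tau>) - TX * h \<tau> = f (\<psi> \<tau> * e j)) \<and>
      (\<forall>\<tau>. h (TU * \<tau>) - TU * h \<tau> = g (\<psi> \<tau> * e j))"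
      by (rule Tlin_Koszul[OF restrict_Tlin[OF f] restrict_Tlin[OF g]])
  qed
  then obtain F where F: "\<And>j. Tlin (F j)" and FX: "\<And>j \<tau>. F j (TX * \<tau>) - TX * F j \<tau> = f (\<psi> \<tau> * e j)"
    and FU: "\<And>j \<tau>. F j (TU * \<tau>) - TU * F j \<tau> = g (\<psi> \<tau> * e j)"
    by metis
  show ?thesis
  proof (rule that)
    show "glue F \<in> H" by (rule glue_H[OF F])
    show "glue F (c * y) - TX * glue F y = f y" for y
      unfolding glue_c FX by (rule glue_restrict[OF f])
    show "glue F (u * y) - TU * glue F y = g y" for y
      unfolding glue_u FU by (rule glue_restrict[OF g])
  qed
qed


declare mult_pCons_left [simp del] mult_pCons_right [simp del]

text \<open>
  The resolution of \<open>A\<close>, with the terms \<open>H\<close>, \<open>H \<times> H\<close> and \<open>H\<close> in degrees \<open>0\<close>, \<open>1\<close> and \<open>2\<close>. All terms are products, so that they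
  share one type; a factor that is absent is the zero module.
\<close>

definition E :: "nat \<Rightarrow> ('a, ('p \<Rightarrow> 'k poly2) \<times> ('p \<Rightarrow> 'k poly2)) module"
  where "E i = prod_module (if i \<le> 2 then HM else HZ) (if i = 1 then HM else HZ)"

lemma E_module: "module A (E i)"
  by (simp add: E_def prod_module HM_module HZ_module)

lemma E_baer_injective: "baer_injective A (E i)"
  by (simp add: E_def prod_baer_injective HM_baer_injective HZ_baer_injective)

definition \<epsilon> :: "'a \<Rightarrow> ('p \<Rightarrow> 'k poly2) \<times> ('p \<Rightarrow> 'k poly2)"
  where "\<epsilon> a = (\<lambda>y. lam (rep a * y), \<lambda>_. 0)"

definition \<delta> :: "nat \<Rightarrow> ('p \<Rightarrow> 'k poly2) \<times> ('p \<Rightarrow> 'k poly2) \<Rightarrow> ('p \<Rightarrow> 'k poly2) \<times> ('p \<Rightarrow> 'k poly2)"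
  where "\<delta> i = (\<lambda>(f, g).
    if i = 0 then (\<lambda>y. f (c * y) - TX * f y, \<lambda>y. f (u * y) - TU * f y)
    else if i = 1 then (\<lambda>y. (f (u * y) - TU * f y) - (g (c * y) - TX * g y), \<lambda>_. 0)
    else (\<lambda>_. 0, \<lambda>_. 0))"

lemma commutator_H: "f \<in> H \<Longrightarrow> (\<lambda>y. f (p * y) - \<tau> * f y) \<in> H"
  by (intro H_diff H_mult H_scale)

lemma E_simps:
  "carrier (E i) = (if i \<le> 2 then H else {\<lambda>_. 0}) \<times> (if i = 1 then H else {\<lambda>_. 0})"
  "\<zero>\<^bsub>E i\<^esub> = (\<lambda>_. 0, \<lambda>_. 0)"
  "(f, g) \<oplus>\<^bsub>E i\<^esub> (f', g') = (\<lambda>y. f y + f' y, \<lambda>y. g y + g' y)"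
  "a \<odot>\<^bsub>E i\<^esub> (f, g) = (\<lambda>y. f (rep a * y), \<lambda>y. g (rep a * y))"
  by (auto simp: E_def)

lemma \<epsilon>_hom: "\<epsilon> \<in> mod_hom A (regular_module A) (E 0)"
proof (rule mod_homI)
  note ll = klinD[OF lam_klin]
  fix a b assume a: "a \<in> carrier (regular_module A)" and b: "b \<in> carrier (regular_module A)"
  show "\<epsilon> a \<in> carrier (E 0)" by (simp add: E_simps \<epsilon>_def H_mult lam_H)
  have "lam (rep (a \<oplus>\<^bsub>A\<^esub> b) * y) = lam (rep a * y) + lam (rep b * y)" for y
  proof -
    have "lam (rep (a \<oplus>\<^bsub>A\<^esub> b) * y) = lam ((rep a + rep b) * y)"
      by (rule H_cong[OF lam_H]) (use a b in \<open>simp add: \<rho>_mult \<rho>_add \<rho>_rep\<close>)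
    then show ?thesis by (simp only: distrib_right ll)
  qed
  then show "\<epsilon> (a \<oplus>\<^bsub>regular_module A\<^esub> b) = \<epsilon> a \<oplus>\<^bsub>E 0\<^esub> \<epsilon> b" by (simp add: \<epsilon>_def E_simps)
next
  fix r a assume r: "r \<in> carrier A" and a: "a \<in> carrier (regular_module A)"
  have "lam (rep (r \<otimes>\<^bsub>A\<^esub> a) * y) = lam (rep a * (rep r * y))" for y
    by (rule H_cong[OF lam_H]) (use r a in \<open>simp add: \<rho>_mult \<rho>_rep A.m_assoc A.m_lcomm\<close>)
  then show "\<epsilon> (r \<odot>\<^bsub>regular_module A\<^esub> a) = r \<odot>\<^bsub>E 0\<^esub> \<epsilon> a" by (simp add: \<epsilon>_def E_simps)
qed

lemma \<epsilon>_inj: "inj_on \<epsilon> (carrier A)"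
proof (rule inj_onI)
  fix a b assume ab: "a \<in> carrier A" "b \<in> carrier A" "\<epsilon> a = \<epsilon> b"
  have "lam (rep a * y) = lam (rep b * y)" for y
    using ab(3) by (auto simp: \<epsilon>_def fun_eq_iff)
  then have "lam ((rep a - rep b) * y) = 0" for y
    by (simp only: left_diff_distrib klinD(4)[OF lam_klin]) simp
  then have "\<rho> (rep a - rep b) = \<zero>\<^bsub>A\<^esub>" by (rule lam_nondegenerate)
  then have "a \<oplus>\<^bsub>A\<^esub> \<ominus>\<^bsub>A\<^esub> b = \<zero>\<^bsub>A\<^esub>"
    using \<rho>_add[of "rep a" "- rep b"] ab by (simp add: \<rho>_uminus \<rho>_rep)
  then show "a = b" using ab by (metis A.a_inv_closed A.minus_equality A.minus_minus)
qed

lemma \<delta>_hom: "\<delta> i \<in> mod_hom A (E i) (E (Suc i))"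
proof (rule mod_homI)
  have i: "i = 0 \<or> i = 1 \<or> i \<ge> 2" by auto
  fix x assume x: "x \<in> carrier (E i)"
  obtain f g where fg: "x = (f, g)" by (cases x)
  show "\<delta> i x \<in> carrier (E (Suc i))"
    using i x by (auto simp: fg E_simps \<delta>_def commutator_H H_diff H_zero)
next
  fix x y assume xy: "x \<in> carrier (E i)" "y \<in> carrier (E i)"
  obtain f g f' g' where fg: "x = (f, g)" "y = (f', g')" by (cases x, cases y)
  show "\<delta> i (x \<oplus>\<^bsub>E i\<^esub> y) = \<delta> i x \<oplus>\<^bsub>E (Suc i)\<^esub> \<delta> i y"
    unfolding fg E_simps \<delta>_def
    by (auto simp: fun_eq_iff E_simps algebra_simps)
next
  fix r x assume r: "r \<in> carrier A" and x: "x \<in> carrier (E i)"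
  obtain f g where fg: "x = (f, g)" by (cases x)
  show "\<delta> i (r \<odot>\<^bsub>E i\<^esub> x) = r \<odot>\<^bsub>E (Suc i)\<^esub> \<delta> i x"
    unfolding fg E_simps \<delta>_def by (auto simp: fun_eq_iff E_simps mult.left_commute[of "rep r"])
qed

lemma exact_0: "\<epsilon> ` carrier A = {x \<in> carrier (E 0). \<delta> 0 x = \<zero>\<^bsub>E 1\<^esub>}"
proof (intro equalityI subsetI)
  fix x assume "x \<in> \<epsilon> ` carrier A"
  then obtain a where a: "a \<in> carrier A" "x = \<epsilon> a" by blast
  have "x \<in> carrier (E 0)" unfolding a(2) using mod_homD(1)[OF \<epsilon>_hom, of a] a(1) by simp
  moreover have "lam (rep a * (c * y)) = TX * lam (rep a * y)" "lam (rep a * (u * y)) = TU * lam (rep a * y)" for y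
    unfolding mult.left_commute[of "rep a"] by (rule lam_c lam_u)+
  then have "\<delta> 0 x = \<zero>\<^bsub>E 1\<^esub>" unfolding a(2) \<delta>_def \<epsilon>_def E_simps by simp
  ultimately show "x \<in> {x \<in> carrier (E 0). \<delta> 0 x = \<zero>\<^bsub>E 1\<^esub>}" by blast
next
  fix x assume x: "x \<in> {x \<in> carrier (E 0). \<delta> 0 x = \<zero>\<^bsub>E 1\<^esub>}"
  then obtain f where f: "x = (f, \<lambda>_. 0)" "f \<in> H" by (auto simp: E_simps)
  have "f (c * y) - TX * f y = 0" "f (u * y) - TU * f y = 0" for y
    using x unfolding f(1) \<delta>_def E_simps by (simp_all add: fun_eq_iff)
  then have "f (c * y) = TX * f y" "f (u * y) = TU * f y" for y
    by (metis eq_iff_diff_eq_0)+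
  then obtain p where p: "\<And>y. f y = lam (p * y)" using commuting_is_lam[OF f(2)] by metis
  have "x = \<epsilon> (\<rho> p)" unfolding f(1) \<epsilon>_def using p H_rep[OF lam_H] by (simp add: fun_eq_iff)
  then show "x \<in> \<epsilon> ` carrier A" by simp
qed

lemma exact_Suc: "\<delta> i ` carrier (E i) = {x \<in> carrier (E (Suc i)). \<delta> (Suc i) x = \<zero>\<^bsub>E (Suc (Suc i))\<^esub>}"
proof -
  have i: "i = 0 \<or> i = 1 \<or> i \<ge> 2" by auto
  then consider (0) "i = 0" | (1) "i = 1" | (2) "i \<ge> 2" by blast
  then show ?thesis
  proof cases
    case 0
    show ?thesis
    proof (intro equalityI subsetI)
      fix x assume "x \<in> \<delta> i ` carrier (E i)"
      then obtain f where f: "f \<in> H" "x = \<delta> 0 (f, \<lambda>_. 0)" by (auto simp: 0 E_simps)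
      have "f (c * (u * y)) = f (u * (c * y))" for y by (simp add: mult.left_commute)
      then have "\<delta> 1 x = (\<lambda>_. 0, \<lambda>_. 0)"
        unfolding f(2) \<delta>_def by (simp add: fun_eq_iff algebra_simps)
      moreover have "x \<in> carrier (E 1)" unfolding f(2) by (simp add: E_simps \<delta>_def commutator_H f(1))
      ultimately show "x \<in> {x \<in> carrier (E (Suc i)). \<delta> (Suc i) x = \<zero>\<^bsub>E (Suc (Suc i))\<^esub>}"
        by (simp add: 0 E_simps)
    next
      fix x assume x: "x \<in> {x \<in> carrier (E (Suc i)). \<delta> (Suc i) x = \<zero>\<^bsub>E (Suc (Suc i))\<^esub>}"
      then obtain f g where fg: "x = (f, g)" "f \<in> H" "g \<in> H" by (auto simp: 0 E_simps)
      have "(f (u * y) - TU * f y) - (g (c * y) - TX * g y) = 0" for y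
        using x unfolding fg(1) 0 \<delta>_def E_simps by (simp add: fun_eq_iff)
      then have "f (u * y) - TU * f y = g (c * y) - TX * g y" for y by (metis eq_iff_diff_eq_0)
      then obtain h where h: "h \<in> H" "\<And>y. h (c * y) - TX * h y = f y" "\<And>y. h (u * y) - TU * h y = g y"
        using koszul_middle[OF fg(2,3)] by metis
      have "x = \<delta> i (h, \<lambda>_. 0)" unfolding fg(1) 0 \<delta>_def using h(2,3) by (simp add: fun_eq_iff)
      then show "x \<in> \<delta> i ` carrier (E i)" using h(1) by (simp add: 0 E_simps)
    qed
  next
    case 1
    have "{x \<in> carrier (E 2). \<delta> 2 x = \<zero>\<^bsub>E 3\<^esub>} = H \<times> {\<lambda>_. 0}"
      by (auto simp: E_simps \<delta>_def)
    moreover have "\<delta> 1 ` carrier (E 1) = H \<times> {\<lambda>_. 0}"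
    proof (intro equalityI subsetI)
      fix x assume "x \<in> \<delta> 1 ` carrier (E 1)"
      then show "x \<in> H \<times> {\<lambda>_. 0}" using mod_homD(1)[OF \<delta>_hom[of 1]] by (auto simp: E_simps)
    next
      fix x assume "x \<in> H \<times> {\<lambda>_ :: 'p. 0 :: 'k poly2}"
      then obtain k where k: "x = (k, \<lambda>_. 0)" "k \<in> H" by blast
      obtain g where g: "g \<in> H" "\<And>y. g (c * y) - TX * g y = - k y"
        using koszul_last[OF H_uminus[OF k(2)]] by metis
      have "k y = 0 - (g (c * y) - TX * g y)" for y unfolding g(2) by simp
      then have "x = \<delta> 1 (\<lambda>_. 0, g)" unfolding k(1) \<delta>_def by (simp add: fun_eq_iff)
      then show "x \<in> \<delta> 1 ` carrier (E 1)" using g(1) H_zero by (auto simp: E_simps intro!: image_eqI)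
    qed
    ultimately show ?thesis using 1 by (simp add: numeral_2_eq_2 numeral_3_eq_3)
  next
    case 2
    then have "carrier (E (Suc i)) = {(\<lambda>_. 0, \<lambda>_. 0)}" by (simp add: E_simps)
    moreover have "\<delta> i ` carrier (E i) = {(\<lambda>_. 0, \<lambda>_. 0)}"
      using 2 H_zero by (auto simp: E_simps \<delta>_def image_def)
    moreover have "\<delta> (Suc i) (\<lambda>_. 0, \<lambda>_. 0) = (\<lambda>_. 0, \<lambda>_. 0)" using 2 by (simp add: \<delta>_def)
    ultimately show ?thesis by (auto simp: E_simps(2))
  qed
qed

text \<open>
  The injection \<open>emb\<close> expresses that the type to which injective resolutions are confined is large enough.
\<close>

theorem gorenstein_ring:
  fixes emb :: "('p \<Rightarrow> 'k poly2) \<times> ('p \<Rightarrow> 'k poly2) \<Rightarrow> (nat \<times> ('a \<times> 'a) set) set"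
  assumes noeth: "noetherian_ring A" and emb: "inj emb"
  shows "gorenstein_ring A"
  unfolding gorenstein_ring_def
proof (intro conjI allI impI A noeth)
  fix P assume P: "primeideal P A"
  show "finite_injective_dimension (localization A P) (regular_module (localization A P))"
  proof (rule finite_injective_dimension_localization[OF A noeth P E_module E_baer_injective \<epsilon>_hom \<epsilon>_inj \<delta>_hom exact_0 exact_Suc _ emb])
    show "carrier (E i) = {\<zero>\<^bsub>E i\<^esub>}" if "i > 2" for i using that by (simp add: E_simps)
  qed
qed

end

section \<open>A trace form given on monomials\<close>

text \<open>
  The value of the trace form at \<open>t ^ j * x ^ k * b\<close>, if \<open>g j\<close> is the value of the form of \<open>B\<close> at \<open>t ^ j * b\<close>, for \<open>b\<close>
  in \<open>B\<close>. The form takes the coefficient of \<open>x\<close> with respect to the basis \<open>1, x\<close>, which gives the values at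
  \<open>k = 0, 1\<close>; the recursion is \<open>x\<^sup>2 = c x - t\<close>.
\<close>

fun xpow_trace :: "(nat \<Rightarrow> 'k::field poly2) \<Rightarrow> nat \<Rightarrow> nat \<Rightarrow> 'k poly2"
  where
    "xpow_trace g j 0 = 0"
  | "xpow_trace g j (Suc 0) = g j"
  | "xpow_trace g j (Suc (Suc k)) = TX * xpow_trace g j (Suc k) - xpow_trace g (Suc j) k"

lemma xpow_trace_shift: "xpow_trace (\<lambda>j. g (Suc j)) j k = xpow_trace g (Suc j) k"
  by (induction g j k rule: xpow_trace.induct) simp_all

lemma xpow_trace_scale: "xpow_trace (\<lambda>j. \<tau> * g j) j k = \<tau> * xpow_trace g j k"
  by (induction g j k rule: xpow_trace.induct) (simp_all only: xpow_trace.simps mult_zero_right right_diff_distrib mult.left_commute)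

lemma xpow_trace_diff: "xpow_trace (\<lambda>j. f j - g j) j k = xpow_trace f j k - xpow_trace g j k"
proof (induction f j k rule: xpow_trace.induct)
  case (3 f j k)
  show ?case by (simp only: xpow_trace.simps 3 right_diff_distrib) (simp only: algebra_simps)
qed simp_all

lemma xpow_trace_sum: "xpow_trace (\<lambda>j. \<Sum>i\<in>I. f i j) j k = (\<Sum>i\<in>I. xpow_trace (f i) j k)"
proof (induction "\<lambda>j. \<Sum>i\<in>I. f i j" j k rule: xpow_trace.induct)
  case (3 j k)
  show ?case by (simp only: xpow_trace.simps 3 sum_distrib_left sum_subtractf)
qed simp_all

text \<open>
  The value at \<open>x ^ p * z ^ q * b\<close>, with as many factors \<open>x z = t\<close> as possible split off. Exchanging \<open>x\<close> and
  \<open>z = c - x\<close> fixes \<open>c\<close> and \<open>t\<close> and reverses the sign of the form.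
\<close>

definition xz_trace :: "(nat \<Rightarrow> 'k::field poly2) \<Rightarrow> nat \<Rightarrow> nat \<Rightarrow> 'k poly2"
  where "xz_trace g p q = (if q \<le> p then xpow_trace g q (p - q) else - xpow_trace g p (q - p))"

lemma xz_trace_Suc_Suc: "xz_trace g (Suc p) (Suc q) = xz_trace (\<lambda>j. g (Suc j)) p q"
  by (simp add: xz_trace_def xpow_trace_shift)

lemma xz_trace_scale: "xz_trace (\<lambda>j. \<tau> * g j) p q = \<tau> * xz_trace g p q"
  by (simp add: xz_trace_def xpow_trace_scale)

lemma xz_trace_diff: "xz_trace (\<lambda>j. f j - g j) p q = xz_trace f p q - xz_trace g p q"
  by (simp add: xz_trace_def xpow_trace_diff)

lemma xz_trace_sum: "xz_trace (\<lambda>j. \<Sum>i\<in>I. f i j) p q = (\<Sum>i\<in>I. xz_trace (f i) p q)"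
  by (simp add: xz_trace_def xpow_trace_sum sum_negf)

lemma xz_trace_TX: "xz_trace g (Suc p) q + xz_trace g p (Suc q) = TX * xz_trace g p q"
proof -
  have *: "xpow_trace g j (Suc (Suc k)) + xpow_trace g (Suc j) k = TX * xpow_trace g j (Suc k)" for j k by simp
  consider "p = q" | k where "p = q + Suc k" | k where "q = p + Suc k"
    by (metis add_Suc_right less_imp_Suc_add linorder_neqE_nat)
  then show ?thesis
  proof cases
    case 1
    then show ?thesis by (simp add: xz_trace_def)
  next
    case (2 k)
    have a: "xz_trace g (Suc p) q = xpow_trace g q (Suc (Suc k))" "xz_trace g p (Suc q) = xpow_trace g (Suc q) k" "xz_trace g p q = xpow_trace g q (Suc k)"
      using 2 by (auto simp: xz_trace_def)
    show ?thesis unfolding a by (rule *)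
  next
    case (3 k)
    have a: "xz_trace g (Suc p) q = - xpow_trace g (Suc p) k" "xz_trace g p (Suc q) = - xpow_trace g p (Suc (Suc k))" "xz_trace g p q = - xpow_trace g p (Suc k)"
      using 3 by (auto simp: xz_trace_def)
    show ?thesis unfolding a mult_minus_right *[symmetric] by simp
  qed
qed

text \<open>
  The value of the form of \<open>B\<close> at \<open>t ^ j\<close> times a monomial of degree \<open>d\<close> in the \<open>y\<^sub>i\<close>; the product is \<open>t\<^bsub>2 j + d\<^esub>\<close> unless it is
  a power of a single \<open>y\<^sub>i\<close>. The flag \<open>mixed\<close> tells whether two different \<open>y\<^sub>i\<close> occur in the monomial. The subtraction
  does not truncate for monomials: an odd degree is at least \<open>3\<close> if two different \<open>y\<^sub>i\<close> occur, and otherwise \<open>j \<ge> 1\<close>.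
\<close>

definition y_trace :: "nat \<Rightarrow> bool \<Rightarrow> nat \<Rightarrow> 'k::field poly2"
  where "y_trace d mixed j = (if odd d \<and> (mixed \<or> j \<ge> 1) then TU ^ ((2 * j + d - 3) div 2) else 0)"

lemma y_trace_mixed_step: "y_trace (d + 2) True j = y_trace d b (Suc j)"
  by (simp add: y_trace_def)

text \<open>
  Linearity over \<open>K[u]\<close>, where \<open>u = \<Sum>\<^sub>i y\<^sub>i\<^sup>2 - (n - 1) t\<close>. On \<open>t\<^sub>d\<close> each of the \<open>n\<close> squares and \<open>t\<close> act in the same
  way, so one of them remains. On an odd power of \<open>y\<^sub>k\<close> the squares of the other \<open>n - 1\<close> variables
  produce the same \<open>t\<^bsub>d + 2\<^esub>\<close> as \<open>t\<close> does, so these terms cancel. The flag \<open>bs i\<close> belongs to the product with \<open>y\<^sub>i\<^sup>2\<close>.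
\<close>

lemma y_trace_TU_step:
  fixes bs :: "nat \<Rightarrow> bool"
  assumes n: "n \<ge> 1"
    and cases: "d = 0 \<or> (b \<and> d \<ge> 2 \<and> (\<forall>i\<in>{1..n}. bs i)) \<or>
      (\<not> b \<and> (\<exists>k\<in>{1..n}. \<forall>i\<in>{1..n}. bs i \<longleftrightarrow> i \<noteq> k))"
  shows "(\<Sum>i=1..n. y_trace (d + 2) (bs i) j) - of_nat (n - 1) * y_trace d b (Suc j) = TU * (y_trace d b j :: 'k::field poly2)"
proof -
  have step: "y_trace d b (Suc j) = TU * (y_trace d b j :: 'k poly2)" if "odd d" "b \<and> d \<ge> 2 \<or> j \<ge> 1"
  proof -
    have "(2 * Suc j + d - 3) div 2 = Suc ((2 * j + d - 3) div 2)"
      using that by (auto elim!: oddE)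
    then show ?thesis using that by (auto simp: y_trace_def simp del: mult_pCons_left)
  qed
  have all: "(\<Sum>i=1..n. y_trace (d + 2) (bs i) j) = of_nat n * (y_trace d b (Suc j) :: 'k poly2)"
    if "\<And>i. i \<in> {1..n} \<Longrightarrow> bs i \<or> j \<ge> 1"
  proof -
    have "y_trace (d + 2) (bs i) j = (y_trace d b (Suc j) :: 'k poly2)" if "i \<in> {1..n}" for i
      using \<open>\<And>i. i \<in> {1..n} \<Longrightarrow> bs i \<or> j \<ge> 1\<close>[OF that] by (auto simp: y_trace_def)
    then have "(\<Sum>i=1..n. y_trace (d + 2) (bs i) j) = (\<Sum>i=1..n. (y_trace d b (Suc j) :: 'k poly2))"
      by (intro sum.cong) auto
    then show ?thesis by simp
  qed
  have n': "of_nat n * \<tau> - of_nat (n - 1) * \<tau> = (\<tau> :: 'k poly2)" for \<tau>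
  proof -
    have "(of_nat n :: 'k poly2) = of_nat (n - 1) + 1" using n by (metis Suc_diff_1 Suc_le_eq One_nat_def add.commute of_nat_Suc)
    then show ?thesis by (simp only: distrib_right) simp
  qed
  consider "even d" | "odd d" "b" "d \<ge> 2" "\<forall>i\<in>{1..n}. bs i"
    | k where "odd d" "\<not> b" "k \<in> {1..n}" "\<forall>i\<in>{1..n}. bs i \<longleftrightarrow> i \<noteq> k"
  proof -
    have "even d" if "d = 0" using that by simp
    then show thesis using cases that by blast
  qed
  then show ?thesis
  proof cases
    case 1
    then show ?thesis by (simp add: y_trace_def)
  next
    case 2
    have "(\<Sum>i=1..n. y_trace (d + 2) (bs i) j) = of_nat n * (y_trace d b (Suc j) :: 'k poly2)"
      by (rule all) (use 2 in blast)
    then show ?thesis by (simp only: n') (rule step, use 2 in auto)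
  next
    case (3 k)
    show ?thesis
    proof (cases "j \<ge> 1")
      case True
      have "(\<Sum>i=1..n. y_trace (d + 2) (bs i) j) = of_nat n * (y_trace d b (Suc j) :: 'k poly2)"
        by (rule all) (use True in blast)
      then show ?thesis by (simp only: n') (rule step, use 3 True in auto)
    next
      case False
      have "(\<Sum>i=1..n. y_trace (d + 2) (bs i) j) = (\<Sum>i\<in>{1..n} - {k}. (y_trace d b (Suc j) :: 'k poly2))"
      proof (rule sum.mono_neutral_cong_right)
        show "\<forall>i\<in>{1..n} - ({1..n} - {k}). y_trace (d + 2) (bs i) j = (0 :: 'k poly2)"
          using 3 False by (auto simp: y_trace_def)
        show "y_trace (d + 2) (bs i) j = (y_trace d b (Suc j) :: 'k poly2)" if "i \<in> {1..n} - {k}" for i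
          using 3 that by (auto simp: y_trace_def)
      qed auto
      also have "\<dots> = of_nat (n - 1) * y_trace d b (Suc j)" using 3(3) by simp
      finally show ?thesis using 3 False by (simp add: y_trace_def)
    qed
  qed
qed

definition linear_extension :: "('m \<Rightarrow> 'k::field poly2) \<Rightarrow> ('m \<Rightarrow>\<^sub>0 'k) \<Rightarrow> 'k poly2"
  where "linear_extension v p = (\<Sum>m\<in>Poly_Mapping.keys p. TC (Poly_Mapping.lookup p m) * v m)"

lemma linear_extension_superset:
  assumes "finite B" "Poly_Mapping.keys p \<subseteq> B"
  shows "linear_extension v p = (\<Sum>m\<in>B. TC (Poly_Mapping.lookup p m) * v m)"
  unfolding linear_extension_def
  by (rule sum.mono_neutral_left) (use assms in \<open>auto simp: in_keys_iff\<close>)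

lemma linear_extension_add: "linear_extension v (p + q) = linear_extension v p + linear_extension v q"
proof -
  let ?B = "Poly_Mapping.keys p \<union> Poly_Mapping.keys q"
  have B: "finite ?B" by simp
  have TC: "TC (a + b) * v m = TC a * v m + TC b * v m" for a b m
  proof -
    have "TC (a + b) = TC a + TC b" by simp
    then show ?thesis by (simp only: distrib_right)
  qed
  show ?thesis
    using linear_extension_superset[OF B keys_add] linear_extension_superset[OF B, of p] linear_extension_superset[OF B, of q]
    by (simp only: lookup_add TC sum.distrib Un_upper1 Un_upper2)
qed

lemma linear_extension_single: "linear_extension v (Poly_Mapping.single m k) = TC k * v m"
  by (simp add: linear_extension_def)

lemma linear_extension_zero [simp]: "linear_extension v 0 = 0"
  by (simp add: linear_extension_def)

lemma linear_extension_scale: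
  fixes p :: "('v \<Rightarrow>\<^sub>0 nat) \<Rightarrow>\<^sub>0 'k::field"
  shows "linear_extension v (Poly_Mapping.single 0 k * p) = TC k * linear_extension v p"
proof (induction p rule: poly_mapping_single_induct)
  case (single m a)
  have "TC (k * a) = TC k * TC a" by simp
  then show ?case by (simp only: mult_single linear_extension_single add_0 mult.assoc)
next
  case (add p q)
  then show ?case by (simp only: distrib_left linear_extension_add)
qed simp

lemma scalars_single: "scalars (Poly_Mapping.single 0 :: 'k::field \<Rightarrow> ('v \<Rightarrow>\<^sub>0 nat) \<Rightarrow>\<^sub>0 'k)"
  by unfold_locales (simp_all add: single_add mult_single)

type_synonym 'k dpoly = "(diamond \<Rightarrow>\<^sub>0 nat) \<Rightarrow>\<^sub>0 'k"

locale diamond =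
  fixes n :: nat
  assumes n3: "n \<ge> 3"
begin

definition ydeg :: "(diamond \<Rightarrow>\<^sub>0 nat) \<Rightarrow> nat"
  where "ydeg m = (\<Sum>i=1..n. Poly_Mapping.lookup m (elt_y i))"

definition ymixed :: "(diamond \<Rightarrow>\<^sub>0 nat) \<Rightarrow> bool"
  where "ymixed m \<longleftrightarrow> (\<exists>i\<in>{1..n}. \<exists>j\<in>{1..n}. i \<noteq> j \<and> Poly_Mapping.lookup m (elt_y i) > 0 \<and> Poly_Mapping.lookup m (elt_y j) > 0)"

definition trace_mon :: "(diamond \<Rightarrow>\<^sub>0 nat) \<Rightarrow> 'k::field poly2"
  where "trace_mon m = (if Poly_Mapping.keys m \<subseteq> diamond_lattice n
    then xz_trace (y_trace (ydeg m) (ymixed m)) (Poly_Mapping.lookup m elt_x) (Poly_Mapping.lookup m elt_z) else 0)"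

definition trace :: "'k::field dpoly \<Rightarrow> 'k poly2"
  where "trace = linear_extension trace_mon"

abbreviation mx :: "diamond \<Rightarrow>\<^sub>0 nat" where "mx \<equiv> Poly_Mapping.single elt_x (Suc 0)"
abbreviation mz :: "diamond \<Rightarrow>\<^sub>0 nat" where "mz \<equiv> Poly_Mapping.single elt_z (Suc 0)"
abbreviation my :: "nat \<Rightarrow> diamond \<Rightarrow>\<^sub>0 nat" where "my i \<equiv> Poly_Mapping.single (elt_y i) (Suc 0)"

lemma in_lattice: "elt_x \<in> diamond_lattice n" "elt_z \<in> diamond_lattice n" "i \<in> {1..n} \<Longrightarrow> elt_y i \<in> diamond_lattice n"
  by (auto simp: diamond_lattice_def)

lemma ydeg_simps: "ydeg (m + m') = ydeg m + ydeg m'" "ydeg mx = 0" "ydeg mz = 0"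
  "i \<in> {1..n} \<Longrightarrow> ydeg (my i) = 1"
proof -
  show "i \<in> {1..n} \<Longrightarrow> ydeg (my i) = 1"
    by (simp add: ydeg_def lookup_single when_def)
qed (simp_all add: ydeg_def lookup_add sum.distrib lookup_single)

lemma ymixed_mx_mz: "ymixed (mx + m) = ymixed m" "ymixed (mz + m) = ymixed m"
  by (simp_all add: ymixed_def lookup_add lookup_single)

lemma trace_mon_c: "trace_mon (mx + m) + trace_mon (mz + m) = TX * (trace_mon m :: 'k::field poly2)"
proof (cases "Poly_Mapping.keys m \<subseteq> diamond_lattice n")
  case True
  have "(trace_mon (mx + m) :: 'k poly2) = xz_trace (y_trace (ydeg m) (ymixed m)) (Suc (Poly_Mapping.lookup m elt_x)) (Poly_Mapping.lookup m elt_z)"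
    using True in_lattice by (simp add: trace_mon_def keys_add_nat ydeg_simps ymixed_mx_mz lookup_add lookup_single)
  moreover have "(trace_mon (mz + m) :: 'k poly2) = xz_trace (y_trace (ydeg m) (ymixed m)) (Poly_Mapping.lookup m elt_x) (Suc (Poly_Mapping.lookup m elt_z))"
    using True in_lattice by (simp add: trace_mon_def keys_add_nat ydeg_simps ymixed_mx_mz lookup_add lookup_single)
  ultimately show ?thesis using True by (simp only: xz_trace_TX trace_mon_def if_True)
next
  case False
  then show ?thesis by (simp add: trace_mon_def keys_add_nat)
qed

lemma trace_mon_xz:
  assumes "Poly_Mapping.keys m \<subseteq> diamond_lattice n"
  shows "(trace_mon (mx + mz + m) :: 'k::field poly2) =
    xz_trace (\<lambda>j. y_trace (ydeg m) (ymixed m) (Suc j)) (Poly_Mapping.lookup m elt_x) (Poly_Mapping.lookup m elt_z)"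
  using assms in_lattice
  by (simp add: trace_mon_def keys_add_nat ydeg_simps ymixed_mx_mz add.assoc lookup_add lookup_single xz_trace_Suc_Suc)

lemma trace_mon_yy:
  assumes ij: "i \<in> {1..n}" "j \<in> {1..n}"
    and m: "Poly_Mapping.keys m \<subseteq> diamond_lattice n"
  shows "(trace_mon (my i + my j + m) :: 'k::field poly2) =
    xz_trace (y_trace (ydeg m + 2) (ymixed (my i + my j + m))) (Poly_Mapping.lookup m elt_x) (Poly_Mapping.lookup m elt_z)"
  using assms in_lattice
  by (simp add: trace_mon_def keys_add_nat ydeg_simps add.assoc lookup_add lookup_single)

lemma trace_mon_relation:
  assumes ij: "i \<in> {1..n}" "j \<in> {1..n}" "i \<noteq> j"
  shows "(trace_mon (my i + my j + m) :: 'k::field poly2) = trace_mon (mx + mz + m)"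
proof (cases "Poly_Mapping.keys m \<subseteq> diamond_lattice n")
  case True
  have step: "(y_trace (ydeg m + 2) True :: nat \<Rightarrow> 'k poly2) = (\<lambda>j. y_trace (ydeg m) (ymixed m) (Suc j))"
    by (rule ext) (rule y_trace_mixed_step)
  have "ymixed (my i + my j + m)"
    unfolding ymixed_def
    by (rule bexI[OF _ ij(1)], rule bexI[OF _ ij(2)]) (simp add: ij(3) lookup_add lookup_single)
  then show ?thesis
    unfolding trace_mon_yy[OF ij(1,2) True] trace_mon_xz[OF True]
    by (simp only: step)
next
  case False
  then show ?thesis by (simp add: trace_mon_def keys_add_nat)
qed

lemma trace_mon_u:
  "(\<Sum>i=1..n. trace_mon (my i + my i + m)) - of_nat (n - 1) * trace_mon (mx + mz + m) = TU * (trace_mon m :: 'k::field poly2)"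
proof (cases "Poly_Mapping.keys m \<subseteq> diamond_lattice n")
  case True
  define bs where "bs i = ymixed (my i + my i + m)" for i
  let ?b = "ymixed m" and ?d = "ydeg m"
  have cases: "?d = 0 \<or> (?b \<and> ?d \<ge> 2 \<and> (\<forall>i\<in>{1..n}. bs i)) \<or> (\<not> ?b \<and> (\<exists>k\<in>{1..n}. \<forall>i\<in>{1..n}. bs i \<longleftrightarrow> i \<noteq> k))"
  proof (cases "?b")
    case b: True
    then obtain i j where ij: "i \<in> {1..n}" "j \<in> {1..n}" "i \<noteq> j" "Poly_Mapping.lookup m (elt_y i) > 0" "Poly_Mapping.lookup m (elt_y j) > 0"
      by (auto simp: ymixed_def)
    have "(\<Sum>k\<in>{i, j}. Poly_Mapping.lookup m (elt_y k)) \<le> ?d"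
      unfolding ydeg_def by (rule sum_mono2) (use ij in auto)
    then have "?d \<ge> 2" using ij by simp
    moreover have "bs k" for k
      unfolding bs_def ymixed_def
      by (intro bexI[OF _ ij(1)] bexI[OF _ ij(2)]) (simp add: ij(3-5) lookup_add)
    ultimately show ?thesis using b by blast
  next
    case b: False
    show ?thesis
    proof (cases "?d = 0")
      case False
      then obtain k where k: "k \<in> {1..n}" "Poly_Mapping.lookup m (elt_y k) > 0"
        unfolding ydeg_def by (metis (no_types, lifting) gr0I sum.neutral)
      have only: "Poly_Mapping.lookup m (elt_y i) = 0" if "i \<in> {1..n}" "i \<noteq> k" for i
      proof (rule ccontr)
        assume "Poly_Mapping.lookup m (elt_y i) \<noteq> 0"
        then have "ymixed m"
          unfolding ymixed_def by (intro bexI[OF _ that(1)] bexI[OF _ k(1)]) (simp add: that(2) k(2))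
        then show False using b by simp
      qed
      have "bs i \<longleftrightarrow> i \<noteq> k" if i: "i \<in> {1..n}" for i
      proof
        assume bsi: "bs i"
        have "l = k" if "l \<in> {1..n}" "Poly_Mapping.lookup (my k + my k + m) (elt_y l) > 0" for l
          using only[OF that(1)] that(2) by (cases "l = k") (auto simp: lookup_add lookup_single when_def)
        then show "i \<noteq> k" using bsi unfolding bs_def ymixed_def by metis
      next
        assume "i \<noteq> k"
        then show "bs i" unfolding bs_def ymixed_def
          by (intro bexI[OF _ i] bexI[OF _ k(1)]) (simp add: k(2) lookup_add lookup_single)
      qed
      then show ?thesis using b k(1) by blast
    qed simp
  qed
  have n1: "n \<ge> 1" using n3 by simp
  have "(\<Sum>i=1..n. trace_mon (my i + my i + m)) - of_nat (n - 1) * trace_mon (mx + mz + m) =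
    xz_trace (\<lambda>j. (\<Sum>i=1..n. y_trace (?d + 2) (bs i) j) - of_nat (n - 1) * (y_trace ?d ?b (Suc j) :: 'k poly2))
      (Poly_Mapping.lookup m elt_x) (Poly_Mapping.lookup m elt_z)"
    unfolding xz_trace_diff xz_trace_sum xz_trace_scale trace_mon_xz[OF True] bs_def
    by (simp add: trace_mon_yy[OF _ _ True])
  also have "\<dots> = TU * trace_mon m"
    unfolding y_trace_TU_step[OF n1 cases] xz_trace_scale using True by (simp only: trace_mon_def if_True)
  finally show ?thesis .
next
  case False
  then show ?thesis by (simp add: trace_mon_def keys_add_nat)
qed

end

section \<open>The coordinate ring of the diamond lattice\<close>

text \<open>
  The \<open>K[u, c]\<close>-submodule generated by the image of \<open>G\<close> under \<open>\<rho>\<close>, as a set of representatives.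
\<close>

inductive_set span_over :: "('k::field \<Rightarrow> 'p::comm_ring_1) \<Rightarrow> 'p \<Rightarrow> 'p \<Rightarrow> ('p \<Rightarrow> 'a) \<Rightarrow> 'p set \<Rightarrow> 'p set"
  for C c u \<rho> G
  where
    gen: "g \<in> G \<Longrightarrow> g \<in> span_over C c u \<rho> G"
  | add: "p \<in> span_over C c u \<rho> G \<Longrightarrow> q \<in> span_over C c u \<rho> G \<Longrightarrow> p + q \<in> span_over C c u \<rho> G"
  | scale: "p \<in> span_over C c u \<rho> G \<Longrightarrow> C k * p \<in> span_over C c u \<rho> G"
  | mult_c: "p \<in> span_over C c u \<rho> G \<Longrightarrow> c * p \<in> span_over C c u \<rho> G"
  | mult_u: "p \<in> span_over C c u \<rho> G \<Longrightarrow> u * p \<in> span_over C c u \<rho> G"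
  | cong: "p \<in> span_over C c u \<rho> G \<Longrightarrow> \<rho> q = \<rho> p \<Longrightarrow> q \<in> span_over C c u \<rho> G"

lemma polys_in_least:
  fixes T :: "(('v \<Rightarrow>\<^sub>0 nat) \<Rightarrow>\<^sub>0 'k::field) set"
  assumes "finite V" and T: "subring_of T" and "range (Poly_Mapping.single 0) \<subseteq> T" "pvar ` V \<subseteq> T"
  shows "polys_in V \<subseteq> T"
  using assms(1,4)
proof (induction V)
  case empty
  have "p \<in> T" if "p \<in> polys_in {}" for p :: "('v \<Rightarrow>\<^sub>0 nat) \<Rightarrow>\<^sub>0 'k"
  proof -
    have "Poly_Mapping.keys p \<subseteq> {0}" using that by (auto simp: polys_in_def)
    then have "p = Poly_Mapping.single 0 (Poly_Mapping.lookup p 0)"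
      by (intro poly_mapping_eqI) (auto simp: lookup_single when_def in_keys_iff)
    then show ?thesis using assms(3) by (metis rangeI subsetD)
  qed
  then show ?case by blast
next
  case (insert v V)
  then show ?case
    unfolding polys_in_insert by (intro adjoin_least subring_polys_in T) auto
qed

context diamond
begin

abbreviation V where "V \<equiv> diamond_lattice n"

abbreviation X :: "'k::field dpoly" where "X \<equiv> pvar elt_x"
abbreviation Z :: "'k::field dpoly" where "Z \<equiv> pvar elt_z"
abbreviation Y :: "nat \<Rightarrow> 'k::field dpoly" where "Y i \<equiv> pvar (elt_y i)"
abbreviation t :: "'k::field dpoly" where "t \<equiv> X * Z"

definition cpar :: "'k::field dpoly" where "cpar = X + Z"
definition upar :: "'k::field dpoly"
  where "upar = (\<Sum>i=1..n. Y i * Y i) - of_nat (n - 1) * t"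

lemma trace_add: "trace (p + q) = trace p + trace q"
  unfolding trace_def by (rule linear_extension_add)

lemma trace_zero [simp]: "trace 0 = 0"
  by (simp add: trace_def)

lemma trace_uminus: "trace (- p) = - trace p"
  using trace_add[of "- p" p] by (simp add: eq_neg_iff_add_eq_0)

lemma trace_diff: "trace (p - q) = trace p - trace q"
  using trace_add[of p "- q"] by (simp add: trace_uminus)

lemma trace_sum: "trace (sum f I) = (\<Sum>i\<in>I. trace (f i))"
  by (induction I rule: infinite_finite_induct) (simp_all add: trace_add)

lemma trace_of_nat: "trace (of_nat N * p) = of_nat N * trace p"
  by (induction N) (simp_all add: distrib_right trace_add)

lemma trace_scale: "trace (Poly_Mapping.single 0 k * p) = TC k * trace p"
  unfolding trace_def by (rule linear_extension_scale)

lemma trace_single: "trace (Poly_Mapping.single m k) = TC k * trace_mon m"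
  by (simp add: trace_def linear_extension_single)

lemma X_single: "X * Poly_Mapping.single m k = Poly_Mapping.single (mx + m) (k::'k::field)"
  and Z_single: "Z * Poly_Mapping.single m k = Poly_Mapping.single (mz + m) (k::'k::field)"
  and Y_single: "Y i * Poly_Mapping.single m k = Poly_Mapping.single (my i + m) (k::'k::field)"
  by (simp_all add: pvar_def mult_single)

lemma trace_cpar: "trace (cpar * p) = TX * trace p"
proof (induction p rule: poly_mapping_single_induct)
  case (single m k)
  show ?case
    unfolding cpar_def distrib_right trace_add X_single Z_single trace_single
    by (simp only: trace_mon_c[symmetric] distrib_left mult.left_commute[of TX])
next
  case (add p q)
  then show ?case by (simp only: distrib_left trace_add)
qed simp

lemma trace_upar: "trace (upar * p) = TU * trace p"
proof (induction p rule: poly_mapping_single_induct)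
  case (single m k)
  have "trace (upar * Poly_Mapping.single m k) =
      (\<Sum>i=1..n. TC k * trace_mon (my i + my i + m)) - of_nat (n - 1) * (TC k * trace_mon (mx + mz + m))"
    unfolding upar_def left_diff_distrib sum_distrib_right trace_diff trace_sum mult.assoc trace_of_nat
      X_single Z_single Y_single trace_single by (simp only: add.assoc)
  also have "\<dots> = TC k * ((\<Sum>i=1..n. trace_mon (my i + my i + m)) - of_nat (n - 1) * trace_mon (mx + mz + m))"
    by (simp only: right_diff_distrib sum_distrib_left mult.left_commute)
  also have "\<dots> = TU * trace (Poly_Mapping.single m k)"
    unfolding trace_mon_u trace_single by (rule mult.left_commute)
  finally show ?case .
next
  case (add p q)
  then show ?case by (simp only: distrib_left trace_add)
qed simp

lemma trace_relation:
  fixes p :: "'k::field dpoly"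
  assumes ij: "i \<in> {1..n}" "j \<in> {1..n}" "i \<noteq> j"
  shows "trace ((Y i * Y j - t) * p) = 0"
proof (induction p rule: poly_mapping_single_induct)
  case (single m k)
  show ?case
    unfolding left_diff_distrib trace_diff mult.assoc X_single Z_single Y_single trace_single
    using trace_mon_relation[OF ij, of m, where 'k = 'k] by (simp add: add.assoc)
next
  case (add p q)
  then show ?case by (simp only: distrib_left trace_add) simp
qed simp

text \<open>
  The variables \<open>y\<^sub>i\<close> of the type \<open>diamond\<close> do not stop at \<open>n\<close>. Setting the surplus variables to zero is a ring
  homomorphism onto the polynomial ring of the lattice, which makes \<open>S / I\<close> an image of the whole type.
\<close>

definition restr :: "'k::field dpoly \<Rightarrow> 'k dpoly"
  where "restr p = (\<Sum>m\<in>{m\<in>Poly_Mapping.keys p. Poly_Mapping.keys m \<subseteq> V}. Poly_Mapping.single m (Poly_Mapping.lookup p m))"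

lemma lookup_restr: "Poly_Mapping.lookup (restr p) m = (if Poly_Mapping.keys m \<subseteq> V then Poly_Mapping.lookup p m else 0)"
  unfolding restr_def by (auto simp: lookup_sum lookup_single when_def in_keys_iff)

lemma restr_add: "restr (p + q) = restr p + restr q"
  by (rule poly_mapping_eqI) (simp add: lookup_restr lookup_add)

lemma restr_zero [simp]: "restr 0 = 0"
  by (rule poly_mapping_eqI) (simp add: lookup_restr)

lemma restr_single: "restr (Poly_Mapping.single m k) = (if Poly_Mapping.keys m \<subseteq> V then Poly_Mapping.single m k else 0)"
  by (rule poly_mapping_eqI) (auto simp: lookup_restr lookup_single when_def)

lemma restr_mult: "restr (p * q) = restr p * restr q"
proof (induction p rule: poly_mapping_single_induct)
  case (single m k)
  show ?case
  proof (induction q rule: poly_mapping_single_induct)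
    case (single m' k')
    show ?case by (simp add: mult_single restr_single keys_add_nat)
  qed (simp_all add: distrib_left restr_add)
qed (simp_all add: distrib_right restr_add)

lemma restr_polys_in: "restr p \<in> polys_in V"
  unfolding polys_in_def
proof (intro CollectI ballI)
  show "Poly_Mapping.keys m \<subseteq> V" if "m \<in> Poly_Mapping.keys (restr p)" for m
    using that by (cases "Poly_Mapping.keys m \<subseteq> V") (simp_all add: in_keys_iff[of m] lookup_restr)
qed

lemma restr_id: "p \<in> polys_in V \<Longrightarrow> restr p = p"
  by (rule poly_mapping_eqI) (auto simp: lookup_restr polys_in_def not_in_keys_iff_lookup_eq_zero[symmetric])

lemma trace_restr: "trace (restr p) = trace p"
  by (induction p rule: poly_mapping_single_induct)
    (auto simp: restr_add trace_add restr_single trace_single trace_mon_def)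

abbreviation DR :: "'k::field dpoly ring" where "DR \<equiv> diamond_ring n"
abbreviation DI :: "'k::field dpoly set" where "DI \<equiv> diamond_ideal n"

lemma DR_simps: "carrier DR = polys_in V" "p \<oplus>\<^bsub>DR\<^esub> q = p + q" "p \<otimes>\<^bsub>DR\<^esub> q = p * q"
  "\<zero>\<^bsub>DR\<^esub> = 0" "\<one>\<^bsub>DR\<^esub> = 1"
  by (simp_all add: diamond_ring_def poly_ring_def polys_in_def)

lemma DR_cring: "cring (DR :: 'k::field dpoly ring)"
proof (intro cringI abelian_groupI comm_monoidI)
  note S = subring_ofD[OF subring_polys_in[of V, where 'k = 'k]]
  fix p assume "p \<in> carrier (DR :: 'k dpoly ring)"
  then show "\<exists>q\<in>carrier DR. q \<oplus>\<^bsub>DR\<^esub> p = \<zero>\<^bsub>DR\<^esub>"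
    by (intro bexI[of _ "- p"]) (simp_all add: DR_simps S)
qed (simp_all add: DR_simps subring_ofD[OF subring_polys_in] algebra_simps)

lemma pvar_polys_in: "v \<in> V \<Longrightarrow> pvar v \<in> polys_in V"
  by (simp add: polys_in_def pvar_def)

lemma generators_carrier:
  "{pvar (elt_y i) * pvar (elt_y j) - pvar elt_x * pvar elt_z | i j. 1 \<le> i \<and> i < j \<and> j \<le> n} \<subseteq> carrier DR"
proof -
  have "Y i * Y j - t \<in> polys_in V" if "1 \<le> i" "i < j" "j \<le> n" for i j
    using that in_lattice
    by (intro subring_ofD(3,4)[OF subring_polys_in] pvar_polys_in) auto
  then show ?thesis unfolding DR_simps by blast
qed

lemma DI_ideal: "ideal (DI :: 'k::field dpoly set) DR"
proof -
  interpret cring "DR :: 'k dpoly ring" by (rule DR_cring)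
  show ?thesis unfolding diamond_ideal_def by (rule genideal_ideal[OF generators_carrier])
qed

lemma relation_in_DI:
  assumes "i \<in> {1..n}" "j \<in> {1..n}" "i \<noteq> j"
  shows "(Y i * Y j - t :: 'k::field dpoly) \<in> DI"
proof -
  interpret cring "DR :: 'k dpoly ring" by (rule DR_cring)
  have *: "(Y i * Y j - t :: 'k dpoly) \<in> DI" if "1 \<le> i" "i < j" "j \<le> n" for i j
    unfolding diamond_ideal_def using genideal_self[OF generators_carrier] that by blast
  show ?thesis
    using *[of i j] *[of j i] assms by (cases "i < j") (auto simp: mult.commute)
qed

text \<open>
  The polynomials all of whose multiples have trace zero form an ideal that contains the generators.
\<close>

lemma trace_DI:
  assumes "(p :: 'k::field dpoly) \<in> DI"
  shows "trace (p * q) = 0"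
proof -
  interpret cring "DR :: 'k dpoly ring" by (rule DR_cring)
  let ?N = "{p \<in> polys_in V. \<forall>q. trace (p * q) = (0 :: 'k poly2)}"
  have "ideal ?N DR"
  proof (rule idealI_commutative)
    show "r \<otimes>\<^bsub>DR\<^esub> a \<in> ?N" if "a \<in> ?N" "r \<in> carrier DR" for a r
      using that subring_ofD(4)[OF subring_polys_in] by (auto simp: DR_simps mult.assoc mult.left_commute)
    show "a \<oplus>\<^bsub>DR\<^esub> b \<in> ?N" if "a \<in> ?N" "b \<in> ?N" for a b
      using that subring_ofD(6)[OF subring_polys_in] by (auto simp: DR_simps distrib_right trace_add)
  qed (auto simp: DR_simps subring_ofD[OF subring_polys_in])
  moreover have "{pvar (elt_y i) * pvar (elt_y j) - pvar elt_x * pvar elt_z | i j. 1 \<le> i \<and> i < j \<and> j \<le> n} \<subseteq> ?N"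
    using generators_carrier[where 'a = 'k] trace_relation[where 'k = 'k] by (auto simp: DR_simps)
  ultimately have "DI \<subseteq> ?N" unfolding diamond_ideal_def by (rule genideal_minimal)
  then show ?thesis using assms by blast
qed

abbreviation Q :: "'k::field dpoly set ring" where "Q \<equiv> DR Quot DI"

definition \<rho> :: "'k::field dpoly \<Rightarrow> 'k dpoly set"
  where "\<rho> p = DI +>\<^bsub>DR\<^esub> restr p"

lemma Q_cring: "cring (Q :: 'k::field dpoly set ring)"
  by (rule ideal.quotient_is_cring[OF DI_ideal DR_cring])

lemma \<rho>_hom:
  fixes p q :: "'k::field dpoly"
  shows "\<rho> (p + q) = \<rho> p \<oplus>\<^bsub>Q\<^esub> \<rho> q" "\<rho> (p * q) = \<rho> p \<otimes>\<^bsub>Q\<^esub> \<rho> q"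
    "\<rho> (1 :: 'k dpoly) = \<one>\<^bsub>Q\<^esub>"
proof -
  have h: "(+>\<^bsub>DR\<^esub>) DI \<in> ring_hom (DR :: 'k dpoly ring) Q" by (rule ideal.rcos_ring_hom[OF DI_ideal])
  show "\<rho> (p + q) = \<rho> p \<oplus>\<^bsub>Q\<^esub> \<rho> q"
    unfolding \<rho>_def restr_add using ring_hom_add[OF h, of "restr p" "restr q"] by (simp add: DR_simps restr_polys_in)
  show "\<rho> (p * q) = \<rho> p \<otimes>\<^bsub>Q\<^esub> \<rho> q"
    unfolding \<rho>_def restr_mult using ring_hom_mult[OF h, of "restr p" "restr q"] by (simp add: DR_simps restr_polys_in)
  have "restr 1 = (1 :: 'k dpoly)" using restr_single[of 0 "1 :: 'k"] by simp
  then show "\<rho> (1 :: 'k dpoly) = \<one>\<^bsub>Q\<^esub>"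
    unfolding \<rho>_def using ring_hom_one[OF h] by (simp add: DR_simps)
qed

lemma \<rho>_image:
  "\<rho> ` polys_in V = carrier (Q :: 'k::field dpoly set ring)"
  "range \<rho> = carrier (Q :: 'k::field dpoly set ring)"
proof -
  have c: "carrier (Q :: 'k dpoly set ring) = (\<lambda>p. DI +>\<^bsub>DR\<^esub> p) ` polys_in V"
    by (auto simp: FactRing_def A_RCOSETS_def' DR_simps)
  show *: "\<rho> ` polys_in V = carrier (Q :: 'k dpoly set ring)"
    unfolding c by (rule image_cong) (simp_all add: \<rho>_def restr_id)
  have "\<rho> p \<in> carrier Q" for p :: "'k dpoly"
    unfolding c \<rho>_def using restr_polys_in[of p] by blast
  then show "range \<rho> = carrier (Q :: 'k dpoly set ring)"
    using * by blast
qed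

lemma \<rho>_eq_zero_iff:
  fixes p :: "'k::field dpoly"
  shows "\<rho> p = \<zero>\<^bsub>Q\<^esub> \<longleftrightarrow> restr p \<in> DI"
proof -
  interpret I: ideal DI "DR :: 'k dpoly ring" by (rule DI_ideal)
  have z: "\<zero>\<^bsub>Q\<^esub> = (DI :: 'k dpoly set)" by (simp add: FactRing_def)
  show ?thesis
    unfolding z \<rho>_def using I.rcos_const_imp_mem[of "restr p"] I.a_rcos_const[of "restr p"]
    by (auto simp: DR_simps restr_polys_in)
qed

lemma trace_ker: "\<rho> p = \<zero>\<^bsub>Q\<^esub> \<Longrightarrow> trace (p :: 'k::field dpoly) = 0"
  using trace_DI[of "restr p" 1] by (simp add: \<rho>_eq_zero_iff trace_restr)

end

section \<open>Generators and dual generators over the parameters\<close>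

text \<open>
  Fixing the field makes all statements of this context refer to the same polynomial type.
\<close>

locale diamond_over = diamond n for n :: nat +
  fixes field_type :: "'k::field itself"
begin

abbreviation rr :: "'k dpoly \<Rightarrow> 'k dpoly set"
  where "rr \<equiv> \<rho>"

abbreviation QQ :: "'k dpoly set ring" where "QQ \<equiv> Q"

interpretation Q: cring QQ by (rule Q_cring)

lemma rr_closed [simp]: "rr p \<in> carrier QQ"
  using \<rho>_image(2) by blast

lemma rr_add: "rr p = rr p' \<Longrightarrow> rr q = rr q' \<Longrightarrow> rr (p + q) = rr (p' + q')"
  by (simp add: \<rho>_hom)

lemma rr_mult: "rr p = rr p' \<Longrightarrow> rr q = rr q' \<Longrightarrow> rr (p * q) = rr (p' * q')"
  by (simp add: \<rho>_hom)

lemma rr_diff: "rr p = rr p' \<Longrightarrow> rr q = rr q' \<Longrightarrow> rr (p - q) = rr (p' - q')"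
  using rr_add[of p p' "- 1 * q" "- 1 * q'"] rr_mult[of "- 1" "- 1" q q'] by simp

lemma rr_sum: "(\<And>i. i \<in> I \<Longrightarrow> rr (f i) = rr (g i)) \<Longrightarrow> rr (sum f I) = rr (sum g I)"
  by (induction I rule: infinite_finite_induct) (simp_all add: \<rho>_hom(1))

lemma rr_eq_iff: "rr p = rr q \<longleftrightarrow> rr (p - q) = rr 0"
  using rr_diff[of p q q q] rr_add[of "p - q" 0 q q] by (metis add_0 cancel_comm_monoid_add_class.diff_cancel diff_add_cancel)

lemma rr_zero: "rr 0 = \<zero>\<^bsub>QQ\<^esub>"
  using \<rho>_hom(1)[of "0 :: 'k dpoly" 0] by simp

definition W :: "nat \<Rightarrow> 'k dpoly"
  where "W i = t - Y i * Y i"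

lemma rr_yy:
  assumes "i \<in> {1..n}" "j \<in> {1..n}" "i \<noteq> j"
  shows "rr (Y i * Y j) = rr t"
proof -
  have p: "(Y i * Y j - t :: 'k dpoly) \<in> polys_in V"
    using assms in_lattice by (intro subring_ofD(3,4)[OF subring_polys_in] pvar_polys_in) auto
  show ?thesis
    unfolding rr_eq_iff[of _ t] rr_zero \<rho>_eq_zero_iff restr_id[OF p] by (rule relation_in_DI[OF assms])
qed

lemma other_index: "\<exists>m\<in>{1..n}. m \<noteq> k \<and> m \<noteq> l"
proof -
  have "card {k, l} \<le> 2" by (simp add: card_insert_if)
  moreover have "card {1..n} \<ge> 3" using n3 by simp
  ultimately have "\<not> {1..n} \<subseteq> {k, l}" using card_mono[of "{k, l}" "{1..n}"] by auto
  then show ?thesis by blast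
qed

text \<open>
  With a third index \<open>m\<close> both sides are equal to the product of \<open>y\<^sub>k\<close>, \<open>y\<^sub>l\<close> and \<open>y\<^sub>m\<close>. Here \<open>n \<ge> 3\<close> is essential.
\<close>

lemma rr_yt:
  assumes k: "k \<in> {1..n}" and l: "l \<in> {1..n}"
  shows "rr (Y k * t) = rr (Y l * t)"
proof (cases "k = l")
  case False
  obtain m where m: "m \<in> {1..n}" "m \<noteq> k" "m \<noteq> l" using other_index by blast
  have "rr (Y k * t) = rr (Y k * (Y l * Y m))" by (rule rr_mult[OF refl rr_yy[symmetric]]) (use l m in auto)
  also have "Y k * (Y l * Y m) = Y l * (Y k * Y m :: 'k dpoly)" by (rule mult.left_commute)
  also have "rr (Y l * (Y k * Y m)) = rr (Y l * t)" by (rule rr_mult[OF refl rr_yy]) (use k m in auto)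
  finally show ?thesis .
qed simp

lemma rr_yW:
  assumes i: "i \<in> {1..n}" and k: "k \<in> {1..n}" "k \<noteq> i"
  shows "rr (Y k * W i) = rr 0"
proof -
  have "rr (Y k * W i) = rr (Y k * t - Y i * (Y i * Y k))" by (simp add: W_def algebra_simps)
  also have "\<dots> = rr (Y k * t - Y i * t)"
    by (rule rr_diff[OF refl rr_mult[OF refl rr_yy]]) (use i k in auto)
  also have "\<dots> = rr 0" using rr_yt[OF k(1) i] by (subst rr_eq_iff[symmetric]) simp
  finally show ?thesis .
qed

lemma rr_uy:
  assumes k: "k \<in> {1..n}"
  shows "rr (upar * Y k) = rr (Y k * (Y k * Y k))"
proof -
  let ?s = "\<lambda>i. if i = k then Y k * (Y k * Y k) else Y k * t :: 'k dpoly"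
  have "rr (Y i * Y i * Y k) = rr (?s i)" if i: "i \<in> {1..n}" for i
  proof (cases "i = k")
    case False
    have "rr (Y i * (Y i * Y k)) = rr (Y i * t)" by (rule rr_mult[OF refl rr_yy]) (use i k False in auto)
    then show ?thesis using False rr_yt[OF i k] by (simp add: mult.assoc)
  qed (simp add: mult.assoc)
  then have "rr ((\<Sum>i=1..n. Y i * Y i * Y k) - of_nat (n - 1) * t * Y k) = rr ((\<Sum>i=1..n. ?s i) - of_nat (n - 1) * t * Y k)"
    by (intro rr_diff rr_sum) auto
  also have "(\<Sum>i=1..n. ?s i) = Y k * (Y k * Y k) + of_nat (n - 1) * (Y k * t)"
    using k by (subst sum.remove[of _ k]) auto
  also have "Y k * (Y k * Y k) + of_nat (n - 1) * (Y k * t) - of_nat (n - 1) * t * Y k = (Y k * (Y k * Y k) :: 'k dpoly)"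
    by (simp only: mult.commute[of "Y k" t] mult.assoc) simp
  also have "(\<Sum>i=1..n. Y i * Y i * Y k) - of_nat (n - 1) * t * Y k = (upar * Y k :: 'k dpoly)"
    by (simp only: upar_def left_diff_distrib sum_distrib_right)
  finally show ?thesis .
qed

lemma rr_yyt:
  assumes i: "i \<in> {1..n}"
  shows "rr (Y i * Y i * t) = rr (t * t)"
proof -
  obtain l where l: "l \<in> {1..n}" "l \<noteq> i" using other_index by blast
  have "rr (Y i * (Y i * t)) = rr (Y i * (Y l * t))" by (rule rr_mult[OF refl rr_yt[OF i l(1)]])
  also have "\<dots> = rr (Y i * Y l * t)" by (simp add: mult.assoc)
  also have "\<dots> = rr (t * t)" by (rule rr_mult[OF rr_yy refl]) (use i l in auto)
  finally show ?thesis by (simp add: mult.assoc)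
qed

lemma rr_ut: "rr (upar * t) = rr (t * t)"
proof -
  have "rr ((\<Sum>i=1..n. Y i * Y i * t) - of_nat (n - 1) * (t * t)) = rr ((\<Sum>i=1..n. t * t) - of_nat (n - 1) * (t * t))"
    by (intro rr_diff rr_sum rr_yyt) auto
  also have "(\<Sum>i=1..n. t * t) = (of_nat n :: 'k dpoly) * (t * t)" by simp
  also have "of_nat n = (of_nat (n - 1) + 1 :: 'k dpoly)"
    using n3 by (metis Suc_diff_1 add.commute less_le_trans of_nat_Suc zero_less_numeral)
  finally show ?thesis
    by (simp add: upar_def left_diff_distrib distrib_right sum_distrib_right mult.assoc)
qed

text \<open>
  Generators of \<open>B\<close> over \<open>K[u]\<close>, hence of \<open>B[c]\<close> over \<open>K[u, c]\<close>.
\<close>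

definition gens :: "'k dpoly set"
  where "gens = {1, t * Y 1} \<union> Y ` {1..n} \<union> W ` {1..n}"

text \<open>
  Representatives of \<open>B[c]\<close>, over which \<open>A\<close> has the basis \<open>1, x\<close>.
\<close>

abbreviation Bc where "Bc \<equiv> span_over (Poly_Mapping.single 0) cpar upar rr gens"

lemma B_gens: "1 \<in> Bc" "t * Y 1 \<in> Bc" "i \<in> {1..n} \<Longrightarrow> Y i \<in> Bc" "i \<in> {1..n} \<Longrightarrow> W i \<in> Bc"
  by (rule span_over.gen, simp add: gens_def)+

lemma B_uminus:
  assumes "p \<in> Bc"
  shows "- p \<in> Bc"
proof -
  have "Poly_Mapping.single 0 (- 1) * p \<in> Bc" by (rule span_over.scale[OF assms])
  then show ?thesis by (simp add: single_uminus)
qed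

lemma B_diff:
  assumes "p \<in> Bc" "q \<in> Bc"
  shows "p - q \<in> Bc"
  using span_over.add[OF assms(1) B_uminus[OF assms(2)]] by simp

lemma B_zero: "0 \<in> Bc"
  using B_diff[OF B_gens(1) B_gens(1)] by simp

lemma B_sum: "(\<And>i. i \<in> I \<Longrightarrow> f i \<in> Bc) \<Longrightarrow> sum f I \<in> Bc"
  by (induction I rule: infinite_finite_induct) (auto intro: B_zero span_over.add)

lemma B_t: "t \<in> Bc"
proof -
  have "(\<Sum>i=1..n. W i) = of_nat n * t - (\<Sum>i=1..n. Y i * Y i)"
    by (simp add: W_def sum_subtractf)
  moreover have "(of_nat n :: 'k dpoly) = of_nat (n - 1) + 1"
    using n3 by (metis Suc_diff_1 add.commute less_le_trans of_nat_Suc zero_less_numeral)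
  ultimately have "t = upar * 1 + (\<Sum>i=1..n. W i)"
    by (simp add: upar_def distrib_right)
  moreover have "upar * 1 + (\<Sum>i=1..n. W i) \<in> Bc"
    by (intro span_over.add span_over.mult_u B_gens B_sum)
  ultimately show ?thesis by simp
qed

text \<open>
  This makes \<open>Bc\<close> all of \<open>B[c]\<close>. Modulo the ideal, the products of \<open>y\<^sub>k\<close> with the generators are
  \<open>y\<^sub>k\<^sup>2 = t - w\<^sub>k\<close>, \<open>y\<^sub>k y\<^sub>i = t\<close>, \<open>y\<^sub>k w\<^sub>i = 0\<close>, \<open>y\<^sub>k w\<^sub>k = t y\<^sub>1 - u y\<^sub>k\<close> and \<open>y\<^sub>k t y\<^sub>1 = u t\<close>,
  where \<open>i \<noteq> k\<close>, \<open>w\<^sub>i\<close> is \<open>W i\<close>, and \<open>t = u + \<Sum>\<^sub>i w\<^sub>i\<close>.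
\<close>

lemma B_y_mult:
  assumes k: "k \<in> {1..n}" and p: "p \<in> Bc"
  shows "Y k * p \<in> Bc"
  using p
proof induction
  case (gen g)
  have one: "1 \<in> {1..n}" using n3 by auto
  consider "g = 1" | "g = t * Y 1" | i where "i \<in> {1..n}" "g = Y i" | i where "i \<in> {1..n}" "g = W i"
    using gen by (auto simp: gens_def)
  then show ?case
  proof cases
    case 1
    then show ?thesis using B_gens(3)[OF k] by simp
  next
    case 2
    have "rr (Y k * (Y 1 * t)) = rr (Y k * (Y k * t))" by (rule rr_mult[OF refl rr_yt[OF one k]])
    also have "\<dots> = rr (upar * t)" using rr_yyt[OF k] rr_ut by (simp add: mult.assoc)
    finally have "rr (Y k * g) = rr (upar * t)" by (simp add: 2 mult.commute)
    then show ?thesis by (rule span_over.cong[OF span_over.mult_u[OF B_t]])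
  next
    case (3 i)
    show ?thesis
    proof (cases "i = k")
      case True
      have "Y k * g = t - W k" using 3 True by (simp add: W_def)
      then show ?thesis using B_diff[OF B_t B_gens(4)[OF k]] by simp
    next
      case False
      then have "rr (Y k * g) = rr t" using 3 rr_yy[OF k, of i] by simp
      then show ?thesis by (rule span_over.cong[OF B_t])
    qed
  next
    case (4 i)
    show ?thesis
    proof (cases "i = k")
      case True
      have "rr (Y k * g) = rr (Y k * t - Y k * (Y k * Y k))" unfolding 4(2) True W_def by (simp only: right_diff_distrib)
      also have "\<dots> = rr (Y 1 * t - upar * Y k)" by (rule rr_diff[OF rr_yt[OF k one] rr_uy[OF k, symmetric]])
      finally show ?thesis
        by (rule span_over.cong[rotated]) (use B_diff[OF B_gens(2) span_over.mult_u[OF B_gens(3)[OF k]]] in \<open>simp add: mult.commute\<close>)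
    next
      case False
      then have "rr (Y k * g) = rr 0" using 4 rr_yW[of i k] k by simp
      then show ?thesis by (rule span_over.cong[OF B_zero])
    qed
  qed
next
  case (add p q)
  then show ?case using span_over.add by (simp add: distrib_left)
next
  case (scale p a)
  then show ?case using span_over.scale by (subst mult.left_commute)
next
  case (mult_c p)
  then show ?case using span_over.mult_c by (subst mult.left_commute)
next
  case (mult_u p)
  then show ?case using span_over.mult_u by (subst mult.left_commute)
next
  case (cong p q)
  then show ?case using span_over.cong[OF cong(3) rr_mult[OF refl cong(2)]] by simp
qed

lemma B_t_mult:
  assumes p: "p \<in> Bc"
  shows "t * p \<in> Bc"
proof -
  have i: "1 \<in> {1..n}" "2 \<in> {1..n}" using n3 by auto
  have "Y 1 * (Y 2 * p) \<in> Bc" by (intro B_y_mult i p)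
  moreover have "rr (t * p) = rr (Y 1 * Y 2 * p)" by (rule rr_mult[OF rr_yy[symmetric] refl]) (use i in auto)
  ultimately show ?thesis using span_over.cong by (metis mult.assoc)
qed

text \<open>
  The set \<open>Bc + x Bc\<close> is closed under multiplication by \<open>x\<close> and \<open>z\<close> because
  \<open>x (a + x b) = - t b + x (a + c b)\<close> and \<open>z (a + x b) = (c a + t b) - x a\<close>.
\<close>

definition N :: "'k dpoly set"
  where "N = {p. \<exists>a\<in>Bc. \<exists>b\<in>Bc. rr p = rr (a + X * b)}"

lemma NI: "a \<in> Bc \<Longrightarrow> b \<in> Bc \<Longrightarrow> rr p = rr (a + X * b) \<Longrightarrow> p \<in> N"
  unfolding N_def by blast

lemma N_mult:
  assumes v: "v \<in> V" and p: "p \<in> N"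
  shows "pvar v * p \<in> N"
proof -
  obtain a b where ab: "a \<in> Bc" "b \<in> Bc" "rr p = rr (a + X * b)" using p unfolding N_def by blast
  note r = rr_mult[OF refl ab(3), of "pvar v"]
  consider "v = elt_x" | "v = elt_z" | k where "k \<in> {1..n}" "v = elt_y k"
    using v by (auto simp: diamond_lattice_def)
  then show ?thesis
  proof cases
    case 1
    have "pvar v * (a + X * b) = - (t * b) + X * (a + cpar * b)"
      unfolding 1 by (simp add: cpar_def algebra_simps)
    then show ?thesis
      using r ab(1,2) by (intro NI[of "- (t * b)" "a + cpar * b"]) (auto intro: B_uminus B_t_mult span_over.intros)
  next
    case 2
    have "pvar v * (a + X * b) = (cpar * a + t * b) + X * (- a)"
      unfolding 2 by (simp add: cpar_def algebra_simps)
    then show ?thesis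
      using r ab(1,2) by (intro NI[of "cpar * a + t * b" "- a"]) (auto intro: B_uminus B_t_mult span_over.intros)
  next
    case (3 k)
    have "pvar v * (a + X * b) = Y k * a + X * (Y k * b)"
      unfolding 3 by (simp add: algebra_simps)
    then show ?thesis
      using r ab(1,2) B_y_mult[OF 3(1)] by (intro NI[of "Y k * a" "Y k * b"]) auto
  qed
qed

lemma N_all: "p \<in> N"
proof -
  have add: "p + q \<in> N" if p: "p \<in> N" and q: "q \<in> N" for p q
  proof -
    obtain a b where ab: "a \<in> Bc" "b \<in> Bc" "rr p = rr (a + X * b)" using p unfolding N_def by blast
    obtain a' b' where ab': "a' \<in> Bc" "b' \<in> Bc" "rr q = rr (a' + X * b')" using q unfolding N_def by blast
    show ?thesis
      using rr_add[OF ab(3) ab'(3)] ab ab'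
      by (intro NI[of "a + a'" "b + b'"]) (auto intro: span_over.add simp: algebra_simps)
  qed
  have scale: "Poly_Mapping.single 0 k * p \<in> N" if p: "p \<in> N" for p k
  proof -
    obtain a b where ab: "a \<in> Bc" "b \<in> Bc" "rr p = rr (a + X * b)" using p unfolding N_def by blast
    have "Poly_Mapping.single 0 k * (a + X * b) = Poly_Mapping.single 0 k * a + X * (Poly_Mapping.single 0 k * b)"
      by (simp only: distrib_left mult.left_commute)
    then show ?thesis
      using rr_mult[OF refl ab(3), of "Poly_Mapping.single 0 k"]
      by (intro NI[OF span_over.scale[OF ab(1)] span_over.scale[OF ab(2)]]) simp
  qed
  have minus: "p - q \<in> N" if "p \<in> N" "q \<in> N" for p q
    using add[OF that(1) scale[OF that(2), of "- 1"]] by (simp add: single_uminus)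
  let ?T = "{q. \<forall>p\<in>N. q * p \<in> N}"
  have "polys_in V \<subseteq> ?T"
  proof (rule polys_in_least)
    show "finite V" by (simp add: diamond_lattice_def)
    show "subring_of ?T"
      unfolding subring_of_def by (auto simp: left_diff_distrib mult.assoc intro: minus)
  qed (auto intro: scale N_mult)
  moreover have one: "1 \<in> N" by (rule NI[OF B_gens(1) B_zero]) simp
  ultimately have "restr p \<in> N" using restr_polys_in[of p] by fastforce
  moreover have "rr (restr p) = rr p" by (simp add: \<rho>_def restr_id[OF restr_polys_in])
  ultimately show ?thesis unfolding N_def by simp
qed


text \<open>
  The trace pairing of the generators is computed by expanding all products into these monomials.
\<close>

definition ymon :: "nat \<Rightarrow> nat list \<Rightarrow> 'k dpoly"
  where "ymon a ks = t ^ a * prod_list (map Y ks)"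

lemma ymon_mult: "ymon a ks * ymon b ls = ymon (a + b) (ks @ ls)"
  by (simp add: ymon_def power_add mult.assoc mult.left_commute)

lemma ymon_single:
  assumes "set ks \<subseteq> {1..n}"
  shows "\<exists>m. ymon a ks = Poly_Mapping.single m 1 \<and> Poly_Mapping.keys m \<subseteq> V \<and>
    Poly_Mapping.lookup m elt_x = a \<and> Poly_Mapping.lookup m elt_z = a \<and>
    (\<forall>i. Poly_Mapping.lookup m (elt_y i) = count_list ks i)"
  using assms
proof (induction ks)
  case Nil
  show ?case
  proof (induction a)
    case 0
    show ?case by (rule exI[of _ 0]) (simp add: ymon_def)
  next
    case (Suc a)
    then obtain m where m: "ymon a [] = Poly_Mapping.single m 1" "Poly_Mapping.keys m \<subseteq> V"
      "Poly_Mapping.lookup m elt_x = a" "Poly_Mapping.lookup m elt_z = a"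
      "\<forall>i. Poly_Mapping.lookup m (elt_y i) = 0" by auto
    have "ymon (Suc a) [] = t * ymon a []" by (simp add: ymon_def)
    also have "\<dots> = Poly_Mapping.single (mx + (mz + m)) 1"
      unfolding m(1) mult.assoc X_single Z_single ..
    finally show ?case
      using m(2-5) in_lattice
      by (intro exI[of _ "mx + (mz + m)"]) (simp add: keys_add_nat lookup_add lookup_single)
  qed
next
  case (Cons k ks)
  then obtain m where m: "ymon a ks = Poly_Mapping.single m 1" "Poly_Mapping.keys m \<subseteq> V"
    "Poly_Mapping.lookup m elt_x = a" "Poly_Mapping.lookup m elt_z = a"
    "\<forall>i. Poly_Mapping.lookup m (elt_y i) = count_list ks i" by auto
  have "ymon a (k # ks) = Y k * ymon a ks" by (simp add: ymon_def mult.left_commute)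
  also have "\<dots> = Poly_Mapping.single (my k + m) 1" unfolding m(1) Y_single ..
  finally show ?case
    using m(2-5) in_lattice(3)[of k] Cons.prems
    by (intro exI[of _ "my k + m"]) (simp add: keys_add_nat lookup_add lookup_single when_def)
qed

definition distinct_letters :: "nat list \<Rightarrow> bool"
  where "distinct_letters ks \<longleftrightarrow> (\<exists>a\<in>set ks. \<exists>b\<in>set ks. a \<noteq> b)"

lemma trace_ymon:
  assumes ks: "set ks \<subseteq> {1..n}"
  shows "trace (X * ymon a ks) = y_trace (length ks) (distinct_letters ks) a"
    "trace (Z * ymon a ks) = - trace (X * ymon a ks)" "trace (ymon a ks) = 0"
proof -
  obtain m where m: "ymon a ks = Poly_Mapping.single m 1" "Poly_Mapping.keys m \<subseteq> V"
    "Poly_Mapping.lookup m elt_x = a" "Poly_Mapping.lookup m elt_z = a"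
    "\<forall>i. Poly_Mapping.lookup m (elt_y i) = count_list ks i" using ymon_single[OF ks] by blast
  have d: "ydeg m = length ks"
    unfolding ydeg_def using m(5) sum_count_set[OF ks] by simp
  have b: "ymixed m = distinct_letters ks"
    unfolding ymixed_def distinct_letters_def using m(5) ks by (auto simp: count_list_0_iff neq0_conv[symmetric] simp del: neq0_conv)
  have TC: "TC 1 * \<tau> = \<tau>" for \<tau> :: "'k poly2" by (simp add: one_pCons[symmetric])
  have 1: "trace (X * ymon a ks) = xz_trace (y_trace (length ks) (distinct_letters ks)) (Suc a) a"
    unfolding m(1) X_single trace_single TC
    using m(2-4) in_lattice d b
    by (simp add: trace_mon_def keys_add_nat ydeg_simps ymixed_mx_mz lookup_add lookup_single)
  have 2: "trace (Z * ymon a ks) = xz_trace (y_trace (length ks) (distinct_letters ks)) a (Suc a)"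
    unfolding m(1) Z_single trace_single TC
    using m(2-4) in_lattice d b
    by (simp add: trace_mon_def keys_add_nat ydeg_simps ymixed_mx_mz lookup_add lookup_single)
  show "trace (X * ymon a ks) = y_trace (length ks) (distinct_letters ks) a" unfolding 1 by (simp add: xz_trace_def)
  show "trace (Z * ymon a ks) = - trace (X * ymon a ks)" unfolding 1 2 by (simp add: xz_trace_def)
  show "trace (ymon a ks) = 0"
    unfolding m(1) trace_single TC using m(2-4) by (simp add: trace_mon_def xz_trace_def)
qed

definition basis_elt :: "nat \<Rightarrow> 'k dpoly"
  where "basis_elt i = (if i = 0 then 1 else if i \<le> n then Y i else if i \<le> 2 * n then W (i - n) else t * Y 1)"

definition dual_elt :: "nat \<Rightarrow> 'k dpoly"
  where "dual_elt i = (if i = 0 then t * Y 1 else if i \<le> n then W i else if i \<le> 2 * n then Y (i - n) else 1)"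

text \<open>
  What holds for polynomials \<open>p\<close> in \<open>t\<close> and the \<open>y\<^sub>i\<close>, on which the trace vanishes. These
  equations make \<open>1, x\<close> and \<open>- z, 1\<close> dual to each other.
\<close>

definition balanced :: "'k dpoly \<Rightarrow> bool"
  where "balanced p \<longleftrightarrow> trace p = (0 :: 'k poly2) \<and> trace (t * p) = (0 :: 'k poly2) \<and> trace (Z * p) = (- trace (X * p) :: 'k poly2)"

lemma balanced_ymon: "set ks \<subseteq> {1..n} \<Longrightarrow> balanced (ymon a ks)"
proof -
  assume ks: "set ks \<subseteq> {1..n}"
  have "t * ymon a ks = ymon (Suc a) ks" by (simp add: ymon_def mult.assoc)
  then show ?thesis using trace_ymon[OF ks] by (simp add: balanced_def)
qed

lemma balanced_diff: "balanced p \<Longrightarrow> balanced q \<Longrightarrow> balanced (p - q)"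
  by (simp add: balanced_def right_diff_distrib trace_diff)

text \<open>
  Since \<open>trace (X * p)\<close> is zero unless the degree of \<open>p\<close> in the \<open>y\<^sub>i\<close> is odd, only few products matter. They are
  \<open>y\<^sub>j w\<^sub>i = t y\<^sub>j - y\<^sub>j y\<^sub>i\<^sup>2\<close>, whose terms both have value \<open>1\<close> for \<open>i \<noteq> j\<close>, whereas \<open>y\<^sub>j\<^sup>3\<close> has value \<open>0\<close>;
  \<open>w\<^sub>j t y\<^sub>1\<close>, whose two terms have the same value; \<open>t y\<^sub>1\<close> with value \<open>1\<close>; and \<open>y\<^sub>j\<close> with value \<open>0\<close>.
\<close>

lemma basis_dual_pairing:
  assumes i: "i \<le> 2 * n + 1" and j: "j \<le> 2 * n + 1"
  shows "balanced (basis_elt j * dual_elt i) \<and> trace (X * (basis_elt j * dual_elt i)) = (if i = j then 1 else (0 :: 'k poly2))"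
proof -
  have one: "1 \<in> {1..n}" using n3 by auto
  have basis_elt: "basis_elt 0 = ymon 0 []" "k \<in> {1..n} \<Longrightarrow> basis_elt k = ymon 0 [k]"
    "k \<in> {1..n} \<Longrightarrow> basis_elt (n + k) = ymon 1 [] - ymon 0 [k, k]" "basis_elt (Suc (2 * n)) = ymon 1 [1]" for k
    by (auto simp: basis_elt_def ymon_def W_def)
  have dual_elt: "dual_elt 0 = ymon 1 [1]" "k \<in> {1..n} \<Longrightarrow> dual_elt k = ymon 1 [] - ymon 0 [k, k]"
    "k \<in> {1..n} \<Longrightarrow> dual_elt (n + k) = ymon 0 [k]" "dual_elt (Suc (2 * n)) = ymon 0 []" for k
    by (auto simp: dual_elt_def ymon_def W_def)
  note expand = left_diff_distrib right_diff_distrib ymon_mult trace_diff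
  have cases: "l = 0 \<or> l \<in> {1..n} \<or> (\<exists>k\<in>{1..n}. l = n + k) \<or> l = 2 * n + 1" if "l \<le> 2 * n + 1" for l
  proof -
    have "\<exists>k\<in>{1..n}. l = n + k" if "n < l" "l \<le> 2 * n" by (rule bexI[of _ "l - n"]) (use that in auto)
    then show ?thesis using that by fastforce
  qed
  have bal: "balanced (basis_elt j * dual_elt i)"
    using cases[OF i] cases[OF j]
    by (elim disjE bexE) (use one in \<open>simp_all add: basis_elt dual_elt expand balanced_diff balanced_ymon\<close>)
  have tr: "trace (X * (basis_elt j * dual_elt i)) = (if i = j then 1 else (0 :: 'k poly2))"
    using cases[OF i] cases[OF j]
    by (elim disjE bexE) (use one in \<open>simp_all add: basis_elt dual_elt expand trace_ymon(1) y_trace_def distinct_letters_def\<close>)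
  show ?thesis using bal tr by blast
qed

end

section \<open>The coordinate ring as a Frobenius algebra\<close>

lemma sum_times_bool: "sum f (A \<times> (UNIV :: bool set)) = (\<Sum>i\<in>A. f (i, False) + f (i, True))"
proof -
  have "sum f (A \<times> (UNIV :: bool set)) = (\<Sum>i\<in>A. \<Sum>s\<in>(UNIV :: bool set). f (i, s))"
    unfolding sum.cartesian_product by simp
  then show ?thesis by (simp add: UNIV_bool)
qed

context diamond_over
begin

interpretation S: scalars "Poly_Mapping.single (0 :: diamond \<Rightarrow>\<^sub>0 nat) :: 'k \<Rightarrow> _"
  by (rule scalars_single)

abbreviation ev :: "'k poly2 \<Rightarrow> 'k dpoly"
  where "ev \<equiv> eval2 (Poly_Mapping.single 0) cpar upar"

text \<open>
  The right-hand side of the dual basis identity. It is linear over \<open>K[u, c]\<close> and depends only on the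
  class of \<open>p\<close>, so that the identity has to be checked on generators only.
\<close>

definition expansion :: "'k dpoly \<Rightarrow> 'k dpoly"
  where "expansion p = (\<Sum>i\<le>2 * n + 1. ev (trace (p * - (Z * dual_elt i))) * basis_elt i + ev (trace (p * dual_elt i)) * (X * basis_elt i))"

lemma expansion_add: "expansion (p + q) = expansion p + expansion q"
  unfolding expansion_def distrib_right trace_add S.eval2_add sum.distrib[symmetric]
  by (intro sum.cong refl) (simp only: algebra_simps)

lemma expansion_scale: "expansion (Poly_Mapping.single 0 k * p) = Poly_Mapping.single 0 k * expansion p"
  unfolding expansion_def mult.assoc trace_scale S.eval2_TC_mult sum_distrib_left
  by (simp only: distrib_left)

lemma expansion_cpar: "expansion (cpar * p) = cpar * expansion p"
  unfolding expansion_def mult.assoc trace_cpar S.eval2_TX sum_distrib_left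
  by (simp only: distrib_left)

lemma expansion_upar: "expansion (upar * p) = upar * expansion p"
  unfolding expansion_def mult.assoc trace_upar S.eval2_TU sum_distrib_left
  by (simp only: distrib_left)

lemma trace_cong:
  assumes "rr p = rr q"
  shows "trace p = (trace q :: 'k poly2)"
proof -
  have "rr (p - q) = \<zero>\<^bsub>QQ\<^esub>" using assms rr_eq_iff rr_zero by metis
  then have "trace (p - q) = (0 :: 'k poly2)" by (rule trace_ker)
  then show ?thesis unfolding trace_diff by (metis eq_iff_diff_eq_0)
qed

lemma expansion_cong:
  assumes "rr p = rr q"
  shows "expansion p = expansion q"
proof -
  have "trace (p * y) = (trace (q * y) :: 'k poly2)" for y by (rule trace_cong[OF rr_mult[OF assms refl]])
  then show ?thesis unfolding expansion_def by (simp only:)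
qed

lemma expansion_basis:
  assumes j: "j \<le> 2 * n + 1"
  shows "expansion (basis_elt j) = basis_elt j" "expansion (X * basis_elt j) = X * basis_elt j"
proof -
  have one: "ev 1 = 1" using S.eval2_TC[of cpar upar 1] by (simp add: one_pCons)
  have p: "trace (basis_elt j * dual_elt i) = (0 :: 'k poly2)" "trace (t * (basis_elt j * dual_elt i)) = (0 :: 'k poly2)"
    "trace (X * (basis_elt j * dual_elt i)) = (if i = j then 1 else (0 :: 'k poly2))"
    "trace (Z * (basis_elt j * dual_elt i)) = - (if i = j then 1 else (0 :: 'k poly2))" if "i \<le> 2 * n + 1" for i
    using basis_dual_pairing[OF that j] by (auto simp: balanced_def)
  have e: "basis_elt j * - (Z * dual_elt i) = - (Z * (basis_elt j * dual_elt i))"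
    "X * basis_elt j * - (Z * dual_elt i) = - (t * (basis_elt j * dual_elt i))"
    "X * basis_elt j * dual_elt i = X * (basis_elt j * dual_elt i)" for i
    by (simp_all only: mult_minus_right mult.left_commute[of _ Z] mult.assoc)
  have "expansion (basis_elt j) = (\<Sum>i\<le>2 * n + 1. if i = j then basis_elt j else 0)"
    unfolding expansion_def e trace_uminus
    by (rule sum.cong[OF refl]) (simp add: p one)
  then show "expansion (basis_elt j) = basis_elt j" using j by simp
  have "expansion (X * basis_elt j) = (\<Sum>i\<le>2 * n + 1. if i = j then X * basis_elt j else 0)"
    unfolding expansion_def e trace_uminus
    by (rule sum.cong[OF refl]) (simp add: p one)
  then show "expansion (X * basis_elt j) = X * basis_elt j" using j by simp
qed

lemma gens_basis: "g \<in> gens \<Longrightarrow> \<exists>j\<le>2 * n + 1. g = basis_elt j"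
proof -
  assume "g \<in> gens"
  then consider "g = 1" | "g = t * Y 1" | i where "i \<in> {1..n}" "g = Y i" | i where "i \<in> {1..n}" "g = W i"
    by (auto simp: gens_def)
  then show ?thesis
  proof cases
    case 1
    then show ?thesis by (intro exI[of _ 0]) (simp add: basis_elt_def)
  next
    case 2
    then show ?thesis by (intro exI[of _ "2 * n + 1"]) (simp add: basis_elt_def)
  next
    case (3 i)
    then show ?thesis by (intro exI[of _ i]) (simp add: basis_elt_def)
  next
    case (4 i)
    then show ?thesis by (intro exI[of _ "n + i"]) (simp add: basis_elt_def)
  qed
qed

lemma expansion_B: "p \<in> Bc \<Longrightarrow> rr (expansion p) = rr p \<and> rr (expansion (X * p)) = rr (X * p)"
proof (induction rule: span_over.induct)
  case (gen g)
  then obtain j where j: "j \<le> 2 * n + 1" "g = basis_elt j" using gens_basis by blast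
  show ?case unfolding j(2) expansion_basis[OF j(1)] by simp
next
  case (add p q)
  show ?case
    unfolding expansion_add distrib_left
    by (intro conjI rr_add add.IH[THEN conjunct1] add.IH[THEN conjunct2])
next
  case (scale p k)
  show ?case
    unfolding mult.left_commute[of X "Poly_Mapping.single 0 k"] expansion_scale
    by (intro conjI rr_mult refl scale.IH[THEN conjunct1] scale.IH[THEN conjunct2])
next
  case (mult_c p)
  show ?case
    unfolding mult.left_commute[of X cpar] expansion_cpar
    by (intro conjI rr_mult refl mult_c.IH[THEN conjunct1] mult_c.IH[THEN conjunct2])
next
  case (mult_u p)
  show ?case
    unfolding mult.left_commute[of X upar] expansion_upar
    by (intro conjI rr_mult refl mult_u.IH[THEN conjunct1] mult_u.IH[THEN conjunct2])
next
  case (cong p q)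
  have "rr (X * q) = rr (X * p)" by (rule rr_mult[OF refl cong(2)])
  then show ?case using cong expansion_cong[of q p] expansion_cong[of "X * q" "X * p"] by simp
qed

lemma expansion: "rr p = rr (expansion p)"
proof -
  obtain a b where ab: "a \<in> Bc" "b \<in> Bc" "rr p = rr (a + X * b)" using N_all[of p] unfolding N_def by blast
  have "rr (expansion p) = rr (expansion a + expansion (X * b))"
    unfolding expansion_cong[OF ab(3)] expansion_add ..
  also have "\<dots> = rr (a + X * b)" using expansion_B ab by (intro rr_add) auto
  finally show ?thesis using ab(3) by simp
qed

lemma frobenius:
  "frobenius_presentation (Poly_Mapping.single 0) QQ rr cpar upar trace
    (\<lambda>(i, s). if s then X * basis_elt i else basis_elt i) (\<lambda>(i, s). if s then dual_elt i else - (Z * dual_elt i)) ({..2 * n + 1} \<times> UNIV)"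
proof -
  have lin: "S.klin trace"
    unfolding S.klin_def by (simp only: trace_add trace_scale simp_thms)
  have basis: "rr p = rr (\<Sum>j\<in>{..2 * n + 1} \<times> UNIV. ev (trace (p * (case j of (i, s) \<Rightarrow> if s then dual_elt i else - (Z * dual_elt i)))) *
    (case j of (i, s) \<Rightarrow> if s then X * basis_elt i else basis_elt i))" for p
  proof -
    have "(\<Sum>j\<in>{..2 * n + 1} \<times> UNIV. ev (trace (p * (case j of (i, s) \<Rightarrow> if s then dual_elt i else - (Z * dual_elt i)))) *
      (case j of (i, s) \<Rightarrow> if s then X * basis_elt i else basis_elt i)) = expansion p"
      unfolding expansion_def sum_times_bool by (simp only: prod.case if_True if_False)
    then show ?thesis using expansion[of p] by (simp only:)
  qed
  show ?thesis
    by (intro frobenius_presentation.intro frobenius_presentation_axioms.intro S.scalars_axioms Q_cring \<rho>_hom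
        \<rho>_image(2) lin trace_cpar trace_upar trace_ker basis) auto
qed

end

text \<open>
  The elements of an injective resolution over the localization have to be sets of pairs that consist of a natural
  number and a set of pairs of cosets. Pairs of maps from polynomials to \<open>T\<close> are embedded there by coding a map by its
  graph, and an element of \<open>T\<close> by the terms of a polynomial in two variables.
\<close>

definition poly2_code :: "'k::field poly2 \<Rightarrow> 'k dpoly set"
  where "poly2_code \<tau> = {Poly_Mapping.single (Poly_Mapping.single elt_x i + Poly_Mapping.single elt_z j) (coeff (coeff \<tau> i) j) | i j. True}"

lemma inj_poly2_code: "inj (poly2_code :: 'k::field poly2 \<Rightarrow> _)"
proof (rule injI)
  let ?m = "\<lambda>i j. Poly_Mapping.single elt_x i + Poly_Mapping.single elt_z j :: diamond \<Rightarrow>\<^sub>0 nat"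
  have m: "i = i' \<and> j = j'" if "?m i j = ?m i' j'" for i j i' j'
    using arg_cong[OF that, of "\<lambda>m. Poly_Mapping.lookup m elt_x"] arg_cong[OF that, of "\<lambda>m. Poly_Mapping.lookup m elt_z"]
    by (simp add: lookup_add lookup_single)
  have *: "coeff (coeff \<sigma> i) j = coeff (coeff \<tau> i) j"
    if eq: "poly2_code \<sigma> = poly2_code \<tau>" and nz: "coeff (coeff \<sigma> i) j \<noteq> 0" for \<sigma> \<tau> :: "'k poly2" and i j
  proof -
    have "Poly_Mapping.single (?m i j) (coeff (coeff \<sigma> i) j) \<in> poly2_code \<tau>"
      unfolding eq[symmetric] unfolding poly2_code_def by blast
    then obtain i' j' where e: "Poly_Mapping.single (?m i j) (coeff (coeff \<sigma> i) j) = Poly_Mapping.single (?m i' j') (coeff (coeff \<tau> i') j')"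
      unfolding poly2_code_def by blast
    have "Poly_Mapping.lookup (Poly_Mapping.single (?m i' j') (coeff (coeff \<tau> i') j')) (?m i j) = coeff (coeff \<sigma> i) j"
      unfolding e[symmetric] by simp
    then have "?m i' j' = ?m i j" "coeff (coeff \<tau> i') j' = coeff (coeff \<sigma> i) j"
      using nz by (auto simp: lookup_single when_def split: if_splits)
    then show ?thesis using m by metis
  qed
  fix \<sigma> \<tau> :: "'k poly2" assume eq: "poly2_code \<sigma> = poly2_code \<tau>"
  show "\<sigma> = \<tau>"
    unfolding poly_eq_iff using *[OF eq] *[OF eq[symmetric]] by metis
qed

definition graph_code :: "('k::field dpoly \<Rightarrow> 'k poly2) \<Rightarrow>
    ('k dpoly set \<times> 'k dpoly set) set"
  where "graph_code f = range (\<lambda>p. ({p}, poly2_code (f p)))"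

lemma inj_graph_code: "inj (graph_code :: ('k::field dpoly \<Rightarrow> 'k poly2) \<Rightarrow> _)"
proof (rule injI, rule ext)
  fix f g :: "'k dpoly \<Rightarrow> 'k poly2" and p
  assume "graph_code f = graph_code g"
  then have "({p}, poly2_code (f p)) \<in> graph_code g" unfolding graph_code_def by blast
  then show "f p = g p" unfolding graph_code_def using injD[OF inj_poly2_code] by auto
qed

lemma inj_pair_code: "inj (\<lambda>(f, g). {(0 :: nat, graph_code f), (1, graph_code g)})"
proof (rule injI, clarify)
  fix f g f' g' assume eq: "{(0 :: nat, graph_code f), (1, graph_code g)} = {(0, graph_code f'), (1, graph_code g')}"
  have "graph_code f = graph_code f'" "graph_code g = graph_code g'"
    using eq by (simp_all add: doubleton_eq_iff)
  then show "f = f' \<and> g = g'" using injD[OF inj_graph_code] by blast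
qed

theorem theorem1p6:
  fixes n :: nat
  assumes "n \<ge> 3"
  shows "gorenstein_ideal (diamond_ring n :: ((diamond \<Rightarrow>\<^sub>0 nat) \<Rightarrow>\<^sub>0 'k::field) ring) (diamond_ideal n)"
proof -
  interpret diamond_over n "TYPE('k)" by unfold_locales (rule assms)
  interpret frobenius_presentation "Poly_Mapping.single 0" QQ rr cpar upar trace
    "\<lambda>(i, s). if s then X * basis_elt i else basis_elt i" "\<lambda>(i, s). if s then dual_elt i else - (Z * dual_elt i)" "{..2 * n + 1} \<times> UNIV"
    by (rule frobenius)
  have "noetherian_ring QQ"
  proof (rule noetherian_ring_if_surjective_image[where \<rho> = rr])
    show "ring QQ" by (rule cring.axioms(1)[OF Q_cring])
    show "noetherian_subring (polys_in V :: 'k dpoly set)"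
      by (rule noetherian_polys_in) (simp add: diamond_lattice_def)
  qed (simp_all add: \<rho>_image \<rho>_hom)
  then have "gorenstein_ring QQ" by (rule gorenstein_ring[OF _ inj_pair_code])
  then show ?thesis unfolding gorenstein_ideal_def using DI_ideal by blast
qed

end
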